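(* Let $p>2$ and $\omega>0$. Then there exists a ground state to the equation $$-\partial_{xx}u+\partial_{yyyy}u+\omega u=|u|^{p-2}u\quad\text{in }\mathbb{R}^2.$$
   Context: $H^{1,2}(\mathbb{R}^2)$ is the completion of $C_0^\infty(\mathbb{R}^2)$ (complex-valued functions of $(x,y)$) under the norm $\|u\|_{H^{1,2}}=\|\partial_xu\|_2+\|\partial_{yy}u\|_2+\|u\|_2$. Solutions of the equation are (weak) solutions in $H^{1,2}(\mathbb{R}^2)$, i.e. critical points of $$J_\omega(u)=\frac12\int_{\mathbb{R}^2}|\partial_xu|^2\,dxdy+\frac12\int_{\mathbb{R}^2}|\partial_{yy}u|^2\,dxdy+\frac{\omega}{2}\int_{\mathbb{R}^2}|u|^2\,dxdy-\frac1p\int_{\mathbb{R}^2}|u|^p\,dxdy .$$ A ground state is a nontrivial solution $u\in H^{1,2}(\mathbb{R}^2)\setminus\{0\}$ that minimizes $J_\omega$ among all nontrivial solutions in $H^{1,2}(\mathbb{R}^2)$. *)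

theory Defs
  imports "HOL-Analysis.Analysis"
begin

definition partial_x :: "(real \<times> real \<Rightarrow> complex) \<Rightarrow> real \<times> real \<Rightarrow> complex" where
  "partial_x f = (\<lambda>(x, y). vector_derivative (\<lambda>t. f (t, y)) (at x))"

definition partial_y :: "(real \<times> real \<Rightarrow> complex) \<Rightarrow> real \<times> real \<Rightarrow> complex" where
  "partial_y f = (\<lambda>(x, y). vector_derivative (\<lambda>t. f (x, t)) (at y))"

fun C_k :: "nat \<Rightarrow> (real \<times> real \<Rightarrow> complex) \<Rightarrow> bool" where
  "C_k 0 f \<longleftrightarrow> continuous_on UNIV f"
| "C_k (Suc k) f \<longleftrightarrow> f differentiable_on UNIV \<and> C_k k (partial_x f) \<and> C_k k (partial_y f)"

definition test_function :: "(real \<times> real \<Rightarrow> complex) \<Rightarrow> bool" where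
  "test_function f \<longleftrightarrow> (\<forall>k. C_k k f) \<and> compact (closure {z. f z \<noteq> 0})"

definition square_integrable :: "(real \<times> real \<Rightarrow> complex) \<Rightarrow> bool" where
  "square_integrable f \<longleftrightarrow>
     f \<in> borel_measurable lborel \<and> integrable lborel (\<lambda>z. (cmod (f z))\<^sup>2)"

definition L2_norm :: "(real \<times> real \<Rightarrow> complex) \<Rightarrow> real" where
  "L2_norm f = sqrt (LINT z|lborel. (cmod (f z))\<^sup>2)"

text \<open>
  The completion of the test functions is realised inside \<open>L\<^sup>2\<close>: a sequence of test functions is
  Cauchy in the \<open>H\<^sup>1\<^sup>,\<^sup>2\<close> norm iff it, its \<open>x\<close>-derivatives and its second \<open>y\<close>-derivatives all
  converge in \<open>L\<^sup>2\<close>. The triple of limits \<open>(u, g, h)\<close> represents the corresponding point of the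
  completion. By integration by parts, \<open>u\<close> determines \<open>g\<close> and \<open>h\<close> almost everywhere (they are its
  weak derivatives), so that the point is represented by \<open>u\<close> alone. Elements are functions
  rather than classes of functions that agree almost everywhere.
\<close>

definition H12_limit ::
  "(real \<times> real \<Rightarrow> complex) \<Rightarrow> (real \<times> real \<Rightarrow> complex) \<Rightarrow> (real \<times> real \<Rightarrow> complex) \<Rightarrow> bool" where
  "H12_limit u g h \<longleftrightarrow>
     square_integrable u \<and> square_integrable g \<and> square_integrable h \<and>
     (\<exists>\<phi>. (\<forall>n. test_function (\<phi> n)) \<and>
        (\<lambda>n. L2_norm (\<lambda>z. \<phi> n z - u z)) \<longlonglongrightarrow> 0 \<and>
        (\<lambda>n. L2_norm (\<lambda>z. partial_x (\<phi> n) z - g z)) \<longlonglongrightarrow> 0 \<and>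
        (\<lambda>n. L2_norm (\<lambda>z. partial_y (partial_y (\<phi> n)) z - h z)) \<longlonglongrightarrow> 0)"

definition H12 :: "(real \<times> real \<Rightarrow> complex) set" where
  "H12 = {u. \<exists>g h. H12_limit u g h}"

text \<open>
  The continuous extensions of \<open>\<partial>\<^sub>x\<close> and \<open>\<partial>\<^sub>y\<^sub>y\<close> to the completion. The choice is immaterial up to
  null sets, and the values are used only under integrals.
\<close>

definition H12_dx :: "(real \<times> real \<Rightarrow> complex) \<Rightarrow> real \<times> real \<Rightarrow> complex" where
  "H12_dx u = (SOME g. \<exists>h. H12_limit u g h)"

definition H12_dyy :: "(real \<times> real \<Rightarrow> complex) \<Rightarrow> real \<times> real \<Rightarrow> complex" where
  "H12_dyy u = (SOME h. \<exists>g. H12_limit u g h)"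

definition H12_norm :: "(real \<times> real \<Rightarrow> complex) \<Rightarrow> real" where
  "H12_norm u = L2_norm (H12_dx u) + L2_norm (H12_dyy u) + L2_norm u"

definition J :: "real \<Rightarrow> real \<Rightarrow> (real \<times> real \<Rightarrow> complex) \<Rightarrow> real" where
  "J \<omega> p u =
     1 / 2 * (LINT z|lborel. (cmod (H12_dx u z))\<^sup>2)
   + 1 / 2 * (LINT z|lborel. (cmod (H12_dyy u z))\<^sup>2)
   + \<omega> / 2 * (LINT z|lborel. (cmod (u z))\<^sup>2)
   - 1 / p * (LINT z|lborel. cmod (u z) powr p)"

text \<open>
  A solution of \<open>- \<partial>\<^sub>x\<^sub>x u + \<partial>\<^sub>y\<^sub>y\<^sub>y\<^sub>y u + \<omega> u = |u|\<^sup>p\<^sup>-\<^sup>2 u\<close> is a critical point of \<open>J \<omega> p\<close>, i.e. a point of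
  \<open>H12\<close> at which the Frechet derivative (over the reals) of \<open>J \<omega> p\<close> exists and is zero. This is
  written out since \<open>H12\<close> is a set of functions with a seminorm and not a normed type.
\<close>

definition solution :: "real \<Rightarrow> real \<Rightarrow> (real \<times> real \<Rightarrow> complex) \<Rightarrow> bool" where
  "solution \<omega> p u \<longleftrightarrow> u \<in> H12 \<and>
     (\<forall>\<epsilon>>0. \<exists>\<delta>>0. \<forall>v\<in>H12. H12_norm v < \<delta> \<longrightarrow>
        \<bar>J \<omega> p (\<lambda>z. u z + v z) - J \<omega> p u\<bar> \<le> \<epsilon> * H12_norm v)"

definition nontrivial_solution :: "real \<Rightarrow> real \<Rightarrow> (real \<times> real \<Rightarrow> complex) \<Rightarrow> bool" where
  "nontrivial_solution \<omega> p u \<longleftrightarrow> solution \<omega> p u \<and> \<not> (AE z in lborel. u z = 0)"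

definition ground_state :: "real \<Rightarrow> real \<Rightarrow> (real \<times> real \<Rightarrow> complex) \<Rightarrow> bool" where
  "ground_state \<omega> p u \<longleftrightarrow> nontrivial_solution \<omega> p u \<and>
     (\<forall>v. nontrivial_solution \<omega> p v \<longrightarrow> J \<omega> p u \<le> J \<omega> p v)"

end

theory Submission
  imports Defs "HOL-Library.Function_Algebras" "HOL-Library.Diagonal_Subsequence"
begin

text \<open>
  Write \<open>E(u, v)\<close> for the symmetric form \<open>\<integral> \<partial>\<^sub>x u \<bullet> \<partial>\<^sub>x v + \<partial>\<^sub>y\<^sub>y u \<bullet> \<partial>\<^sub>y\<^sub>y v + \<omega> u \<bullet> v\<close>, \<open>N(u)\<close> for
  \<open>\<integral> |u|\<^sup>p\<close> and \<open>\<langle>f(u), v\<rangle>\<close> for \<open>\<integral> |u|\<^sup>p\<^sup>-\<^sup>2 u \<bullet> v\<close>, so that \<open>J(u) = E(u, u)/2 - N(u)/p\<close>. The ground state is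
  a rescaled extremal of the Sobolev inequality \<open>N(u) \<le> S E(u, u)\<^bsup>p/2\<^esup>\<close>.

  The symbol \<open>\<xi>\<^sup>2 + \<eta>\<^sup>4\<close> is strong enough in two dimensions for \<open>1/(1 + \<xi>\<^sup>2 + \<eta>\<^sup>4)\<close> to be
  integrable, which is why the energy space embeds into the bounded continuous functions. An
  elementary proof is in \<open>anisotropic_Sobolev\<close>: one integration in \<open>x\<close> bounds the \<open>L\<^sup>2\<close> norm of \<open>u\<close>
  and of \<open>\<partial>\<^sub>y u\<close> on every vertical line, and then one integration in \<open>y\<close> bounds \<open>u\<close> itself. Two
  things become easy in this way. First, \<open>|u|\<^sup>p \<le> (sup |u|)\<^sup>p\<^sup>-\<^sup>2 |u|\<^sup>2\<close>, so that \<open>N\<close> is bounded on the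
  unit ball for every \<open>p > 2\<close> and a maximizing sequence cannot become uniformly small. Secondly,
  point evaluations are bounded functionals, so that weak convergence implies pointwise
  convergence.

  Let \<open>S\<close> be the supremum of \<open>N\<close> over the test functions in the unit ball of \<open>E\<close>
  (\<open>best_const\<close>), and take a maximizing sequence \<open>u\<^sub>n\<close>. After translations, \<open>|u\<^sub>n(0)|\<close> is bounded
  below (\<open>maximizing_sequence\<close>), so that a weak limit \<open>u\<close> is not zero. Young's inequality in the form
  \<open>p \<langle>f(u\<^sub>n), w\<rangle> \<le> (p - 1) N(u\<^sub>n) + N(w)\<close> shows that the functional \<open>f(u\<^sub>n)\<close> has norm at most \<open>S\<close>, while
  its value at \<open>u\<^sub>n\<close> tends to \<open>S\<close>. In a Hilbert space this forces \<open>f(u\<^sub>n) - S E(u\<^sub>n, \<cdot>)\<close> to tend to zero,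
  and in the limit \<open>\<langle>f(u), v\<rangle> = S E(u, v)\<close> for all \<open>v\<close>. This equation shows that no energy was lost
  in the weak limit: the choice \<open>v = u\<close> gives \<open>S E(u, u) = N(u) \<le> S E(u, u)\<^bsup>p/2\<^esup>\<close>, which together with \<open>0 < E(u, u) \<le> 1\<close> and \<open>p > 2\<close>
  yields \<open>E(u, u) = 1\<close> (\<open>extremal_exists\<close>).

  The multiple \<open>c u\<close> with \<open>c\<^sup>p\<^sup>-\<^sup>2 = 1/S\<close> then satisfies \<open>\<langle>f(c u), v\<rangle> = E(c u, v)\<close> for all \<open>v\<close>, and since the
  remainder in the expansion of \<open>J\<close> is quadratic (\<open>J_expansion\<close>), it is a critical point.
  Conversely, differentiating \<open>J\<close> at any critical point \<open>v\<close> in the direction \<open>v\<close> gives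
  \<open>E(v, v) = N(v)\<close> (\<open>solution_Nehari\<close>), and with the Sobolev inequality \<open>E(v, v) \<ge> c\<^sup>2\<close> unless \<open>v = 0\<close>.
  On such points \<open>J(v) = (1/2 - 1/p) E(v, v)\<close>, so that \<open>c u\<close> has the least value.

  Weak compactness is proved for semi-inner products on spaces of functions, because the
  elements of the energy space are functions and not classes of functions.
\<close>

section \<open>Weak compactness for semi-inner products\<close>

instantiation "fun" :: (type, real_vector) real_vector
begin

definition "r *\<^sub>R f = (\<lambda>x. r *\<^sub>R f x)"

instance
  by standard (auto simp: scaleR_fun_def fun_eq_iff algebra_simps)

end

text \<open>
  The form lives on a subspace and may vanish on nonzero elements, as integrals of functions do on
  functions that are zero almost everywhere. Limits are therefore not unique.
\<close>

locale semi_inner_product =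
  fixes V :: "'a::real_vector set" and B :: "'a \<Rightarrow> 'a \<Rightarrow> real"
  assumes subspace_V: "subspace V"
    and sym: "u \<in> V \<Longrightarrow> v \<in> V \<Longrightarrow> B u v = B v u"
    and add_left: "u \<in> V \<Longrightarrow> v \<in> V \<Longrightarrow> w \<in> V \<Longrightarrow> B (u + v) w = B u w + B v w"
    and scale_left: "u \<in> V \<Longrightarrow> v \<in> V \<Longrightarrow> B (r *\<^sub>R u) v = r * B u v"
    and nonneg: "u \<in> V \<Longrightarrow> B u u \<ge> 0"
begin

definition nrm :: "'a \<Rightarrow> real" where
  "nrm u = sqrt (B u u)"

lemma mem_simps [simp, intro]:
  "0 \<in> V" "u \<in> V \<Longrightarrow> v \<in> V \<Longrightarrow> u + v \<in> V" "u \<in> V \<Longrightarrow> v \<in> V \<Longrightarrow> u - v \<in> V"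
  "u \<in> V \<Longrightarrow> r *\<^sub>R u \<in> V" "u \<in> V \<Longrightarrow> - u \<in> V"
  using subspace_V by (auto intro: subspace_0 subspace_add subspace_diff subspace_scale subspace_neg)

lemma add_right: "u \<in> V \<Longrightarrow> v \<in> V \<Longrightarrow> w \<in> V \<Longrightarrow> B w (u + v) = B w u + B w v"
  using sym add_left by simp

lemma scale_right: "u \<in> V \<Longrightarrow> v \<in> V \<Longrightarrow> B v (r *\<^sub>R u) = r * B v u"
  using sym scale_left by simp

lemma diff_left: "u \<in> V \<Longrightarrow> v \<in> V \<Longrightarrow> w \<in> V \<Longrightarrow> B (u - v) w = B u w - B v w"
  using add_left[of u "(-1) *\<^sub>R v" w] scale_left[of v w "-1"] by simp

lemma diff_right: "u \<in> V \<Longrightarrow> v \<in> V \<Longrightarrow> w \<in> V \<Longrightarrow> B w (u - v) = B w u - B w v"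
  using sym diff_left by simp

lemmas bilinear = add_left add_right scale_left scale_right diff_left diff_right

lemma nrm_zero [simp]: "nrm 0 = 0"
  using scale_left[of 0 0 0] by (simp add: nrm_def)

lemma nrm_nonneg: "u \<in> V \<Longrightarrow> nrm u \<ge> 0"
  using nonneg by (simp add: nrm_def)

lemma nrm_square: "u \<in> V \<Longrightarrow> (nrm u)\<^sup>2 = B u u"
  using nonneg by (simp add: nrm_def)

lemma Cauchy_Schwarz_square:
  assumes u: "u \<in> V" and v: "v \<in> V"
  shows "(B u v)\<^sup>2 \<le> B u u * B v v"
proof -
  have *: "0 \<le> B u u + 2 * t * B u v + t\<^sup>2 * B v v" for t
  proof -
    have "0 \<le> B (u + t *\<^sub>R v) (u + t *\<^sub>R v)"
      using u v by (intro nonneg) auto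
    also have "\<dots> = B u u + 2 * t * B u v + t\<^sup>2 * B v v"
      using u v by (simp add: bilinear sym[OF v u] algebra_simps power2_eq_square)
    finally show ?thesis .
  qed
  show ?thesis
  proof (cases "B v v = 0")
    case True
    have "B u v = 0"
    proof (rule ccontr)
      assume nz: "B u v \<noteq> 0"
      show False
        \<comment> \<open>If \<open>B v v\<close> vanishes, the quadratic is linear in \<open>t\<close>; this \<open>t\<close> gives it the value \<open>-1\<close>.\<close>
        using *[of "- (B u u + 1) / (2 * B u v)"] nz by (simp add: True field_simps)
    qed
    then show ?thesis by (simp add: True)
  next
    case False
    then have pos: "B v v > 0"
      using nonneg[OF v] by simp
    have "0 \<le> B u u - (B u v)\<^sup>2 / B v v"
      \<comment> \<open>the minimum of the quadratic\<close>
      using *[of "- B u v / B v v"] pos by (simp add: field_simps power2_eq_square)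
    then show ?thesis
      using pos by (simp add: field_simps)
  qed
qed

lemma Cauchy_Schwarz: "u \<in> V \<Longrightarrow> v \<in> V \<Longrightarrow> \<bar>B u v\<bar> \<le> nrm u * nrm v"
  using real_sqrt_le_mono[OF Cauchy_Schwarz_square[of u v]]
  by (simp add: nrm_def real_sqrt_mult)

lemma nrm_triangle:
  assumes u: "u \<in> V" and v: "v \<in> V"
  shows "nrm (u + v) \<le> nrm u + nrm v"
proof -
  have "(nrm (u + v))\<^sup>2 = (nrm u)\<^sup>2 + 2 * B u v + (nrm v)\<^sup>2"
    using u v by (simp add: nrm_square bilinear sym[OF v u])
  also have "\<dots> \<le> (nrm u + nrm v)\<^sup>2"
    using Cauchy_Schwarz[OF u v] by (simp add: power2_sum)
  finally show ?thesis
    by (rule power2_le_imp_le) (use u v in \<open>auto intro!: add_nonneg_nonneg nrm_nonneg\<close>)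
qed

lemma nrm_scale: "u \<in> V \<Longrightarrow> nrm (r *\<^sub>R u) = \<bar>r\<bar> * nrm u"
  by (simp add: nrm_def bilinear real_sqrt_mult flip: mult.assoc power2_eq_square)

lemma nrm_minus: "u \<in> V \<Longrightarrow> nrm (- u) = nrm u"
  using nrm_scale[of u "-1"] by simp

lemma nrm_diff_commute: "u \<in> V \<Longrightarrow> v \<in> V \<Longrightarrow> nrm (u - v) = nrm (v - u)"
  using nrm_minus[of "u - v"] by simp

lemma nrm_triangle_diff:
  "u \<in> V \<Longrightarrow> v \<in> V \<Longrightarrow> w \<in> V \<Longrightarrow> nrm (u - w) \<le> nrm (u - v) + nrm (v - w)"
  using nrm_triangle[of "u - v" "v - w"] by simp

lemma parallelogram:
  assumes "u \<in> V" "v \<in> V"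
  shows "B (u - v) (u - v) = 2 * B u u + 2 * B v v - 4 * B ((1/2) *\<^sub>R (u + v)) ((1/2) *\<^sub>R (u + v))"
  using assms by (simp add: bilinear algebra_simps)

lemma tendsto_B:
  assumes X: "\<And>n. X n \<in> V" and Y: "\<And>n. Y n \<in> V" and u: "u \<in> V" and v: "v \<in> V"
    and Xu: "(\<lambda>n. nrm (X n - u)) \<longlonglongrightarrow> 0" and Yv: "(\<lambda>n. nrm (Y n - v)) \<longlonglongrightarrow> 0"
  shows "(\<lambda>n. B (X n) (Y n)) \<longlonglongrightarrow> B u v"
proof -
  have "(\<lambda>n. B (X n) (Y n) - B u v) \<longlonglongrightarrow> 0"
  proof (rule Lim_null_comparison)
    have "\<bar>B (X n) (Y n) - B u v\<bar>
        \<le> nrm (X n - u) * nrm (Y n - v) + nrm (X n - u) * nrm v + nrm u * nrm (Y n - v)" for n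
    proof -
      have "B (X n) (Y n) - B u v = B (X n - u) (Y n - v) + B (X n - u) v + B u (Y n - v)"
        using X Y u v by (simp add: bilinear)
      also have "\<bar>\<dots>\<bar> \<le> \<bar>B (X n - u) (Y n - v)\<bar> + \<bar>B (X n - u) v\<bar> + \<bar>B u (Y n - v)\<bar>"
        by linarith
      also have "\<dots> \<le> nrm (X n - u) * nrm (Y n - v) + nrm (X n - u) * nrm v + nrm u * nrm (Y n - v)"
        using X Y u v by (intro add_mono Cauchy_Schwarz) auto
      finally show ?thesis .
    qed
    then show "\<forall>\<^sub>F n in sequentially. norm (B (X n) (Y n) - B u v)
        \<le> nrm (X n - u) * nrm (Y n - v) + nrm (X n - u) * nrm v + nrm u * nrm (Y n - v)"
      by simp
    show "(\<lambda>n. nrm (X n - u) * nrm (Y n - v) + nrm (X n - u) * nrm v + nrm u * nrm (Y n - v))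
        \<longlonglongrightarrow> 0"
      by (rule tendsto_eq_intros Xu Yv | simp)+
  qed
  then show ?thesis
    by (simp add: LIM_zero_cancel)
qed

definition bounded_functional :: "('a \<Rightarrow> real) \<Rightarrow> bool" where
  "bounded_functional L \<longleftrightarrow>
     (\<forall>u\<in>V. \<forall>v\<in>V. L (u + v) = L u + L v) \<and> (\<forall>u\<in>V. \<forall>r. L (r *\<^sub>R u) = r * L u) \<and>
     (\<exists>C. \<forall>u\<in>V. \<bar>L u\<bar> \<le> C * nrm u)"

lemma bounded_functional_diff:
  "bounded_functional L \<Longrightarrow> u \<in> V \<Longrightarrow> v \<in> V \<Longrightarrow> L (u - v) = L u - L v"
  unfolding bounded_functional_def
  by (metis mem_simps(2,3) add_diff_cancel_right' diff_add_cancel)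

lemma bounded_functional_B:
  assumes "v \<in> V"
  shows "bounded_functional (B v)"
  unfolding bounded_functional_def using assms Cauchy_Schwarz
  by (auto simp: bilinear intro!: exI[of _ "nrm v"])

lemma bounded_functional_tendsto:
  assumes L: "bounded_functional L" and X: "\<And>n. X n \<in> V" "u \<in> V"
    and Xu: "(\<lambda>n. nrm (X n - u)) \<longlonglongrightarrow> 0"
  shows "(\<lambda>n. L (X n)) \<longlonglongrightarrow> L u"
proof -
  obtain C where C: "\<bar>L v\<bar> \<le> C * nrm v" if "v \<in> V" for v
    using L unfolding bounded_functional_def by blast
  have "(\<lambda>n. L (X n) - L u) \<longlonglongrightarrow> 0"
  proof (rule Lim_null_comparison)
    show "\<forall>\<^sub>F n in sequentially. norm (L (X n) - L u) \<le> C * nrm (X n - u)"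
      using C X by (simp add: bounded_functional_diff[OF L, symmetric])
    show "(\<lambda>n. C * nrm (X n - u)) \<longlonglongrightarrow> 0"
      using tendsto_mult_left[OF Xu, of C] by simp
  qed
  then show ?thesis
    by (simp add: LIM_zero_cancel)
qed

end

text \<open>
  Midpoints suffice for the argument with the parallelogram law below and spare the bookkeeping of
  general convex combinations.
\<close>

inductive_set midpoint_hull :: "'a::real_vector set \<Rightarrow> 'a set" for A where
  base: "x \<in> A \<Longrightarrow> x \<in> midpoint_hull A"
| midpoint: "x \<in> midpoint_hull A \<Longrightarrow> y \<in> midpoint_hull A \<Longrightarrow> (1/2) *\<^sub>R (x + y) \<in> midpoint_hull A"

lemma midpoint_hull_mono: "A \<subseteq> A' \<Longrightarrow> midpoint_hull A \<subseteq> midpoint_hull A'"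
proof
  fix x assume "A \<subseteq> A'" "x \<in> midpoint_hull A"
  from this(2,1) show "x \<in> midpoint_hull A'"
    by induction (blast intro: midpoint_hull.intros)+
qed

locale semi_hilbert = semi_inner_product +
  assumes complete: "\<And>X. (\<And>n. X n \<in> V) \<Longrightarrow>
    (\<And>e. e > 0 \<Longrightarrow> \<exists>k. \<forall>m\<ge>k. \<forall>n\<ge>k. nrm (X m - X n) < e) \<Longrightarrow>
    \<exists>u\<in>V. (\<lambda>n. nrm (X n - u)) \<longlonglongrightarrow> 0"
begin

lemma midpoint_hull_subset: "A \<subseteq> V \<Longrightarrow> midpoint_hull A \<subseteq> V"
proof
  fix x assume "A \<subseteq> V" "x \<in> midpoint_hull A"
  from this(2,1) show "x \<in> V"
    by induction auto
qed

lemma functional_midpoint_hull_le: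
  assumes L: "bounded_functional L" and A: "A \<subseteq> V" and x: "x \<in> midpoint_hull A"
    and "\<And>a. a \<in> A \<Longrightarrow> \<bar>L a - c\<bar> \<le> e"
  shows "\<bar>L x - c\<bar> \<le> e"
  using x
proof induction
  case (base x)
  then show ?case using assms by blast
next
  case (midpoint x y)
  then have "x \<in> V" "y \<in> V"
    using midpoint_hull_subset[OF A] by auto
  then have "L ((1/2) *\<^sub>R (x + y)) = (L x + L y) / 2"
    using L by (simp add: bounded_functional_def)
  moreover have "\<bar>(L x + L y) / 2 - c\<bar> \<le> e"
    using midpoint.IH by argo
  ultimately show ?case by argo
qed

text \<open>
  Let \<open>d k\<close> be the least value of \<open>B x x\<close> on the midpoint hull \<open>K k\<close> of the tail from \<open>k\<close> on. The
  numbers \<open>d k\<close> increase and are bounded, so by the parallelogram law almost minimal elements of \<open>K k\<close>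
  form a Cauchy sequence. A functional that converges along the tails has almost its limit value on
  their hulls, and hence at the strong limit \<open>u\<close> of these elements. So \<open>u\<close> is the only candidate
  for a weak limit, up to elements of norm zero.
\<close>

lemma bounded_sequence_cluster:
  assumes X: "\<And>n. X n \<in> V" and bdd: "\<And>n. B (X n) (X n) \<le> C"
  obtains u x where "u \<in> V" "\<And>k. x k \<in> midpoint_hull (X ` {k..})"
    "(\<lambda>k. nrm (x k - u)) \<longlonglongrightarrow> 0"
    "\<And>L a. bounded_functional L \<Longrightarrow> (\<lambda>n. L (X n)) \<longlonglongrightarrow> a \<Longrightarrow> L u = a"
proof -
  define K where "K k = midpoint_hull (X ` {k..})" for k
  have KV: "K k \<subseteq> V" for k
    unfolding K_def using X by (intro midpoint_hull_subset) auto
  have K_anti: "K m \<subseteq> K k" if "k \<le> m" for k m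
    unfolding K_def using that by (intro midpoint_hull_mono) auto
  have XK: "X k \<in> K k" for k
    unfolding K_def by (intro midpoint_hull.base) auto
  define d where "d k = (INF x\<in>K k. B x x)" for k
  have bb: "bdd_below ((\<lambda>x. B x x) ` K k)" for k
    using KV nonneg by (intro bdd_belowI[of _ 0]) auto
  have d_le: "d k \<le> B x x" if "x \<in> K k" for k x
    unfolding d_def using bb that by (intro cINF_lower) auto
  have d_mono: "d k \<le> d m" if "k \<le> m" for k m
    unfolding d_def using K_anti[OF that] bb XK[of m] by (intro cINF_superset_mono) auto
  have d_C: "d k \<le> C" for k
    using d_le[OF XK, of k] bdd[of k] by linarith
  have "convergent d"
  proof (rule Bseq_mono_convergent)
    have "norm (d n) \<le> \<bar>C\<bar> + \<bar>d 0\<bar>" for n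
      using d_mono[of 0 n] d_C[of n] by simp
    then show "Bseq d" by (rule BseqI')
  qed (use d_mono in blast)
  then obtain D where D: "d \<longlonglongrightarrow> D"
    unfolding convergent_def by blast
  have "\<exists>x\<in>K k. B x x < d k + inverse (real (Suc k))" for k
  proof (rule ccontr)
    assume "\<not> ?thesis"
    then have "d k + inverse (real (Suc k)) \<le> d k"
      using XK[of k] unfolding d_def by (intro cINF_greatest) (auto simp: not_less)
    then show False by simp
  qed
  then obtain x where xK: "\<And>k. x k \<in> K k" and xd: "\<And>k. B (x k) (x k) < d k + inverse (real (Suc k))"
    by metis
  have xV: "x k \<in> V" for k
    using xK KV by blast
  have diff: "B (x m - x n) (x m - x n) \<le> 2 * (d m + inverse (real (Suc m))) + 2 * (d n + inverse (real (Suc n))) - 4 * d k"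
    if "k \<le> m" "k \<le> n" for k m n
  proof -
    have "(1/2) *\<^sub>R (x m + x n) \<in> K k"
      using xK[of m] xK[of n] K_anti[OF that(1)] K_anti[OF that(2)]
      unfolding K_def by (intro midpoint_hull.midpoint) auto
    from d_le[OF this] show ?thesis
      using parallelogram[OF xV xV, of m n] xd[of m] xd[of n] by argo
  qed
  have lim: "(\<lambda>m. d m + inverse (real (Suc m))) \<longlonglongrightarrow> D"
    using tendsto_add[OF D LIMSEQ_inverse_real_of_nat] by simp
  have "\<exists>k. \<forall>m\<ge>k. \<forall>n\<ge>k. nrm (x m - x n) < e" if "e > 0" for e
  proof -
    have e: "e\<^sup>2 / 16 > 0" using that by simp
    have "\<forall>\<^sub>F m in sequentially. \<bar>d m + inverse (real (Suc m)) - D\<bar> < e\<^sup>2 / 16 \<and> \<bar>d m - D\<bar> < e\<^sup>2 / 16"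
      using tendstoD[OF lim e] tendstoD[OF D e] by (simp add: dist_real_def eventually_conj_iff)
    then obtain k where k: "\<And>m. m \<ge> k \<Longrightarrow> \<bar>d m + inverse (real (Suc m)) - D\<bar> < e\<^sup>2 / 16 \<and> \<bar>d m - D\<bar> < e\<^sup>2 / 16"
      by (auto simp: eventually_sequentially)
    have aux: "s < E" if "s \<le> 2 * a + 2 * b - 4 * c" "\<bar>a - D\<bar> < E / 16" "\<bar>b - D\<bar> < E / 16"
      "\<bar>c - D\<bar> < E / 16" for a b c s E
      using that by linarith
    have "nrm (x m - x n) < e" if "m \<ge> k" "n \<ge> k" for m n
    proof -
      have "B (x m - x n) (x m - x n) < e\<^sup>2"
        using aux[OF diff[OF that]] k[of k] k[OF that(1)] k[OF that(2)] by blast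
      then have "nrm (x m - x n) < sqrt (e\<^sup>2)"
        unfolding nrm_def by (rule real_sqrt_less_mono)
      then show ?thesis using \<open>e > 0\<close> by simp
    qed
    then show ?thesis by blast
  qed
  then obtain u where u: "u \<in> V" "(\<lambda>k. nrm (x k - u)) \<longlonglongrightarrow> 0"
    using complete[of x] xV by blast
  have "L u = a" if L: "bounded_functional L" and La: "(\<lambda>n. L (X n)) \<longlonglongrightarrow> a" for L a
  proof -
    have "(\<lambda>k. L (x k)) \<longlonglongrightarrow> a"
    proof (rule LIMSEQ_I)
      fix e :: real assume "e > 0"
      then obtain k where k: "\<And>n. n \<ge> k \<Longrightarrow> \<bar>L (X n) - a\<bar> < e / 2"
        using LIMSEQ_D[OF La, of "e / 2"] by (auto simp: real_norm_def)
      have "norm (L (x n) - a) < e" if "n \<ge> k" for n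
      proof -
        have "\<bar>L y - a\<bar> \<le> e / 2" if "y \<in> X ` {n..}" for y
          using that k \<open>n \<ge> k\<close> by (force intro: less_imp_le)
        then have "\<bar>L (x n) - a\<bar> \<le> e / 2"
          using functional_midpoint_hull_le[OF L, of "X ` {n..}" "x n" a "e/2"] X xK[of n]
          unfolding K_def by blast
        then show ?thesis using \<open>e > 0\<close> by simp
      qed
      then show "\<exists>k. \<forall>n\<ge>k. norm (L (x n) - a) < e" by blast
    qed
    moreover have "(\<lambda>k. L (x k)) \<longlonglongrightarrow> L u"
      using bounded_functional_tendsto[OF L xV u] .
    ultimately show ?thesis
      using LIMSEQ_unique by blast
  qed
  then show ?thesis
    using that[of u x] u xK unfolding K_def by blast
qed

text \<open>
  A diagonal argument. Convergence of the Gram matrix identifies the limits that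
  \<open>bounded_sequence_cluster\<close> attaches to different subsequences.
\<close>

lemma gram_subsequence:
  assumes X: "\<And>n. X n \<in> V" and bdd: "\<And>n. B (X n) (X n) \<le> C"
  obtains r :: "nat \<Rightarrow> nat" where "strict_mono r" "\<And>m. convergent (\<lambda>n. B (X m) (X (r n)))"
proof -
  interpret subseqs "\<lambda>m s. convergent (\<lambda>n. B (X m) (X (s n)))"
  proof (unfold_locales)
    fix m and s :: "nat \<Rightarrow> nat" assume "strict_mono s"
    have "\<bar>B (X m) (X (s n))\<bar> \<le> C" for n
    proof -
      have C: "C \<ge> 0"
        using bdd[of m] nonneg[OF X, of m] by linarith
      have "\<bar>B (X m) (X (s n))\<bar> \<le> nrm (X m) * nrm (X (s n))"
        using Cauchy_Schwarz[OF X X] .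
      also have "\<dots> \<le> sqrt C * sqrt C"
        using bdd nonneg[OF X] C by (intro mult_mono) (auto simp: nrm_def)
      finally show ?thesis using C by simp
    qed
    then have "bounded (range (\<lambda>n. B (X m) (X (s n))))"
      by (auto simp: bounded_iff)
    then obtain l r where "strict_mono r" "((\<lambda>n. B (X m) (X (s n))) \<circ> r) \<longlonglongrightarrow> l"
      using bounded_imp_convergent_subsequence by blast
    then show "\<exists>r'. strict_mono r' \<and> convergent (\<lambda>n. B (X m) (X ((s \<circ> r') n)))"
      by (intro exI[of _ r]) (auto simp: convergent_def o_def)
  qed
  have "convergent (\<lambda>n. B (X m) (X (diagseq n)))" for m
  proof -
    have "convergent (\<lambda>n. B (X m) (X ((diagseq \<circ> (+) (Suc m)) n)))"
    proof (rule diagseq_holds)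
      fix s r :: "nat \<Rightarrow> nat" and k assume "strict_mono r" "convergent (\<lambda>n. B (X k) (X (s n)))"
      then show "convergent (\<lambda>n. B (X k) (X ((s \<circ> r) n)))"
        using convergent_subseq_convergent[of "\<lambda>n. B (X k) (X (s n))" r] by (simp add: o_def)
    qed
    then show ?thesis
      using convergent_ignore_initial_segment[of "\<lambda>n. B (X m) (X (diagseq n))" "Suc m"]
      by (simp add: o_def add.commute)
  qed
  then show ?thesis
    using that subseq_diagseq by blast
qed

text \<open>
  Along a subsequence with convergent Gram matrix, let \<open>u\<close> be the limit of averages of the sequence.
  If some functional \<open>L\<close> did not converge to \<open>L u\<close>, then it would converge to another value along a
  further subsequence, and averages of that one have a limit \<open>u'\<close> with \<open>L u' \<noteq> L u\<close>. But \<open>u - u'\<close> is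
  orthogonal to the sequence, because the Gram matrix converges, and it is a limit of linear
  combinations of the sequence. So its norm is zero.
\<close>

theorem weak_compactness:
  assumes X: "\<And>n. X n \<in> V" and bdd: "\<And>n. B (X n) (X n) \<le> C"
  obtains r :: "nat \<Rightarrow> nat" and u where "strict_mono r" "u \<in> V"
    "\<And>L. bounded_functional L \<Longrightarrow> (\<lambda>n. L (X (r n))) \<longlonglongrightarrow> L u"
proof -
  obtain r where r: "strict_mono r" and gram: "\<And>m. convergent (\<lambda>n. B (X m) (X (r n)))"
    using gram_subsequence[of X C, OF X bdd] by blast
  obtain u x where u: "u \<in> V" and x: "\<And>k. x k \<in> midpoint_hull ((\<lambda>n. X (r n)) ` {k..})"
    and xu: "(\<lambda>k. nrm (x k - u)) \<longlonglongrightarrow> 0"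
    and uL: "\<And>L a. bounded_functional L \<Longrightarrow> (\<lambda>n. L (X (r n))) \<longlonglongrightarrow> a \<Longrightarrow> L u = a"
    using bounded_sequence_cluster[of "\<lambda>n. X (r n)" C, OF X bdd] by blast
  have "(\<lambda>n. L (X (r n))) \<longlonglongrightarrow> L u" if L: "bounded_functional L" for L
  proof (rule ccontr)
    assume "\<not> ?thesis"
    then obtain e where e: "e > 0" "\<And>k. \<exists>n\<ge>k. \<bar>L (X (r n)) - L u\<bar> \<ge> e"
      unfolding LIMSEQ_def dist_real_def by (meson not_less)
    then have inf: "infinite {n. \<bar>L (X (r n)) - L u\<bar> \<ge> e}"
      unfolding infinite_nat_iff_unbounded_le by blast
    define s where "s = enumerate {n. \<bar>L (X (r n)) - L u\<bar> \<ge> e}"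
    have s: "strict_mono s" "\<And>n. \<bar>L (X (r (s n))) - L u\<bar> \<ge> e"
      using strict_mono_enumerate[OF inf] enumerate_in_set[OF inf] unfolding s_def by auto
    obtain c where c: "\<And>v. v \<in> V \<Longrightarrow> \<bar>L v\<bar> \<le> c * nrm v"
      using L unfolding bounded_functional_def by blast
    have "bounded (range (\<lambda>n. L (X (r (s n)))))"
    proof -
      have "\<bar>L (X n)\<bar> \<le> \<bar>c\<bar> * sqrt C" for n
      proof -
        have "\<bar>L (X n)\<bar> \<le> c * nrm (X n)" using c X by blast
        also have "\<dots> \<le> \<bar>c\<bar> * nrm (X n)" using nrm_nonneg[OF X] by (intro mult_right_mono) auto
        also have "\<dots> \<le> \<bar>c\<bar> * sqrt C" unfolding nrm_def using bdd by (intro mult_left_mono) auto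
        finally show ?thesis .
      qed
      then show ?thesis unfolding bounded_iff by auto
    qed
    then obtain a t where t: "strict_mono t" "(\<lambda>n. L (X (r (s (t n))))) \<longlonglongrightarrow> a"
      using bounded_imp_convergent_subsequence[of "\<lambda>n. L (X (r (s n)))"] by (auto simp: o_def)
    define q where "q n = s (t n)" for n
    have q: "strict_mono q" using s t unfolding q_def by (simp add: strict_mono_def)
    obtain u' x' where u': "u' \<in> V" and x': "\<And>k. x' k \<in> midpoint_hull ((\<lambda>n. X (r (q n))) ` {k..})"
      and xu': "(\<lambda>k. nrm (x' k - u')) \<longlonglongrightarrow> 0"
      and uL': "\<And>L a. bounded_functional L \<Longrightarrow> (\<lambda>n. L (X (r (q n)))) \<longlonglongrightarrow> a \<Longrightarrow> L u' = a"
      using bounded_sequence_cluster[of "\<lambda>n. X (r (q n))" C, OF X bdd] by blast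
    have xV: "x k \<in> V" "x' k \<in> V" for k
      using x[of k] x'[of k] midpoint_hull_subset[of "(\<lambda>n. X (r n)) ` {k..}"]
        midpoint_hull_subset[of "(\<lambda>n. X (r (q n))) ` {k..}"] X by auto
    have XX: "B (X m) (u - u') = 0" for m
    proof -
      obtain l where l: "(\<lambda>n. B (X m) (X (r n))) \<longlonglongrightarrow> l"
        using gram unfolding convergent_def by blast
      have "B (X m) u = l" "B (X m) u' = l"
        using uL[OF bounded_functional_B[OF X] l]
          uL'[OF bounded_functional_B[OF X], of m l] LIMSEQ_subseq_LIMSEQ[OF l q] by (auto simp: o_def)
      then show ?thesis using X u u' by (simp add: bilinear)
    qed
    have fu: "bounded_functional (B (u - u'))"
      using u u' by (intro bounded_functional_B) auto
    have hull0: "B (u - u') y = 0" if "y \<in> midpoint_hull (range X)" for y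
    proof -
      have "B (u - u') a = 0" if "a \<in> range X" for a
        using that X XX u u' sym[of "u - u'"] by auto
      then have "\<bar>B (u - u') y - 0\<bar> \<le> 0"
        by (intro functional_midpoint_hull_le[OF fu _ that]) (use X in auto)
      then show ?thesis by simp
    qed
    have "x k \<in> midpoint_hull (range X)" "x' k \<in> midpoint_hull (range X)" for k
      using x[of k] x'[of k] midpoint_hull_mono[of "(\<lambda>n. X (r n)) ` {k..}" "range X"]
        midpoint_hull_mono[of "(\<lambda>n. X (r (q n))) ` {k..}" "range X"] by auto
    then have "B (u - u') u = 0" "B (u - u') u' = 0"
      using bounded_functional_tendsto[OF fu xV(1) u xu] bounded_functional_tendsto[OF fu xV(2) u' xu']
      by (auto simp: hull0 LIMSEQ_const_iff)
    then have "nrm (u - u') = 0"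
      using u u' by (simp add: nrm_def bilinear)
    then have "L u = L u'"
      using c[of "u - u'"] bounded_functional_diff[OF L u u'] u u' by auto
    moreover have "L u' = a"
      using uL'[OF L] t unfolding q_def by blast
    moreover have "e \<le> \<bar>a - L u\<bar>"
      using tendsto_le[OF _ tendsto_rabs[OF tendsto_diff[OF t(2) tendsto_const]] tendsto_const, of e "L u"]
        s(2) by simp
    ultimately show False using e by simp
  qed
  then show ?thesis
    using that r u by blast
qed

end

section \<open>The space of square integrable functions\<close>

abbreviation L2 :: "(real \<times> real \<Rightarrow> complex) set" where
  "L2 \<equiv> {f. square_integrable f}"

definition L2_inner :: "(real \<times> real \<Rightarrow> complex) \<Rightarrow> (real \<times> real \<Rightarrow> complex) \<Rightarrow> real" where
  "L2_inner f g = (LINT z|lborel. f z \<bullet> g z)"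

lemma square_integrable_measurable [measurable_dest]:
  "square_integrable f \<Longrightarrow> f \<in> borel_measurable borel"
  by (simp add: square_integrable_def)

lemma integrable_norm_mult:
  assumes "square_integrable f" "square_integrable g"
  shows "integrable lborel (\<lambda>z. cmod (f z) * cmod (g z))"
proof (rule Bochner_Integration.integrable_bound)
  show "integrable lborel (\<lambda>z. (cmod (f z))\<^sup>2 + (cmod (g z))\<^sup>2)"
    using assms by (auto simp: square_integrable_def)
  show "AE z in lborel. norm (cmod (f z) * cmod (g z)) \<le> norm ((cmod (f z))\<^sup>2 + (cmod (g z))\<^sup>2)"
  proof (rule AE_I2)
    fix z
    have "2 * (cmod (f z) * cmod (g z)) \<le> (cmod (f z))\<^sup>2 + (cmod (g z))\<^sup>2"
      using sum_squares_bound[of "cmod (f z)" "cmod (g z)"] by simp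
    moreover have "0 \<le> cmod (f z) * cmod (g z)" by simp
    ultimately have "cmod (f z) * cmod (g z) \<le> (cmod (f z))\<^sup>2 + (cmod (g z))\<^sup>2"
      by argo
    then show "norm (cmod (f z) * cmod (g z)) \<le> norm ((cmod (f z))\<^sup>2 + (cmod (g z))\<^sup>2)"
      by simp
  qed
qed (use assms in \<open>auto simp: square_integrable_def\<close>)

lemma integrable_inner:
  assumes "square_integrable f" "square_integrable g"
  shows "integrable lborel (\<lambda>z. f z \<bullet> g z)"
  using integrable_norm_mult[OF assms]
  by (rule Bochner_Integration.integrable_bound)
    (use assms in \<open>auto simp: square_integrable_def abs_mult Cauchy_Schwarz_ineq2\<close>)

lemma square_integrable_add:
  assumes "square_integrable f" "square_integrable g"
  shows "square_integrable (\<lambda>z. f z + g z)"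
proof -
  have "integrable lborel (\<lambda>z. (cmod (f z))\<^sup>2 + 2 * (f z \<bullet> g z) + (cmod (g z))\<^sup>2)"
    using assms integrable_inner[OF assms] by (auto simp: square_integrable_def)
  moreover have "(cmod (f z + g z))\<^sup>2 = (cmod (f z))\<^sup>2 + 2 * (f z \<bullet> g z) + (cmod (g z))\<^sup>2" for z
    by (simp add: power2_norm_eq_inner inner_add inner_commute)
  ultimately show ?thesis
    using assms by (auto simp: square_integrable_def)
qed

lemma square_integrable_scale:
  "square_integrable f \<Longrightarrow> square_integrable (\<lambda>z. r *\<^sub>R f z)"
  by (auto simp: square_integrable_def power_mult_distrib)

lemma square_integrable_cong_AE:
  assumes "square_integrable f" "AE z in lborel. f z = g z" "g \<in> borel_measurable borel"
  shows "square_integrable g"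
proof -
  have "integrable lborel (\<lambda>z. (cmod (g z))\<^sup>2) \<longleftrightarrow> integrable lborel (\<lambda>z. (cmod (f z))\<^sup>2)"
    using assms by (intro integrable_cong_AE) (auto simp: square_integrable_def)
  then show ?thesis
    using assms by (simp add: square_integrable_def)
qed

interpretation L2: semi_inner_product L2 L2_inner
proof
  show "subspace L2"
    by (auto simp: subspace_def plus_fun_def zero_fun_def scaleR_fun_def square_integrable_add
        square_integrable_scale) (simp add: square_integrable_def)
qed (auto simp: L2_inner_def plus_fun_def scaleR_fun_def inner_add integrable_inner
    intro: Bochner_Integration.integral_cong inner_commute)

lemmas square_integrable_simps [simp, intro] = L2.mem_simps[unfolded mem_Collect_eq]

lemma L2_nrm_eq: "L2.nrm f = L2_norm f"
  by (simp add: L2.nrm_def L2_norm_def L2_inner_def power2_norm_eq_inner)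

lemma L2_norm_eq_nrm_diff: "L2_norm (\<lambda>z. f z - g z) = L2.nrm (f - g)"
  by (simp add: L2_nrm_eq fun_diff_def)

lemma L2_inner_self: "L2_inner f f = (LINT z|lborel. (cmod (f z))\<^sup>2)"
  by (simp add: L2_inner_def power2_norm_eq_inner)

lemma L2_inner_cong_AE:
  assumes "square_integrable f" "square_integrable f'" "square_integrable g" "square_integrable g'"
    and "AE z in lborel. f z = f' z" "AE z in lborel. g z = g' z"
  shows "L2_inner f g = L2_inner f' g'"
  unfolding L2_inner_def
  by (rule integral_cong_AE)
    (use assms in \<open>auto simp: square_integrable_def elim: AE_mp\<close>)

lemma L2_norm_eq_0_imp_AE:
  assumes "square_integrable f" "L2_norm f = 0"
  shows "AE z in lborel. f z = 0"
proof -
  have "(LINT z|lborel. (cmod (f z))\<^sup>2) = 0"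
    using assms by (simp add: L2_norm_def)
  then show ?thesis
    using assms integral_nonneg_eq_0_iff_AE[of lborel "\<lambda>z. (cmod (f z))\<^sup>2"]
    by (simp add: square_integrable_def)
qed

text \<open>
  The weights \<open>4\<^sup>n\<close> leave the sum of the squared increments integrable. Where it is finite, the
  increments are at most a multiple of \<open>2\<^sup>-\<^sup>n\<close>.
\<close>

lemma AE_convergent_if_fast:
  assumes f: "\<And>n. square_integrable (f n)"
    and fast: "\<And>n. (LINT z|lborel. (cmod (f (Suc n) z - f n z))\<^sup>2) \<le> (1/16) ^ n"
  shows "AE z in lborel. convergent (\<lambda>n. f n z)"
proof -
  have sqd: "square_integrable (\<lambda>z. f (Suc n) z - f n z)" for n
    using L2.mem_simps(3)[of "f (Suc n)" "f n"] f by (simp add: fun_diff_def)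
  have "(\<integral>\<^sup>+z. (\<Sum>n. ennreal (4 ^ n * (cmod (f (Suc n) z - f n z))\<^sup>2)) \<partial>lborel)
      = (\<Sum>n. \<integral>\<^sup>+z. ennreal (4 ^ n * (cmod (f (Suc n) z - f n z))\<^sup>2) \<partial>lborel)"
    by (rule nn_integral_suminf) (use f in measurable)
  also have "\<dots> \<le> (\<Sum>n. ennreal ((1/4) ^ n))"
  proof (rule suminf_le)
    fix n
    have "(\<integral>\<^sup>+z. ennreal (4 ^ n * (cmod (f (Suc n) z - f n z))\<^sup>2) \<partial>lborel)
        = ennreal (LINT z|lborel. 4 ^ n * (cmod (f (Suc n) z - f n z))\<^sup>2)"
      using sqd[of n] by (intro nn_integral_eq_integral) (auto simp: square_integrable_def)
    also have "\<dots> \<le> ennreal ((1/4) ^ n)"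
    proof (rule ennreal_leI)
      have "(LINT z|lborel. 4 ^ n * (cmod (f (Suc n) z - f n z))\<^sup>2) \<le> 4 ^ n * (1/16) ^ n"
        using fast[of n] by simp
      also have "\<dots> = (1/4 :: real) ^ n"
        by (simp flip: power_mult_distrib)
      finally show "(LINT z|lborel. 4 ^ n * (cmod (f (Suc n) z - f n z))\<^sup>2) \<le> (1/4) ^ n" .
    qed
    finally show "(\<integral>\<^sup>+z. ennreal (4 ^ n * (cmod (f (Suc n) z - f n z))\<^sup>2) \<partial>lborel) \<le> ennreal ((1/4) ^ n)" .
  qed auto
  also have "\<dots> = ennreal (\<Sum>n. (1/4) ^ n)"
    by (rule suminf_ennreal2) (auto intro: summable_geometric)
  also have "\<dots> < \<infinity>" by simp
  finally have fin: "(\<integral>\<^sup>+z. (\<Sum>n. ennreal (4 ^ n * (cmod (f (Suc n) z - f n z))\<^sup>2)) \<partial>lborel) < \<infinity>" .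
  have "AE z in lborel. (\<Sum>n. ennreal (4 ^ n * (cmod (f (Suc n) z - f n z))\<^sup>2)) \<noteq> \<infinity>"
  proof (rule nn_integral_PInf_AE)
    show "(\<lambda>z. \<Sum>n. ennreal (4 ^ n * (cmod (f (Suc n) z - f n z))\<^sup>2)) \<in> borel_measurable lborel"
      using f by measurable
    show "(\<integral>\<^sup>+z. (\<Sum>n. ennreal (4 ^ n * (cmod (f (Suc n) z - f n z))\<^sup>2)) \<partial>lborel) \<noteq> \<infinity>"
      using fin by (simp only: less_top infinity_ennreal_def)
  qed
  then show ?thesis
  proof (rule AE_mp, intro AE_I2 impI)
    fix z assume elim: "(\<Sum>n. ennreal (4 ^ n * (cmod (f (Suc n) z - f n z))\<^sup>2)) \<noteq> \<infinity>"
    define F where "F n = ennreal (4 ^ n * (cmod (f (Suc n) z - f n z))\<^sup>2)" for n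
    have "suminf F \<noteq> \<infinity>"
      using elim unfolding F_def .
    then obtain c where c: "c \<ge> 0" "suminf F = ennreal c"
      by (metis ennreal_cases infinity_ennreal_def)
    have "cmod (f (Suc n) z - f n z) \<le> sqrt c * (1/2) ^ n" for n
    proof -
      have "sum F {n} \<le> suminf F"
        by (rule sum_le_suminf) auto
      then have "ennreal (4 ^ n * (cmod (f (Suc n) z - f n z))\<^sup>2) \<le> ennreal c"
        unfolding c(2) by (simp add: F_def)
      then have "4 ^ n * (cmod (f (Suc n) z - f n z))\<^sup>2 \<le> c"
        using c(1) by (subst (asm) ennreal_le_iff) auto
      then have "(2 ^ n * cmod (f (Suc n) z - f n z))\<^sup>2 \<le> c"
        using power_even_eq[of "2::real" n] by (simp add: power_mult_distrib power_mult)
      then have "2 ^ n * cmod (f (Suc n) z - f n z) \<le> sqrt c"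
        by (rule real_le_rsqrt)
      then show ?thesis
        by (simp add: power_one_over field_simps)
    qed
    moreover have "summable (\<lambda>n. sqrt c * (1/2) ^ n)"
      by (intro summable_mult summable_geometric) simp
    ultimately have "summable (\<lambda>n. f (Suc n) z - f n z)"
      using summable_comparison_test'[of "\<lambda>n. sqrt c * (1/2) ^ n" 0 "\<lambda>n. f (Suc n) z - f n z"]
      by blast
    then have "convergent (\<lambda>n. \<Sum>i<n. f (Suc i) z - f i z)"
      by (simp add: summable_iff_convergent)
    then have "convergent (\<lambda>n. f n z - f 0 z)"
      using sum_lessThan_telescope[of "\<lambda>n. f n z"] by simp
    then show "convergent (\<lambda>n. f n z)"
      by (simp add: convergent_diff_const_right_iff)
  qed
qed

lemma L2_Cauchy_subsequence:
  assumes f: "\<And>n. square_integrable (f n)"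
    and Cau: "\<And>e. e > 0 \<Longrightarrow> \<exists>k. \<forall>m\<ge>k. \<forall>n\<ge>k. L2.nrm (f m - f n) < e"
  obtains r :: "nat \<Rightarrow> nat" where "strict_mono r" "AE z in lborel. convergent (\<lambda>n. f (r n) z)"
proof -
  have "\<exists>k. \<forall>m\<ge>k. \<forall>n\<ge>k. L2.nrm (f m - f n) < (1/4) ^ j" for j
    by (rule Cau) simp
  then obtain k where k: "\<And>j m n. m \<ge> k j \<Longrightarrow> n \<ge> k j \<Longrightarrow> L2.nrm (f m - f n) < (1/4) ^ j"
    by metis
  \<comment> \<open>a strictly increasing majorant of \<open>k\<close>\<close>
  define r where "r n = (\<Sum>i\<le>n. Suc (k i))" for n
  have r: "strict_mono r"
    by (auto simp: strict_mono_Suc_iff r_def)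
  have rk: "r n \<ge> k n" for n
    by (cases n) (auto simp: r_def)
  have "(LINT z|lborel. (cmod (f (r (Suc n)) z - f (r n) z))\<^sup>2) \<le> (1/16) ^ n" for n
  proof -
    have rr: "r (Suc n) \<ge> k n"
      using rk[of n] strict_monoD[OF r, of n "Suc n"] by simp
    have "L2.nrm (f (r (Suc n)) - f (r n)) \<le> (1/4) ^ n"
      using k[OF rr rk[of n]] by simp
    then have "(L2.nrm (f (r (Suc n)) - f (r n)))\<^sup>2 \<le> ((1/4) ^ n)\<^sup>2"
      using f by (intro power_mono L2.nrm_nonneg) auto
    also have "\<dots> = (1/16) ^ n"
      by (simp add: power2_eq_square flip: power_mult_distrib)
    also have "(L2.nrm (f (r (Suc n)) - f (r n)))\<^sup>2 = (LINT z|lborel. (cmod (f (r (Suc n)) z - f (r n) z))\<^sup>2)"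
      using f by (subst L2.nrm_square) (auto simp: L2_inner_self)
    finally show ?thesis .
  qed
  then have "AE z in lborel. convergent (\<lambda>n. f (r n) z)"
    by (intro AE_convergent_if_fast[of "\<lambda>n. f (r n)"] f)
  then show ?thesis using that r by blast
qed

text \<open>
  Riesz and Fischer: a rapidly convergent subsequence has a limit almost everywhere, and Fatou's
  lemma makes it the limit in \<open>L\<^sup>2\<close> of the whole sequence.
\<close>

lemma L2_complete:
  assumes f: "\<And>n. square_integrable (f n)"
    and Cau: "\<And>e. e > 0 \<Longrightarrow> \<exists>k. \<forall>m\<ge>k. \<forall>n\<ge>k. L2.nrm (f m - f n) < e"
  obtains g r where "square_integrable g" "(\<lambda>n. L2.nrm (f n - g)) \<longlonglongrightarrow> 0"
    "strict_mono (r :: nat \<Rightarrow> nat)" "AE z in lborel. (\<lambda>n. f (r n) z) \<longlonglongrightarrow> g z"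
proof -
  obtain r where r: "strict_mono r" and conv: "AE z in lborel. convergent (\<lambda>n. f (r n) z)"
    using L2_Cauchy_subsequence[OF f Cau] by blast
  have fm [measurable]: "f n \<in> borel_measurable borel" for n
    using f by (simp add: square_integrable_def)
  define g where "g z = lim (\<lambda>n. f (r n) z)" for z
  have gm [measurable]: "g \<in> borel_measurable borel"
    unfolding g_def by measurable
  have lim: "AE z in lborel. (\<lambda>n. f (r n) z) \<longlonglongrightarrow> g z"
    using conv by eventually_elim (simp add: g_def convergent_LIMSEQ_iff)
  have tail: "\<exists>k. \<forall>m\<ge>k. integrable lborel (\<lambda>z. (cmod (f m z - g z))\<^sup>2)
      \<and> (LINT z|lborel. (cmod (f m z - g z))\<^sup>2) \<le> e\<^sup>2" if e: "e > 0" for e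
  proof -
    obtain k where k: "\<And>m n. m \<ge> k \<Longrightarrow> n \<ge> k \<Longrightarrow> L2.nrm (f m - f n) < e"
      using Cau[OF e] by blast
    have "integrable lborel (\<lambda>z. (cmod (f m z - g z))\<^sup>2)
      \<and> (LINT z|lborel. (cmod (f m z - g z))\<^sup>2) \<le> e\<^sup>2" if m: "m \<ge> k" for m
    proof -
      have bound: "(\<integral>\<^sup>+z. ennreal ((cmod (f m z - f (r n) z))\<^sup>2) \<partial>lborel) \<le> ennreal (e\<^sup>2)" if "n \<ge> k" for n
      proof -
        have rn: "r n \<ge> k"
          using that strict_mono_imp_increasing[OF r, of n] by linarith
        have sq: "square_integrable (\<lambda>z. f m z - f (r n) z)"
          using L2.mem_simps(3)[of "f m" "f (r n)"] f by (simp add: fun_diff_def)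
        have "(\<integral>\<^sup>+z. ennreal ((cmod (f m z - f (r n) z))\<^sup>2) \<partial>lborel)
            = ennreal (LINT z|lborel. (cmod (f m z - f (r n) z))\<^sup>2)"
          using sq by (intro nn_integral_eq_integral) (auto simp: square_integrable_def)
        also have "(LINT z|lborel. (cmod (f m z - f (r n) z))\<^sup>2) = (L2.nrm (f m - f (r n)))\<^sup>2"
          using f by (subst L2.nrm_square) (auto simp: L2_inner_self)
        also have "ennreal \<dots> \<le> ennreal (e\<^sup>2)"
          using k[OF m rn] f by (intro ennreal_leI power_mono L2.nrm_nonneg) auto
        finally show ?thesis .
      qed
      have "(\<integral>\<^sup>+z. ennreal ((cmod (f m z - g z))\<^sup>2) \<partial>lborel)
          = (\<integral>\<^sup>+z. liminf (\<lambda>n. ennreal ((cmod (f m z - f (r n) z))\<^sup>2)) \<partial>lborel)"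
      proof (rule nn_integral_cong_AE)
        show "AE z in lborel. ennreal ((cmod (f m z - g z))\<^sup>2)
            = liminf (\<lambda>n. ennreal ((cmod (f m z - f (r n) z))\<^sup>2))"
          using lim
        proof eventually_elim
          case (elim z)
          have "(\<lambda>n. ennreal ((cmod (f m z - f (r n) z))\<^sup>2)) \<longlonglongrightarrow> ennreal ((cmod (f m z - g z))\<^sup>2)"
            by (intro tendsto_intros tendsto_ennrealI elim)
          then show ?case
            by (rule lim_imp_Liminf[OF trivial_limit_sequentially, symmetric])
        qed
      qed
      also have "\<dots> \<le> liminf (\<lambda>n. \<integral>\<^sup>+z. ennreal ((cmod (f m z - f (r n) z))\<^sup>2) \<partial>lborel)"
        by (rule nn_integral_liminf) measurable
      also have "\<dots> \<le> limsup (\<lambda>n. \<integral>\<^sup>+z. ennreal ((cmod (f m z - f (r n) z))\<^sup>2) \<partial>lborel)"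
        by (rule Liminf_le_Limsup) simp
      also have "\<dots> \<le> ennreal (e\<^sup>2)"
        using bound by (intro Limsup_bounded) (auto simp: eventually_sequentially)
      finally have *: "(\<integral>\<^sup>+z. ennreal ((cmod (f m z - g z))\<^sup>2) \<partial>lborel) \<le> ennreal (e\<^sup>2)" .
      have int: "integrable lborel (\<lambda>z. (cmod (f m z - g z))\<^sup>2)"
        by (rule integrableI_bounded) (use * in \<open>auto simp: top_unique less_top[symmetric]\<close>)
      then have "ennreal (LINT z|lborel. (cmod (f m z - g z))\<^sup>2) \<le> ennreal (e\<^sup>2)"
        using * by (subst nn_integral_eq_integral[symmetric]) auto
      then have "(LINT z|lborel. (cmod (f m z - g z))\<^sup>2) \<le> e\<^sup>2"
        by (subst (asm) ennreal_le_iff) auto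
      then show ?thesis using int by blast
    qed
    then show ?thesis by blast
  qed
  obtain k where "integrable lborel (\<lambda>z. (cmod (f k z - g z))\<^sup>2)"
    using tail[of 1] by auto
  then have "square_integrable (\<lambda>z. f k z - g z)"
    by (simp add: square_integrable_def)
  then have "square_integrable (f k - (\<lambda>z. f k z - g z))"
    using L2.mem_simps(3)[of "f k" "\<lambda>z. f k z - g z"] f by simp
  then have g: "square_integrable g"
    by (simp add: fun_diff_def)
  have "(\<lambda>n. L2.nrm (f n - g)) \<longlonglongrightarrow> 0"
  proof (rule LIMSEQ_I)
    fix e :: real assume e: "e > 0"
    then obtain k where k: "\<And>m. m \<ge> k \<Longrightarrow> (LINT z|lborel. (cmod (f m z - g z))\<^sup>2) \<le> (e/2)\<^sup>2"
      using tail[of "e/2"] by auto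
    have "norm (L2.nrm (f m - g) - 0) < e" if "m \<ge> k" for m
    proof -
      have "(L2.nrm (f m - g))\<^sup>2 \<le> (e/2)\<^sup>2"
        using k[OF that] f g by (subst L2.nrm_square) (auto simp: L2_inner_self)
      then have "L2.nrm (f m - g) \<le> e/2"
        by (rule power2_le_imp_le) (use e in simp)
      then show ?thesis
        using e f g L2.nrm_nonneg[of "f m - g"] by simp
    qed
    then show "\<exists>k. \<forall>n\<ge>k. norm (L2.nrm (f n - g) - 0) < e" by blast
  qed
  then show ?thesis using that g r lim by blast
qed

lemma L2_limit_AE_subsequence:
  assumes f: "\<And>n. square_integrable (f n)" and g: "square_integrable g"
    and lim: "(\<lambda>n. L2_norm (\<lambda>z. f n z - g z)) \<longlonglongrightarrow> 0"
  obtains r :: "nat \<Rightarrow> nat" where "strict_mono r" "AE z in lborel. (\<lambda>n. f (r n) z) \<longlonglongrightarrow> g z"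
proof -
  have lim': "(\<lambda>n. L2.nrm (f n - g)) \<longlonglongrightarrow> 0"
    using lim by (simp add: L2_norm_eq_nrm_diff)
  have Cau: "\<exists>k. \<forall>m\<ge>k. \<forall>n\<ge>k. L2.nrm (f m - f n) < e" if e: "e > 0" for e
  proof -
    obtain k where k: "\<And>n. n \<ge> k \<Longrightarrow> L2.nrm (f n - g) < e/2"
      using order_tendstoD(2)[OF lim', of "e/2"] e by (auto simp: eventually_sequentially)
    have "L2.nrm (f m - f n) < e" if "m \<ge> k" "n \<ge> k" for m n
      using L2.nrm_triangle_diff[of "f m" g "f n"] L2.nrm_diff_commute[of g "f n"] f g
        k[OF that(1)] k[OF that(2)] by simp
    then show ?thesis by blast
  qed
  obtain g' r where g': "square_integrable g'" "(\<lambda>n. L2.nrm (f n - g')) \<longlonglongrightarrow> 0"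
    and r: "strict_mono (r :: nat \<Rightarrow> nat)" "AE z in lborel. (\<lambda>n. f (r n) z) \<longlonglongrightarrow> g' z"
    by (rule L2_complete[OF f Cau]) blast+
  have "L2.nrm (g - g') \<le> 0"
  proof (rule tendsto_le[OF _ _ tendsto_const])
    show "(\<lambda>n. L2.nrm (f n - g) + L2.nrm (f n - g')) \<longlonglongrightarrow> 0"
      using tendsto_add[OF lim' g'(2)] by simp
    show "\<forall>\<^sub>F n in sequentially. L2.nrm (g - g') \<le> L2.nrm (f n - g) + L2.nrm (f n - g')"
    proof (rule eventuallyI)
      fix n
      show "L2.nrm (g - g') \<le> L2.nrm (f n - g) + L2.nrm (f n - g')"
        using L2.nrm_triangle_diff[of g "f n" g'] L2.nrm_diff_commute[of g "f n"] f g g'(1) by simp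
    qed
  qed simp
  then have "L2_norm (g - g') = 0"
    using L2.nrm_nonneg[of "g - g'"] g g'(1) by (simp flip: L2_nrm_eq)
  then have "AE z in lborel. (g - g') z = 0"
    using g g'(1) by (intro L2_norm_eq_0_imp_AE[of "g - g'"]) auto
  then have "AE z in lborel. (\<lambda>n. f (r n) z) \<longlonglongrightarrow> g z"
    using r(2) by eventually_elim simp
  then show ?thesis using that r by blast
qed

section \<open>Test functions and integration by parts\<close>

definition Cc :: "('a::euclidean_space \<Rightarrow> 'b::euclidean_space) \<Rightarrow> bool" where
  "Cc f \<longleftrightarrow> continuous_on UNIV f \<and> (\<exists>R. \<forall>z. R \<le> norm z \<longrightarrow> f z = 0)"

lemma Cc_integrable:
  assumes "Cc f"
  shows "integrable lborel f"
proof -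
  obtain R where R: "\<And>z. R \<le> norm z \<Longrightarrow> f z = 0" and cont: "continuous_on UNIV f"
    using assms unfolding Cc_def by blast
  have "integrable lborel (\<lambda>z. indicator (cball 0 R) z *\<^sub>R f z)"
    using cont continuous_on_subset by (intro borel_integrable_compact) auto
  also have "(\<lambda>z. indicator (cball 0 R) z *\<^sub>R f z) = f"
    using R by (auto simp: indicator_def fun_eq_iff)
  finally show ?thesis .
qed

lemma Cc_compose0:
  assumes "Cc f" "continuous_on UNIV h" "h 0 = 0"
  shows "Cc (\<lambda>z. h (f z))"
  using assms unfolding Cc_def by (metis UNIV_I continuous_on_compose2 subsetI)

lemma Cc_add:
  assumes "Cc f" "Cc g"
  shows "Cc (\<lambda>z. f z + g z)"
proof -
  obtain R R' where "\<And>z. R \<le> norm z \<Longrightarrow> f z = 0" "\<And>z. R' \<le> norm z \<Longrightarrow> g z = 0"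
    using assms unfolding Cc_def by blast
  then have "\<forall>z. max R R' \<le> norm z \<longrightarrow> f z + g z = 0" by simp
  then show ?thesis
    using assms unfolding Cc_def by (blast intro: continuous_on_add)
qed

lemma Cc_inner:
  assumes "Cc f" "Cc g"
  shows "Cc (\<lambda>z. f z \<bullet> g z)"
  using assms unfolding Cc_def by (metis continuous_on_inner inner_zero_left)

lemma Cc_norm_square: "Cc f \<Longrightarrow> Cc (\<lambda>z. (norm (f z))\<^sup>2)"
  using Cc_inner[of f f] by (simp add: power2_norm_eq_inner)

lemma Cc_scaleR: "Cc f \<Longrightarrow> Cc (\<lambda>z. r *\<^sub>R f z)"
  by (erule Cc_compose0) (auto intro: continuous_intros)

lemma Cc_slice:
  fixes f :: "real \<times> real \<Rightarrow> 'b::euclidean_space"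
  assumes "Cc f"
  shows Cc_slice_x: "Cc (\<lambda>t. f (t, y))" and Cc_slice_y: "Cc (\<lambda>t. f (x, t))"
proof -
  obtain R where R: "\<And>z. R \<le> norm z \<Longrightarrow> f z = 0" and cont: "continuous_on UNIV f"
    using assms unfolding Cc_def by blast
  have "continuous_on UNIV (\<lambda>t. f (t, y))" "continuous_on UNIV (\<lambda>t. f (x, t))"
    by (rule continuous_on_compose2[OF cont]; auto intro!: continuous_intros)+
  moreover have "R \<le> norm t \<Longrightarrow> f (t, y) = 0" "R \<le> norm t \<Longrightarrow> f (x, t) = 0" for t
    using R[of "(t, y)"] R[of "(x, t)"] norm_fst_le[of t y] norm_snd_le[of t x] by linarith+
  ultimately show "Cc (\<lambda>t. f (t, y))" "Cc (\<lambda>t. f (x, t))"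
    unfolding Cc_def by blast+
qed

lemma Cc_Fubini:
  fixes f :: "real \<times> real \<Rightarrow> real"
  assumes "Cc f"
  shows "(LINT z|lborel. f z) = (LINT x|lborel. LINT y|lborel. f (x, y))"
    and "(LINT z|lborel. f z) = (LINT y|lborel. LINT x|lborel. f (x, y))"
    and "integrable lborel (\<lambda>x. LINT y|lborel. f (x, y))"
    and "integrable lborel (\<lambda>y. LINT x|lborel. f (x, y))"
proof -
  have int: "integrable (lborel \<Otimes>\<^sub>M lborel) f"
    using Cc_integrable[OF assms] by (simp add: lborel_prod)
  have int': "integrable (lborel \<Otimes>\<^sub>M lborel) (case_prod (\<lambda>x y. f (x, y)))"
    using int by (simp add: case_prod_beta')
  show "(LINT z|lborel. f z) = (LINT x|lborel. LINT y|lborel. f (x, y))"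
    using lborel_pair.integral_fst'[OF int] by (simp add: lborel_prod)
  show "(LINT z|lborel. f z) = (LINT y|lborel. LINT x|lborel. f (x, y))"
    using lborel_pair.integral_snd[OF int'] by (simp add: lborel_prod case_prod_beta')
  show "integrable lborel (\<lambda>x. LINT y|lborel. f (x, y))"
    using lborel_pair.integrable_fst'[OF int] by simp
  show "integrable lborel (\<lambda>y. LINT x|lborel. f (x, y))"
    using lborel_pair.integrable_snd[OF int'] by simp
qed

text \<open>
  The indicator keeps the integral over the whole line, where Fubini's theorem is available, and the
  equality, which allows an integration by parts in the other variable before any estimate.
\<close>

lemma Cc_eq_integral_deriv:
  fixes k :: "real \<Rightarrow> real"
  assumes k: "Cc k" and k': "Cc k'" and deriv: "\<And>t. (k has_vector_derivative k' t) (at t)"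
  shows "k x = (LINT t|lborel. indicator {..x} t * k' t)"
proof -
  obtain R R' where R: "\<And>z. R \<le> \<bar>z\<bar> \<Longrightarrow> k z = 0" and R': "\<And>z. R' \<le> \<bar>z\<bar> \<Longrightarrow> k' z = 0"
    using k k' unfolding Cc_def by (auto simp: real_norm_def)
  define a where "a = min x (- max \<bar>R\<bar> \<bar>R'\<bar>) - 1"
  have a: "a \<le> x" "k a = 0" "\<And>t. t \<le> a \<Longrightarrow> k' t = 0"
    unfolding a_def using R R' by auto
  have "(k' has_integral (k x - k a)) {a..x}"
    using a(1) deriv by (intro fundamental_theorem_of_calculus) (auto intro: has_vector_derivative_at_within)
  then have "((\<lambda>t. if t \<in> {a..x} then k' t else 0) has_integral k x) UNIV"
    using a(2) by (simp only: has_integral_restrict_UNIV) simp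
  moreover have "(\<lambda>t. if t \<in> {a..x} then k' t else 0) = (\<lambda>t. indicator {..x} t * k' t)"
    using a(3) by (auto simp: indicator_def fun_eq_iff)
  ultimately have 1: "((\<lambda>t. indicator {..x} t * k' t) has_integral k x) UNIV"
    by simp
  have "integrable lborel (\<lambda>t. indicator {..x} t * k' t)"
    using integrable_real_mult_indicator[of "{..x}" lborel k'] Cc_integrable[OF k'] by (simp add: mult.commute)
  then have "((\<lambda>t. indicator {..x} t * k' t) has_integral (LINT t|lborel. indicator {..x} t * k' t)) UNIV"
    by (rule has_integral_integral_lborel)
  then show ?thesis
    using 1 has_integral_unique by blast
qed

lemma Cc_integral_deriv_eq_0:
  fixes k :: "real \<Rightarrow> real"
  assumes k: "Cc k" and k': "Cc k'" and deriv: "\<And>t. (k has_vector_derivative k' t) (at t)"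
  shows "(LINT t|lborel. k' t) = 0"
proof -
  obtain R R' where R: "\<And>z. R \<le> \<bar>z\<bar> \<Longrightarrow> k z = 0" and R': "\<And>z. R' \<le> \<bar>z\<bar> \<Longrightarrow> k' z = 0"
    using k k' unfolding Cc_def by (auto simp: real_norm_def)
  define b where "b = max \<bar>R\<bar> \<bar>R'\<bar>"
  have "(LINT t|lborel. k' t) = (LINT t|lborel. indicator {..b} t * k' t)"
    by (rule Bochner_Integration.integral_cong) (use R' in \<open>auto simp: b_def indicator_def\<close>)
  also have "\<dots> = k b"
    using Cc_eq_integral_deriv[OF assms] by simp
  also have "\<dots> = 0"
    using R by (simp add: b_def)
  finally show ?thesis .
qed

lemma Cc_abs_le_integral_deriv:
  fixes k :: "real \<Rightarrow> real"
  assumes k: "Cc k" and k': "Cc k'" and deriv: "\<And>t. (k has_vector_derivative k' t) (at t)"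
  shows "\<bar>k x\<bar> \<le> (LINT t|lborel. \<bar>k' t\<bar>)"
proof -
  have "\<bar>k x\<bar> \<le> (LINT t|lborel. \<bar>indicator {..x} t * k' t\<bar>)"
    unfolding Cc_eq_integral_deriv[OF assms] by (rule integral_abs_bound)
  also have "\<dots> \<le> (LINT t|lborel. \<bar>k' t\<bar>)"
    using Cc_integrable[OF k'] integrable_real_mult_indicator[of "{..x}" lborel k']
    by (intro integral_mono integrable_abs) (auto simp: mult.commute indicator_def split: if_splits)
  finally show ?thesis .
qed

lemma test_function_iff:
  "test_function f \<longleftrightarrow> (\<forall>k. C_k k f) \<and> (\<exists>R. \<forall>z. R \<le> norm z \<longrightarrow> f z = 0)"
proof -
  have "bounded {z. f z \<noteq> 0} \<longleftrightarrow> (\<exists>R. \<forall>z. R \<le> norm z \<longrightarrow> f z = 0)"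
  proof
    assume "bounded {z. f z \<noteq> 0}"
    then obtain R where "\<And>z. f z \<noteq> 0 \<Longrightarrow> norm z \<le> R"
      unfolding bounded_iff by auto
    then have "\<forall>z. R + 1 \<le> norm z \<longrightarrow> f z = 0"
      by (smt (verit))
    then show "\<exists>R. \<forall>z. R \<le> norm z \<longrightarrow> f z = 0" by blast
  next
    assume "\<exists>R. \<forall>z. R \<le> norm z \<longrightarrow> f z = 0"
    then obtain R where "\<And>z. R \<le> norm z \<Longrightarrow> f z = 0" by blast
    then have "\<forall>z\<in>{z. f z \<noteq> 0}. norm z \<le> R"
      by (metis linorder_le_cases mem_Collect_eq)
    then show "bounded {z. f z \<noteq> 0}"
      unfolding bounded_iff by blast
  qed
  then show ?thesis
    unfolding test_function_def by simp
qed

lemma test_function_Cc: "test_function f \<Longrightarrow> Cc f"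
  unfolding test_function_iff Cc_def by (metis C_k.simps(1))

lemma test_function_continuous: "test_function f \<Longrightarrow> continuous_on UNIV f"
  using test_function_Cc unfolding Cc_def by blast

lemma partial_x_has_derivative:
  assumes "f differentiable_on UNIV"
  shows "((\<lambda>t. f (t, y)) has_vector_derivative partial_x f (x, y)) (at x)"
proof -
  have "f differentiable at (x, y)"
    using assms by (simp add: differentiable_on_def)
  then have "(f \<circ> (\<lambda>t. (t, y))) differentiable at x"
    by (intro differentiable_chain_at) (auto intro!: derivative_intros simp: differentiable_def)
  then show ?thesis
    by (simp add: o_def partial_x_def vector_derivative_works)
qed

lemma partial_y_has_derivative:
  assumes "f differentiable_on UNIV"
  shows "((\<lambda>t. f (x, t)) has_vector_derivative partial_y f (x, y)) (at y)"
proof -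
  have "f differentiable at (x, y)"
    using assms by (simp add: differentiable_on_def)
  then have "(f \<circ> (\<lambda>t. (x, t))) differentiable at y"
    by (intro differentiable_chain_at) (auto intro!: derivative_intros simp: differentiable_def)
  then show ?thesis
    by (simp add: o_def partial_y_def vector_derivative_works)
qed

lemma partial_x_eqI:
  "((\<lambda>t. f (t, y)) has_vector_derivative d) (at x) \<Longrightarrow> partial_x f (x, y) = d"
  by (simp add: partial_x_def vector_derivative_at)

lemma partial_y_eqI:
  "((\<lambda>t. f (x, t)) has_vector_derivative d) (at y) \<Longrightarrow> partial_y f (x, y) = d"
  by (simp add: partial_y_def vector_derivative_at)

lemma test_function_differentiable: "test_function f \<Longrightarrow> f differentiable_on UNIV"
  unfolding test_function_def using C_k.simps(2) by blast

lemmas test_function_derivative_x = partial_x_has_derivative[OF test_function_differentiable]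
lemmas test_function_derivative_y = partial_y_has_derivative[OF test_function_differentiable]

lemma test_function_partial_x:
  assumes "test_function f"
  shows "test_function (partial_x f)"
proof -
  obtain R where R: "\<And>z. R \<le> norm z \<Longrightarrow> f z = 0"
    using assms unfolding test_function_iff by blast
  have "partial_x f z = 0" if z: "R + 1 \<le> norm z" for z
  proof -
    have "((\<lambda>t. f (t, snd z)) has_vector_derivative 0) (at (fst z))"
    proof (rule has_vector_derivative_transform_within_open[of "\<lambda>t. 0" _ _ "{t. R < norm (t, snd z)}"])
      show "open {t. R < norm (t, snd z)}"
        by (intro open_Collect_less continuous_intros)
    qed (use z R in auto)
    then show ?thesis
      using partial_x_eqI[of f "snd z" 0 "fst z"] by simp
  qed
  then show ?thesis
    using assms unfolding test_function_iff by (metis C_k.simps(2))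
qed

lemma test_function_partial_y:
  assumes "test_function f"
  shows "test_function (partial_y f)"
proof -
  obtain R where R: "\<And>z. R \<le> norm z \<Longrightarrow> f z = 0"
    using assms unfolding test_function_iff by blast
  have "partial_y f z = 0" if z: "R + 1 \<le> norm z" for z
  proof -
    have "((\<lambda>t. f (fst z, t)) has_vector_derivative 0) (at (snd z))"
    proof (rule has_vector_derivative_transform_within_open[of "\<lambda>t. 0" _ _ "{t. R < norm (fst z, t)}"])
      show "open {t. R < norm (fst z, t)}"
        by (intro open_Collect_less continuous_intros)
    qed (use z R in auto)
    then show ?thesis
      using partial_y_eqI[of f "fst z" 0 "snd z"] by simp
  qed
  then show ?thesis
    using assms unfolding test_function_iff by (metis C_k.simps(2))
qed

lemma partial_add:
  assumes "f differentiable_on UNIV" "g differentiable_on UNIV"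
  shows "partial_x (\<lambda>z. f z + g z) = (\<lambda>z. partial_x f z + partial_x g z)"
    and "partial_y (\<lambda>z. f z + g z) = (\<lambda>z. partial_y f z + partial_y g z)"
  using assms
  by (auto simp: fun_eq_iff intro!: partial_x_eqI partial_y_eqI
      has_vector_derivative_add partial_x_has_derivative partial_y_has_derivative)

lemma partial_scale:
  assumes "f differentiable_on UNIV"
  shows "partial_x (\<lambda>z. r *\<^sub>R f z) = (\<lambda>z. r *\<^sub>R partial_x f z)"
    and "partial_y (\<lambda>z. r *\<^sub>R f z) = (\<lambda>z. r *\<^sub>R partial_y f z)"
  using assms
  by (auto simp: fun_eq_iff intro!: partial_x_eqI partial_y_eqI
      bounded_linear.has_vector_derivative[OF bounded_linear_scaleR_right] partial_x_has_derivative partial_y_has_derivative)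

lemma partial_translate:
  shows "partial_x (\<lambda>z. f (z + a)) = (\<lambda>z. partial_x f (z + a))"
    and "partial_y (\<lambda>z. f (z + a)) = (\<lambda>z. partial_y f (z + a))"
proof -
  have *: "vector_derivative (\<lambda>t. g (t + c)) (at s) = vector_derivative g (at (s + c))"
    for g :: "real \<Rightarrow> complex" and c s
  proof -
    have "((\<lambda>t. g (t + c)) has_vector_derivative d) (at s) \<longleftrightarrow> (g has_vector_derivative d) (at (s + c))" for d
    proof
      assume "(g has_vector_derivative d) (at (s + c))"
      then have "((g \<circ> (\<lambda>t. t + c)) has_vector_derivative 1 *\<^sub>R d) (at s)"
        by (intro vector_diff_chain_at) (auto intro!: derivative_eq_intros)
      then show "((\<lambda>t. g (t + c)) has_vector_derivative d) (at s)"
        by (simp add: o_def)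
    next
      assume "((\<lambda>t. g (t + c)) has_vector_derivative d) (at s)"
      then have "(((\<lambda>t. g (t + c)) \<circ> (\<lambda>t. t - c)) has_vector_derivative 1 *\<^sub>R d) (at (s + c))"
        by (intro vector_diff_chain_at) (auto intro!: derivative_eq_intros)
      then show "(g has_vector_derivative d) (at (s + c))"
        by (simp add: o_def)
    qed
    then show ?thesis
      by (simp add: vector_derivative_def)
  qed
  show "partial_x (\<lambda>z. f (z + a)) = (\<lambda>z. partial_x f (z + a))"
    using *[of "\<lambda>t. f (t, _ + snd a)" "fst a"] by (cases a) (auto simp: partial_x_def fun_eq_iff)
  show "partial_y (\<lambda>z. f (z + a)) = (\<lambda>z. partial_y f (z + a))"
    using *[of "\<lambda>t. f (_ + fst a, t)" "snd a"] by (cases a) (auto simp: partial_y_def fun_eq_iff)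
qed

lemma C_k_add: "C_k k f \<Longrightarrow> C_k k g \<Longrightarrow> C_k k (\<lambda>z. f z + g z)"
  by (induction k arbitrary: f g) (auto intro: continuous_on_add derivative_intros simp: partial_add)

lemma C_k_scale: "C_k k f \<Longrightarrow> C_k k (\<lambda>z. r *\<^sub>R f z)"
  by (induction k arbitrary: f) (auto intro: continuous_intros derivative_intros simp: partial_scale)

lemma C_k_translate: "C_k k f \<Longrightarrow> C_k k (\<lambda>z. f (z + a))"
proof (induction k arbitrary: f)
  case 0
  then show ?case
    by (auto intro!: continuous_on_compose2[of UNIV f] continuous_intros)
next
  case (Suc k)
  have "(\<lambda>z. f (z + a)) differentiable_on UNIV"
    unfolding differentiable_on_def
  proof
    fix z
    have "(f \<circ> (\<lambda>z. z + a)) differentiable (at z)"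
    proof (rule differentiable_chain_at)
      show "f differentiable (at (z + a))"
        using Suc.prems unfolding C_k.simps differentiable_on_def by blast
    qed (intro derivative_intros)
    then show "(\<lambda>z. f (z + a)) differentiable (at z)"
      by (simp add: o_def)
  qed
  then show ?case
    using Suc by (simp add: partial_translate)
qed

lemma test_function_add:
  assumes "test_function f" "test_function g"
  shows "test_function (\<lambda>z. f z + g z)"
proof -
  obtain R R' where "\<And>z. R \<le> norm z \<Longrightarrow> f z = 0" "\<And>z. R' \<le> norm z \<Longrightarrow> g z = 0"
    using assms unfolding test_function_iff by blast
  then have "\<forall>z. max R R' \<le> norm z \<longrightarrow> f z + g z = 0" by simp
  then show ?thesis
    using assms C_k_add unfolding test_function_iff by blast
qed

lemma test_function_scale: "test_function f \<Longrightarrow> test_function (\<lambda>z. r *\<^sub>R f z)"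
  unfolding test_function_iff using C_k_scale by (metis scaleR_zero_right)

lemma test_function_translate:
  assumes "test_function f"
  shows "test_function (\<lambda>z. f (z + a))"
proof -
  obtain R where R: "\<And>z. R \<le> norm z \<Longrightarrow> f z = 0"
    using assms unfolding test_function_iff by blast
  have "f (z + a) = 0" if "R + norm a \<le> norm z" for z
    using R[of "z + a"] norm_diff_ineq[of z a] that by simp
  then show ?thesis
    using assms C_k_translate unfolding test_function_iff by blast
qed

lemma test_function_square_integrable:
  assumes "test_function f"
  shows "square_integrable f"
  unfolding square_integrable_def
  using Cc_integrable[OF Cc_norm_square[OF test_function_Cc[OF assms]]]
    borel_measurable_continuous_onI[OF test_function_continuous[OF assms]] by simp

lemma Cc_integration_by_parts:
  fixes f g :: "real \<Rightarrow> complex"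
  assumes C: "Cc f" "Cc f'" "Cc g" "Cc g'"
    and f: "\<And>t. (f has_vector_derivative f' t) (at t)" and g: "\<And>t. (g has_vector_derivative g' t) (at t)"
  shows "(LINT t|lborel. f' t \<bullet> g t) = - (LINT t|lborel. f t \<bullet> g' t)"
proof -
  have "(LINT t|lborel. f t \<bullet> g' t + f' t \<bullet> g t) = 0"
    by (rule Cc_integral_deriv_eq_0[of "\<lambda>t. f t \<bullet> g t"])
      (intro Cc_add Cc_inner C bounded_bilinear.has_vector_derivative[OF bounded_bilinear_inner] f g)+
  then show ?thesis
    using Cc_integrable[OF Cc_inner[OF C(1,4)]] Cc_integrable[OF Cc_inner[OF C(2,3)]] by simp
qed

lemma integration_by_parts_x_slice:
  assumes f: "test_function f" and g: "test_function g"
  shows "(LINT t|lborel. partial_x f (t, y) \<bullet> g (t, y)) = - (LINT t|lborel. f (t, y) \<bullet> partial_x g (t, y))"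
  by (rule Cc_integration_by_parts[OF _ _ _ _ test_function_derivative_x[OF f] test_function_derivative_x[OF g]])
    (intro Cc_slice_x test_function_Cc test_function_partial_x f g)+

lemma integration_by_parts_y_slice:
  assumes f: "test_function f" and g: "test_function g"
  shows "(LINT t|lborel. partial_y f (x, t) \<bullet> g (x, t)) = - (LINT t|lborel. f (x, t) \<bullet> partial_y g (x, t))"
  by (rule Cc_integration_by_parts[OF _ _ _ _ test_function_derivative_y[OF f] test_function_derivative_y[OF g]])
    (intro Cc_slice_y test_function_Cc test_function_partial_y f g)+

lemma integration_by_parts:
  assumes f: "test_function f" and g: "test_function g"
  shows integration_by_parts_x: "L2_inner (partial_x f) g = - L2_inner f (partial_x g)"
    and integration_by_parts_y: "L2_inner (partial_y f) g = - L2_inner f (partial_y g)"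
proof -
  note Cs = test_function_Cc[OF f] test_function_Cc[OF g]
    test_function_Cc[OF test_function_partial_x[OF f]] test_function_Cc[OF test_function_partial_x[OF g]]
    test_function_Cc[OF test_function_partial_y[OF f]] test_function_Cc[OF test_function_partial_y[OF g]]
  have c: "Cc (\<lambda>z. f z \<bullet> partial_x g z)" "Cc (\<lambda>z. partial_x f z \<bullet> g z)"
    "Cc (\<lambda>z. f z \<bullet> partial_y g z)" "Cc (\<lambda>z. partial_y f z \<bullet> g z)"
    using Cs by (auto intro!: Cc_inner)
  show "L2_inner (partial_x f) g = - L2_inner f (partial_x g)"
    unfolding L2_inner_def Cc_Fubini(2)[OF c(1)] Cc_Fubini(2)[OF c(2)]
    by (simp add: integration_by_parts_x_slice[OF f g])
  show "L2_inner (partial_y f) g = - L2_inner f (partial_y g)"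
    unfolding L2_inner_def Cc_Fubini(1)[OF c(3)] Cc_Fubini(1)[OF c(4)]
    by (simp add: integration_by_parts_y_slice[OF f g])
qed

text \<open>
  On a vertical line, \<open>f(x, s) - f(x, a)\<close> is the integral of \<open>\<partial>\<^sub>y f\<close>. Differentiating under the
  integral gives \<open>\<partial>\<^sub>x f(x, s) - \<partial>\<^sub>x f(x, a)\<close> as the integral of \<open>\<partial>\<^sub>x \<partial>\<^sub>y f\<close>, and the fundamental theorem
  recovers the integrand as the derivative in \<open>s\<close>.
\<close>

lemma mixed_partials_commute:
  assumes f: "test_function f"
  shows "partial_y (partial_x f) = partial_x (partial_y f)"
proof
  fix z :: "real \<times> real"
  obtain x y where z: "z = (x, y)" by (cases z)
  \<comment> \<open>any base point below \<open>y\<close>\<close>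
  define a where "a = y - 1"
  let ?D = "partial_x (partial_y f)"
  have fy: "test_function (partial_y f)" and D: "test_function ?D"
    using f by (auto intro: test_function_partial_x test_function_partial_y)
  have cont_slice: "continuous_on S (\<lambda>t. g (u, t))" if "test_function g" for g u S
    by (rule continuous_on_compose2[OF test_function_continuous[OF that]]) (auto intro!: continuous_intros)
  have rep: "f (u, s) - f (u, a) = integral {a..s} (\<lambda>t. partial_y f (u, t))" if "a \<le> s" for u s
    by (rule integral_unique[symmetric], rule fundamental_theorem_of_calculus)
      (use that test_function_derivative_y[OF f] in \<open>auto intro: has_vector_derivative_at_within\<close>)
  have fx: "partial_x f (x, s) - partial_x f (x, a) = integral {a..s} (\<lambda>t. ?D (x, t))" if s: "a \<le> s" for s
  proof -
    have "((\<lambda>u. integral (cbox a s) (\<lambda>t. partial_y f (u, t))) has_vector_derivative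
        integral (cbox a s) (\<lambda>t. ?D (x, t))) (at x within UNIV)"
    proof (rule leibniz_rule_vector_derivative)
      show "continuous_on (UNIV \<times> cbox a s) (\<lambda>(u, t). ?D (u, t))"
        using test_function_continuous[OF D] by (auto intro: continuous_on_subset)
    qed (use test_function_derivative_x[OF fy] cont_slice[OF fy] in \<open>auto intro: integrable_continuous_real\<close>)
    then have "((\<lambda>u. f (u, s) - f (u, a)) has_vector_derivative integral {a..s} (\<lambda>t. ?D (x, t))) (at x)"
      using rep[OF s] by simp
    moreover have "((\<lambda>u. f (u, s) - f (u, a)) has_vector_derivative partial_x f (x, s) - partial_x f (x, a)) (at x)"
      by (intro has_vector_derivative_diff test_function_derivative_x f)
    ultimately show ?thesis
      using vector_derivative_unique_at by blast
  qed
  have "((\<lambda>s. integral {a..s} (\<lambda>t. ?D (x, t))) has_vector_derivative ?D (x, y)) (at y within {a..y+1})"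
    by (rule integral_has_vector_derivative) (auto intro: cont_slice[OF D] simp: a_def)
  then have "((\<lambda>s. integral {a..s} (\<lambda>t. ?D (x, t))) has_vector_derivative ?D (x, y)) (at y)"
    by (simp add: at_within_Icc_at a_def)
  then have "((\<lambda>s. partial_x f (x, s) - partial_x f (x, a)) has_vector_derivative ?D (x, y)) (at y)"
    by (rule has_vector_derivative_transform_within_open[of _ _ _ "{a<..}"]) (auto simp: fx, simp add: a_def)
  then have "((\<lambda>s. partial_x f (x, s)) has_vector_derivative ?D (x, y)) (at y)"
    using has_vector_derivative_add[OF _ has_vector_derivative_const[of "partial_x f (x, a)"]] by fastforce
  then show "partial_y (partial_x f) z = ?D z"
    unfolding z by (rule partial_y_eqI)
qed

section \<open>An anisotropic Sobolev inequality\<close>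

lemma abs_two_mult_le_squares: "\<bar>2 * (a \<bullet> b)\<bar> \<le> (norm a)\<^sup>2 + (norm b)\<^sup>2"
  for a b :: "'a::real_inner"
proof -
  have "0 \<le> (norm (a - b))\<^sup>2" "0 \<le> (norm (a + b))\<^sup>2" by simp_all
  then show "\<bar>2 * (a \<bullet> b)\<bar> \<le> (norm a)\<^sup>2 + (norm b)\<^sup>2"
    by (auto simp: power2_norm_eq_inner inner_simps inner_commute abs_le_iff)
qed

lemma norm_square_has_derivative:
  fixes k :: "real \<Rightarrow> complex"
  assumes "(k has_vector_derivative d) (at t)"
  shows "((\<lambda>t. (cmod (k t))\<^sup>2) has_vector_derivative 2 * (k t \<bullet> d)) (at t)"
  using bounded_bilinear.has_vector_derivative[OF bounded_bilinear_inner assms assms]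
  by (simp add: power2_norm_eq_inner inner_commute)

lemma Cc_norm_square_le_integral:
  fixes k :: "real \<Rightarrow> complex"
  assumes k: "Cc k" and k': "Cc k'" and deriv: "\<And>t. (k has_vector_derivative k' t) (at t)"
  shows "(cmod (k x))\<^sup>2 \<le> (LINT t|lborel. (cmod (k t))\<^sup>2 + (cmod (k' t))\<^sup>2)"
proof -
  have C: "Cc (\<lambda>t. (cmod (k t))\<^sup>2)" "Cc (\<lambda>t. 2 * (k t \<bullet> k' t))" "Cc (\<lambda>t. (cmod (k t))\<^sup>2 + (cmod (k' t))\<^sup>2)"
    using Cc_scaleR[OF Cc_inner[OF k k'], of 2] k k' by (auto intro: Cc_norm_square Cc_add)
  have "(cmod (k x))\<^sup>2 \<le> (LINT t|lborel. \<bar>2 * (k t \<bullet> k' t)\<bar>)"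
    using Cc_abs_le_integral_deriv[OF C(1,2) norm_square_has_derivative[OF deriv], of x] by simp
  also have "\<dots> \<le> (LINT t|lborel. (cmod (k t))\<^sup>2 + (cmod (k' t))\<^sup>2)"
    by (intro integral_mono integrable_abs Cc_integrable C abs_two_mult_le_squares)
  finally show ?thesis .
qed

lemma slice_norm_bound:
  assumes f: "test_function f"
  shows "(LINT y|lborel. (cmod (f (x, y)))\<^sup>2) \<le> L2_inner f f + L2_inner (partial_x f) (partial_x f)"
proof -
  note C = test_function_Cc[OF f] test_function_Cc[OF test_function_partial_x[OF f]]
  have S: "Cc (\<lambda>z. (cmod (f z))\<^sup>2)" "Cc (\<lambda>z. (cmod (partial_x f z))\<^sup>2)"
    using C by (auto intro: Cc_norm_square)
  have "(LINT y|lborel. (cmod (f (x, y)))\<^sup>2)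
      \<le> (LINT y|lborel. LINT t|lborel. (cmod (f (t, y)))\<^sup>2 + (cmod (partial_x f (t, y)))\<^sup>2)"
  proof (rule integral_mono)
    show "integrable lborel (\<lambda>y. (cmod (f (x, y)))\<^sup>2)"
      using Cc_integrable[OF Cc_slice_y[OF S(1)]] .
    show "integrable lborel (\<lambda>y. LINT t|lborel. (cmod (f (t, y)))\<^sup>2 + (cmod (partial_x f (t, y)))\<^sup>2)"
      using Cc_Fubini(4)[OF Cc_add[OF S]] .
    show "(cmod (f (x, y)))\<^sup>2 \<le> (LINT t|lborel. (cmod (f (t, y)))\<^sup>2 + (cmod (partial_x f (t, y)))\<^sup>2)" for y
      by (rule Cc_norm_square_le_integral[OF Cc_slice_x[OF C(1)] Cc_slice_x[OF C(2)] test_function_derivative_x[OF f]])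
  qed
  also have "\<dots> = (LINT z|lborel. (cmod (f z))\<^sup>2 + (cmod (partial_x f z))\<^sup>2)"
    using Cc_Fubini(2)[OF Cc_add[OF S]] by simp
  also have "\<dots> = L2_inner f f + L2_inner (partial_x f) (partial_x f)"
    using Cc_integrable[OF S(1)] Cc_integrable[OF S(2)] by (simp add: L2_inner_self)
  finally show ?thesis .
qed

text \<open>
  The derivative in \<open>x\<close> of \<open>|\<partial>\<^sub>y f|\<^sup>2\<close> is \<open>2 \<partial>\<^sub>y f \<bullet> \<partial>\<^sub>x \<partial>\<^sub>y f\<close>, and the energy does not control the mixed
  derivative. After integration over the vertical line, one derivative in \<open>y\<close> moves to the other
  factor, which leaves \<open>-2 \<partial>\<^sub>y\<^sub>y f \<bullet> \<partial>\<^sub>x f\<close>.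
\<close>

lemma slice_derivative_norm_bound:
  assumes f: "test_function f"
  shows "(LINT y|lborel. (cmod (partial_y f (x, y)))\<^sup>2)
    \<le> L2_inner (partial_x f) (partial_x f) + L2_inner (partial_y (partial_y f)) (partial_y (partial_y f))"
proof -
  let ?g = "partial_y f" and ?fx = "partial_x f" and ?fyy = "partial_y (partial_y f)"
  have tests: "test_function ?g" "test_function ?fx" "test_function ?fyy" "test_function (partial_x ?g)"
    using f by (auto intro: test_function_partial_x test_function_partial_y)
  note C = tests[THEN test_function_Cc]
  have Ck: "Cc (\<lambda>z. 2 * (?g z \<bullet> partial_x ?g z))"
    using Cc_scaleR[OF Cc_inner[OF C(1) C(4)], of 2] by simp
  have Cm: "Cc (\<lambda>z. \<bar>2 * (?fyy z \<bullet> ?fx z)\<bar>)" "Cc (\<lambda>z. 2 * (?fyy z \<bullet> ?fx z))"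
  proof -
    show *: "Cc (\<lambda>z. 2 * (?fyy z \<bullet> ?fx z))"
      using Cc_scaleR[OF Cc_inner[OF C(3) C(2)], of 2] by simp
    show "Cc (\<lambda>z. \<bar>2 * (?fyy z \<bullet> ?fx z)\<bar>)"
      by (rule Cc_compose0[OF *]) (auto intro: continuous_intros)
  qed
  have S: "Cc (\<lambda>z. (cmod (?fx z))\<^sup>2)" "Cc (\<lambda>z. (cmod (?fyy z))\<^sup>2)" "Cc (\<lambda>z. (cmod (?g z))\<^sup>2)"
    using C by (auto intro: Cc_norm_square)
  define F where "F = (\<lambda>(t::real, y::real). indicator {..x} t * (2 * (?g (t, y) \<bullet> partial_x ?g (t, y))))"
  have F_int: "integrable (lborel \<Otimes>\<^sub>M lborel) F"
  proof -
    have "integrable lborel (\<lambda>z. 2 * (?g z \<bullet> partial_x ?g z) * indicator ({..x} \<times> UNIV) z)"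
      by (rule integrable_real_mult_indicator[OF _ Cc_integrable[OF Ck]]) (simp add: borel_Times)
    also have "(\<lambda>z. 2 * (?g z \<bullet> partial_x ?g z) * indicator ({..x} \<times> UNIV) z) = F"
      by (auto simp: F_def fun_eq_iff indicator_def)
    finally show ?thesis by (simp add: lborel_prod)
  qed
  have F_int': "integrable (lborel \<Otimes>\<^sub>M lborel) (case_prod (\<lambda>t y. F (t, y)))"
    using F_int by (simp add: case_prod_beta')
  have "(LINT y|lborel. (cmod (?g (x, y)))\<^sup>2) = (LINT y|lborel. LINT t|lborel. F (t, y))"
  proof (rule Bochner_Integration.integral_cong)
    fix y
    show "(cmod (?g (x, y)))\<^sup>2 = (LINT t|lborel. F (t, y))"
      unfolding F_def case_prod_conv
      by (rule Cc_eq_integral_deriv[OF Cc_slice_x[OF S(3)] Cc_slice_x[OF Ck]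
            norm_square_has_derivative[OF test_function_derivative_x[OF tests(1)]]])
  qed simp
  also have "\<dots> = (LINT t|lborel. LINT y|lborel. F (t, y))"
    using lborel_pair.integral_snd[OF F_int'] lborel_pair.integral_fst'[OF F_int]
    by (simp add: case_prod_beta')
  also have "\<dots> \<le> (LINT t|lborel. LINT y|lborel. \<bar>2 * (?fyy (t, y) \<bullet> ?fx (t, y))\<bar>)"
  proof (rule integral_mono)
    show "integrable lborel (\<lambda>t. LINT y|lborel. F (t, y))"
      using lborel_pair.integrable_fst'[OF F_int] .
    show "integrable lborel (\<lambda>t. LINT y|lborel. \<bar>2 * (?fyy (t, y) \<bullet> ?fx (t, y))\<bar>)"
      using Cc_Fubini(3)[OF Cm(1)] .
    fix t
    have "(LINT y|lborel. F (t, y)) = indicator {..x} t * (2 * (LINT y|lborel. partial_y ?fx (t, y) \<bullet> ?g (t, y)))"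
      by (simp add: F_def mixed_partials_commute[OF f] inner_commute)
    also have "\<dots> = indicator {..x} t * - (LINT y|lborel. 2 * (?fyy (t, y) \<bullet> ?fx (t, y)))"
      unfolding integration_by_parts_y_slice[OF tests(2,1)]
      by (simp only: inner_commute[of "?fx _"] integral_mult_right_zero mult_minus_right)
    also have "\<dots> \<le> \<bar>LINT y|lborel. 2 * (?fyy (t, y) \<bullet> ?fx (t, y))\<bar>"
      by (auto simp: indicator_def)
    also have "\<dots> \<le> (LINT y|lborel. \<bar>2 * (?fyy (t, y) \<bullet> ?fx (t, y))\<bar>)"
      by (rule integral_abs_bound)
    finally show "(LINT y|lborel. F (t, y)) \<le> (LINT y|lborel. \<bar>2 * (?fyy (t, y) \<bullet> ?fx (t, y))\<bar>)" .
  qed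
  also have "\<dots> = (LINT z|lborel. \<bar>2 * (?fyy z \<bullet> ?fx z)\<bar>)"
    using Cc_Fubini(1)[OF Cm(1)] by simp
  also have "\<dots> \<le> (LINT z|lborel. (cmod (?fyy z))\<^sup>2 + (cmod (?fx z))\<^sup>2)"
    by (intro integral_mono Cc_integrable Cm Cc_add S abs_two_mult_le_squares)
  also have "\<dots> = L2_inner ?fx ?fx + L2_inner ?fyy ?fyy"
    using Cc_integrable[OF S(1)] Cc_integrable[OF S(2)] by (simp add: L2_inner_self)
  finally show ?thesis .
qed

text \<open>
  On the vertical line through the point, \<open>f\<close> and \<open>\<partial>\<^sub>y f\<close> are bounded in \<open>L\<^sup>2\<close> by the two preceding
  lemmas, and a function on a line is bounded by these two norms.
\<close>

theorem anisotropic_Sobolev: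
  assumes f: "test_function f"
  shows "(cmod (f z))\<^sup>2 \<le> L2_inner f f + 2 * L2_inner (partial_x f) (partial_x f)
    + L2_inner (partial_y (partial_y f)) (partial_y (partial_y f))"
proof -
  obtain x y where z: "z = (x, y)" by (cases z)
  note C = test_function_Cc[OF f] test_function_Cc[OF test_function_partial_y[OF f]]
  have "(cmod (f (x, y)))\<^sup>2 \<le> (LINT t|lborel. (cmod (f (x, t)))\<^sup>2 + (cmod (partial_y f (x, t)))\<^sup>2)"
    by (rule Cc_norm_square_le_integral[OF Cc_slice_y[OF C(1)] Cc_slice_y[OF C(2)] test_function_derivative_y[OF f]])
  also have "\<dots> = (LINT t|lborel. (cmod (f (x, t)))\<^sup>2) + (LINT t|lborel. (cmod (partial_y f (x, t)))\<^sup>2)"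
    by (intro Bochner_Integration.integral_add Cc_integrable Cc_norm_square Cc_slice_y C)
  finally show ?thesis
    unfolding z using slice_norm_bound[OF f, of x] slice_derivative_norm_bound[OF f, of x] by simp
qed

section \<open>The energy space\<close>

definition energy :: "real \<Rightarrow> (real \<times> real \<Rightarrow> complex) \<Rightarrow> (real \<times> real \<Rightarrow> complex) \<Rightarrow> real" where
  "energy \<omega> u v = L2_inner (H12_dx u) (H12_dx v) + L2_inner (H12_dyy u) (H12_dyy v) + \<omega> * L2_inner u v"

lemma H12_limit_iff:
  "H12_limit u g h \<longleftrightarrow> square_integrable u \<and> square_integrable g \<and> square_integrable h \<and>
     (\<exists>\<phi>. (\<forall>n. test_function (\<phi> n)) \<and> (\<lambda>n. L2.nrm (\<phi> n - u)) \<longlonglongrightarrow> 0 \<and>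
        (\<lambda>n. L2.nrm (partial_x (\<phi> n) - g)) \<longlonglongrightarrow> 0 \<and>
        (\<lambda>n. L2.nrm (partial_y (partial_y (\<phi> n)) - h)) \<longlonglongrightarrow> 0)"
  by (simp add: H12_limit_def L2_norm_eq_nrm_diff)

lemma test_function_add': "test_function f \<Longrightarrow> test_function g \<Longrightarrow> test_function (f + g)"
  and test_function_scale': "test_function f \<Longrightarrow> test_function (r *\<^sub>R f)"
  by (simp_all add: plus_fun_def scaleR_fun_def test_function_add test_function_scale)

lemma test_function_diff: "test_function f \<Longrightarrow> test_function g \<Longrightarrow> test_function (f - g)"
  using test_function_add'[of f "(-1) *\<^sub>R g"] test_function_scale'[of g "-1"] by simp

lemma partial_x_linear:
  assumes "test_function f" "test_function g"
  shows "partial_x (f + g) = partial_x f + partial_x g" and "partial_x (r *\<^sub>R f) = r *\<^sub>R partial_x f"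
  using assms partial_add(1) partial_scale(1)
  by (simp_all add: plus_fun_def scaleR_fun_def test_function_differentiable)

lemma partial_y_linear:
  assumes "test_function f" "test_function g"
  shows "partial_y (f + g) = partial_y f + partial_y g" and "partial_y (r *\<^sub>R f) = r *\<^sub>R partial_y f"
  using assms partial_add(2) partial_scale(2)
  by (simp_all add: plus_fun_def scaleR_fun_def test_function_differentiable)

lemma L2_nrm_add_tendsto:
  assumes "\<And>n. square_integrable (f n)" "\<And>n. square_integrable (f' n)" "square_integrable g" "square_integrable g'"
    and "(\<lambda>n. L2.nrm (f n - g)) \<longlonglongrightarrow> 0" "(\<lambda>n. L2.nrm (f' n - g')) \<longlonglongrightarrow> 0"
  shows "(\<lambda>n. L2.nrm ((f n + f' n) - (g + g'))) \<longlonglongrightarrow> 0"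
proof (rule tendsto_sandwich[OF _ _ tendsto_const])
  show "\<forall>\<^sub>F n in sequentially. 0 \<le> L2.nrm ((f n + f' n) - (g + g'))"
    using assms by (auto intro!: L2.nrm_nonneg always_eventually)
  show "\<forall>\<^sub>F n in sequentially. L2.nrm ((f n + f' n) - (g + g')) \<le> L2.nrm (f n - g) + L2.nrm (f' n - g')"
  proof (rule eventuallyI)
    fix n
    show "L2.nrm ((f n + f' n) - (g + g')) \<le> L2.nrm (f n - g) + L2.nrm (f' n - g')"
      using L2.nrm_triangle[of "f n - g" "f' n - g'"] assms by (simp add: algebra_simps)
  qed
  show "(\<lambda>n. L2.nrm (f n - g) + L2.nrm (f' n - g')) \<longlonglongrightarrow> 0"
    using tendsto_add[OF assms(5,6)] by simp
qed

lemma L2_nrm_scale_tendsto: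
  assumes "\<And>n. square_integrable (f n)" "square_integrable g"
    and "(\<lambda>n. L2.nrm (f n - g)) \<longlonglongrightarrow> 0"
  shows "(\<lambda>n. L2.nrm (r *\<^sub>R f n - r *\<^sub>R g)) \<longlonglongrightarrow> 0"
proof -
  have "L2.nrm (r *\<^sub>R f n - r *\<^sub>R g) = \<bar>r\<bar> * L2.nrm (f n - g)" for n
    using L2.nrm_scale[of "f n - g" r] assms by (simp add: scaleR_right_diff_distrib)
  then show ?thesis
    using tendsto_mult_left[OF assms(3), of "\<bar>r\<bar>"] by simp
qed

lemmas test_function_closed =
  test_function_partial_x test_function_partial_y test_function_square_integrable

lemma H12_limit_add:
  assumes "H12_limit u g h" "H12_limit u' g' h'"
  shows "H12_limit (u + u') (g + g') (h + h')"
proof -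
  obtain \<phi> \<phi>' where t: "\<And>n. test_function (\<phi> n)" "\<And>n. test_function (\<phi>' n)"
    and lim: "(\<lambda>n. L2.nrm (\<phi> n - u)) \<longlonglongrightarrow> 0" "(\<lambda>n. L2.nrm (partial_x (\<phi> n) - g)) \<longlonglongrightarrow> 0"
      "(\<lambda>n. L2.nrm (partial_y (partial_y (\<phi> n)) - h)) \<longlonglongrightarrow> 0"
      "(\<lambda>n. L2.nrm (\<phi>' n - u')) \<longlonglongrightarrow> 0" "(\<lambda>n. L2.nrm (partial_x (\<phi>' n) - g')) \<longlonglongrightarrow> 0"
      "(\<lambda>n. L2.nrm (partial_y (partial_y (\<phi>' n)) - h')) \<longlonglongrightarrow> 0"
    using assms unfolding H12_limit_iff by blast
  have sq: "square_integrable u" "square_integrable g" "square_integrable h"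
    "square_integrable u'" "square_integrable g'" "square_integrable h'"
    using assms unfolding H12_limit_iff by auto
  show ?thesis
    unfolding H12_limit_iff
  proof (intro conjI exI allI)
    show "test_function (\<phi> n + \<phi>' n)" for n
      using t by (intro test_function_add')
    show "(\<lambda>n. L2.nrm (\<phi> n + \<phi>' n - (u + u'))) \<longlonglongrightarrow> 0"
      by (intro L2_nrm_add_tendsto lim sq test_function_closed t)
    show "(\<lambda>n. L2.nrm (partial_x (\<phi> n + \<phi>' n) - (g + g'))) \<longlonglongrightarrow> 0"
      unfolding partial_x_linear(1)[OF t] by (intro L2_nrm_add_tendsto lim sq test_function_closed t)
    show "(\<lambda>n. L2.nrm (partial_y (partial_y (\<phi> n + \<phi>' n)) - (h + h'))) \<longlonglongrightarrow> 0"
      unfolding partial_y_linear(1)[OF t]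
        partial_y_linear(1)[OF test_function_partial_y[OF t(1)] test_function_partial_y[OF t(2)]]
      by (intro L2_nrm_add_tendsto lim sq test_function_closed t)
  qed (use sq in auto)
qed

lemma H12_limit_scale:
  assumes "H12_limit u g h"
  shows "H12_limit (r *\<^sub>R u) (r *\<^sub>R g) (r *\<^sub>R h)"
proof -
  obtain \<phi> where t: "\<And>n. test_function (\<phi> n)"
    and lim: "(\<lambda>n. L2.nrm (\<phi> n - u)) \<longlonglongrightarrow> 0" "(\<lambda>n. L2.nrm (partial_x (\<phi> n) - g)) \<longlonglongrightarrow> 0"
      "(\<lambda>n. L2.nrm (partial_y (partial_y (\<phi> n)) - h)) \<longlonglongrightarrow> 0"
    using assms unfolding H12_limit_iff by blast
  have sq: "square_integrable u" "square_integrable g" "square_integrable h"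
    using assms unfolding H12_limit_iff by auto
  show ?thesis
    unfolding H12_limit_iff
  proof (intro conjI exI allI)
    show "test_function (r *\<^sub>R \<phi> n)" for n
      using t by (intro test_function_scale')
    show "(\<lambda>n. L2.nrm (r *\<^sub>R \<phi> n - r *\<^sub>R u)) \<longlonglongrightarrow> 0"
      by (intro L2_nrm_scale_tendsto lim sq test_function_closed t)
    show "(\<lambda>n. L2.nrm (partial_x (r *\<^sub>R \<phi> n) - r *\<^sub>R g)) \<longlonglongrightarrow> 0"
      unfolding partial_x_linear(2)[OF t t] by (intro L2_nrm_scale_tendsto lim sq test_function_closed t)
    show "(\<lambda>n. L2.nrm (partial_y (partial_y (r *\<^sub>R \<phi> n)) - r *\<^sub>R h)) \<longlonglongrightarrow> 0"
      unfolding partial_y_linear(2)[OF t t]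
        partial_y_linear(2)[OF test_function_partial_y[OF t] test_function_partial_y[OF t]]
      by (intro L2_nrm_scale_tendsto lim sq test_function_closed t)
  qed (use sq in auto)
qed

lemma H12_limit_diff:
  assumes "H12_limit u g h" "H12_limit u' g' h'"
  shows "H12_limit (u - u') (g - g') (h - h')"
  using H12_limit_add[OF assms(1) H12_limit_scale[OF assms(2), of "-1"]] by simp

lemma test_function_H12_limit:
  assumes "test_function f"
  shows "H12_limit f (partial_x f) (partial_y (partial_y f))"
  unfolding H12_limit_iff
  by (intro conjI exI[of _ "\<lambda>n. f"]) (use assms in \<open>auto intro: test_function_closed\<close>)

lemma L2_nrm_diff_cong_AE:
  assumes "square_integrable f" "square_integrable u" "square_integrable u'" "AE z in lborel. u z = u' z"
  shows "L2.nrm (f - u) = L2.nrm (f - u')"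
proof -
  have "L2_inner (f - u) (f - u) = L2_inner (f - u') (f - u')"
  proof (rule L2_inner_cong_AE)
    show "AE z in lborel. (f - u) z = (f - u') z"
      using assms(4) by eventually_elim simp
    then show "AE z in lborel. (f - u) z = (f - u') z" .
  qed (use assms in auto)
  then show ?thesis by (simp add: L2.nrm_def)
qed

lemma H12_limit_cong_AE:
  assumes lim: "H12_limit u g h"
    and u': "square_integrable u'" "AE z in lborel. u z = u' z"
    and g': "square_integrable g'" "AE z in lborel. g z = g' z"
    and h': "square_integrable h'" "AE z in lborel. h z = h' z"
  shows "H12_limit u' g' h'"
proof -
  obtain \<phi> where t: "\<And>n. test_function (\<phi> n)"
    and lim': "(\<lambda>n. L2.nrm (\<phi> n - u)) \<longlonglongrightarrow> 0" "(\<lambda>n. L2.nrm (partial_x (\<phi> n) - g)) \<longlonglongrightarrow> 0"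
      "(\<lambda>n. L2.nrm (partial_y (partial_y (\<phi> n)) - h)) \<longlonglongrightarrow> 0"
    using lim unfolding H12_limit_iff by blast
  have sq: "square_integrable u" "square_integrable g" "square_integrable h"
    using lim unfolding H12_limit_iff by auto
  have "L2.nrm (\<phi> n - u) = L2.nrm (\<phi> n - u')"
    "L2.nrm (partial_x (\<phi> n) - g) = L2.nrm (partial_x (\<phi> n) - g')"
    "L2.nrm (partial_y (partial_y (\<phi> n)) - h) = L2.nrm (partial_y (partial_y (\<phi> n)) - h')" for n
    by (intro L2_nrm_diff_cong_AE test_function_closed t sq u' g' h')+
  then show ?thesis
    unfolding H12_limit_iff using u' g' h' t lim' by auto
qed

lemma H12_limit_weak_derivatives:
  assumes lim: "H12_limit u g h" and \<psi>: "test_function \<psi>"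
  shows "L2_inner g \<psi> = - L2_inner u (partial_x \<psi>)"
    and "L2_inner h \<psi> = L2_inner u (partial_y (partial_y \<psi>))"
proof -
  obtain \<phi> where t: "\<And>n. test_function (\<phi> n)"
    and lim': "(\<lambda>n. L2.nrm (\<phi> n - u)) \<longlonglongrightarrow> 0" "(\<lambda>n. L2.nrm (partial_x (\<phi> n) - g)) \<longlonglongrightarrow> 0"
      "(\<lambda>n. L2.nrm (partial_y (partial_y (\<phi> n)) - h)) \<longlonglongrightarrow> 0"
    using lim unfolding H12_limit_iff by blast
  have sq: "square_integrable u" "square_integrable g" "square_integrable h"
    using lim unfolding H12_limit_iff by auto
  have conv: "(\<lambda>n. L2_inner (f n) k) \<longlonglongrightarrow> L2_inner f' k"
    if "\<And>n. square_integrable (f n)" "square_integrable f'" "square_integrable k" "(\<lambda>n. L2.nrm (f n - f')) \<longlonglongrightarrow> 0"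
    for f f' k
    by (rule L2.tendsto_B) (use that in auto)
  note \<psi>s = \<psi> test_function_partial_x[OF \<psi>] test_function_partial_y[OF \<psi>] test_function_partial_y[OF test_function_partial_y[OF \<psi>]]
  have "(\<lambda>n. L2_inner (partial_x (\<phi> n)) \<psi>) \<longlonglongrightarrow> L2_inner g \<psi>"
    by (intro conv test_function_closed t sq \<psi>s lim')
  moreover have "(\<lambda>n. L2_inner (partial_x (\<phi> n)) \<psi>) \<longlonglongrightarrow> - L2_inner u (partial_x \<psi>)"
    unfolding integration_by_parts_x[OF t \<psi>]
    by (intro tendsto_minus conv test_function_closed t sq \<psi>s lim')
  ultimately show "L2_inner g \<psi> = - L2_inner u (partial_x \<psi>)"
    using LIMSEQ_unique by blast
  have "(\<lambda>n. L2_inner (partial_y (partial_y (\<phi> n))) \<psi>) \<longlonglongrightarrow> L2_inner h \<psi>"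
    by (intro conv test_function_closed t sq \<psi>s lim')
  moreover have "(\<lambda>n. L2_inner (partial_y (partial_y (\<phi> n))) \<psi>) \<longlonglongrightarrow> L2_inner u (partial_y (partial_y \<psi>))"
    unfolding integration_by_parts_y[OF test_function_partial_y[OF t] \<psi>] integration_by_parts_y[OF t \<psi>s(3)] minus_minus
    by (intro conv test_function_closed t sq \<psi>s lim')
  ultimately show "L2_inner h \<psi> = L2_inner u (partial_y (partial_y \<psi>))"
    using LIMSEQ_unique by blast
qed

lemma L2_limit_orthogonal_imp_AE_0:
  assumes f: "\<And>n. square_integrable (f n)" and g: "square_integrable g"
    and lim: "(\<lambda>n. L2.nrm (f n - g)) \<longlonglongrightarrow> 0" and orth: "\<And>n. L2_inner g (f n) = 0"
  shows "AE z in lborel. g z = 0"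
proof -
  have "(\<lambda>n. L2_inner g (f n)) \<longlonglongrightarrow> L2_inner g g"
    by (rule L2.tendsto_B) (use assms in auto)
  then have "L2_inner g g = 0"
    by (simp add: orth LIMSEQ_const_iff)
  then have "L2_norm g = 0"
    by (simp add: L2_nrm_eq[symmetric] L2.nrm_def)
  then show ?thesis
    using L2_norm_eq_0_imp_AE g by blast
qed

text \<open>
  The graph of the derivatives is closable: the weak derivatives of a null function are orthogonal
  to all test functions, and they are themselves \<open>L\<^sup>2\<close> limits of test functions.
\<close>

lemma H12_limit_unique:
  assumes "H12_limit u g h" "H12_limit u' g' h'" and eq: "AE z in lborel. u z = u' z"
  shows "AE z in lborel. g z = g' z" and "AE z in lborel. h z = h' z"
proof -
  have d: "H12_limit (u - u') (g - g') (h - h')"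
    using H12_limit_diff assms by blast
  obtain \<phi> where t: "\<And>n. test_function (\<phi> n)"
    and lim': "(\<lambda>n. L2.nrm (partial_x (\<phi> n) - (g - g'))) \<longlonglongrightarrow> 0"
      "(\<lambda>n. L2.nrm (partial_y (partial_y (\<phi> n)) - (h - h'))) \<longlonglongrightarrow> 0"
    using d unfolding H12_limit_iff by blast
  have sq: "square_integrable (u - u')" "square_integrable (g - g')" "square_integrable (h - h')"
    using d unfolding H12_limit_iff by auto
  have zero: "L2_inner (u - u') k = 0" if k: "square_integrable k" for k
  proof -
    have "L2_inner (u - u') k = L2_inner 0 k"
      by (rule L2_inner_cong_AE) (use sq k eq in auto)
    then show ?thesis by (simp add: L2_inner_def)
  qed
  have "AE z in lborel. (g - g') z = 0"
    by (rule L2_limit_orthogonal_imp_AE_0[OF _ sq(2) lim'(1)])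
      (use t H12_limit_weak_derivatives(1)[OF d test_function_partial_x[OF t]] in
        \<open>auto intro!: test_function_closed zero\<close>)
  then show "AE z in lborel. g z = g' z" by simp
  have "AE z in lborel. (h - h') z = 0"
    by (rule L2_limit_orthogonal_imp_AE_0[OF _ sq(3) lim'(2)])
      (use t H12_limit_weak_derivatives(2)[OF d test_function_partial_y[OF test_function_partial_y[OF t]]] in
        \<open>auto intro!: test_function_closed zero\<close>)
  then show "AE z in lborel. h z = h' z" by simp
qed

text \<open>
  The two components are chosen independently of each other. By uniqueness they nevertheless belong
  to the same approximating sequence.
\<close>

lemma H12_limit_derivatives:
  assumes "u \<in> H12"
  shows "H12_limit u (H12_dx u) (H12_dyy u)"
proof -
  obtain h where h: "H12_limit u (H12_dx u) h"
    using assms someI_ex[of "\<lambda>g. \<exists>h. H12_limit u g h"] unfolding H12_def H12_dx_def by blast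
  obtain g where g: "H12_limit u g (H12_dyy u)"
    using assms someI_ex[of "\<lambda>h. \<exists>g. H12_limit u g h"] unfolding H12_def H12_dyy_def by blast
  have "AE z in lborel. h z = H12_dyy u z"
    using H12_limit_unique(2)[OF h g] by simp
  then show ?thesis
    using H12_limit_cong_AE[OF h] h g unfolding H12_limit_iff by auto
qed

lemma H12_limit_imp_H12: "H12_limit u g h \<Longrightarrow> u \<in> H12"
  unfolding H12_def by blast

lemma test_function_H12: "test_function f \<Longrightarrow> f \<in> H12"
  using test_function_H12_limit H12_limit_imp_H12 by blast

lemma H12_square_integrable: "u \<in> H12 \<Longrightarrow> square_integrable u"
  and H12_dx_square_integrable: "u \<in> H12 \<Longrightarrow> square_integrable (H12_dx u)"
  and H12_dyy_square_integrable: "u \<in> H12 \<Longrightarrow> square_integrable (H12_dyy u)"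
  using H12_limit_derivatives unfolding H12_limit_def by blast+

text \<open>
  Uniqueness of weak derivatives frees computations from the choice made in \<open>H12_dx\<close> and \<open>H12_dyy\<close>.
\<close>

lemma energy_eq:
  assumes u: "H12_limit u g h" and v: "H12_limit v g' h'"
  shows "energy \<omega> u v = L2_inner g g' + L2_inner h h' + \<omega> * L2_inner u v"
proof -
  note du = H12_limit_derivatives[OF H12_limit_imp_H12[OF u]]
  note dv = H12_limit_derivatives[OF H12_limit_imp_H12[OF v]]
  have "L2_inner (H12_dx u) (H12_dx v) = L2_inner g g'"
    by (rule L2_inner_cong_AE)
      (use u v du dv H12_limit_unique(1)[OF du u] H12_limit_unique(1)[OF dv v] in \<open>auto simp: H12_limit_def\<close>)
  moreover have "L2_inner (H12_dyy u) (H12_dyy v) = L2_inner h h'"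
    by (rule L2_inner_cong_AE)
      (use u v du dv H12_limit_unique(2)[OF du u] H12_limit_unique(2)[OF dv v] in \<open>auto simp: H12_limit_def\<close>)
  ultimately show ?thesis
    unfolding energy_def by simp
qed

lemma H12_closed:
  shows H12_add: "u \<in> H12 \<Longrightarrow> v \<in> H12 \<Longrightarrow> u + v \<in> H12"
    and H12_scale: "u \<in> H12 \<Longrightarrow> r *\<^sub>R u \<in> H12"
  using H12_limit_add H12_limit_scale unfolding H12_def by blast+

lemma subspace_H12: "subspace H12"
proof -
  have "test_function 0"
  proof -
    have "C_k k (\<lambda>z. 0)" for k
      by (induction k) (auto simp: partial_x_def partial_y_def case_prod_beta')
    then show ?thesis
      unfolding test_function_iff by (auto simp: zero_fun_def)
  qed
  then show ?thesis
    by (simp add: subspace_def H12_closed test_function_H12)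
qed

lemma energy_semi_inner_product:
  assumes "\<omega> \<ge> 0"
  shows "semi_inner_product H12 (energy \<omega>)"
proof
  show "subspace H12" by (rule subspace_H12)
next
  fix u v assume "u \<in> H12" "v \<in> H12"
  then show "energy \<omega> u v = energy \<omega> v u"
    unfolding energy_def
    by (simp add: L2.sym H12_square_integrable H12_dx_square_integrable H12_dyy_square_integrable)
next
  fix u v w assume uvw: "u \<in> H12" "v \<in> H12" "w \<in> H12"
  note lims = uvw[THEN H12_limit_derivatives]
  have sq: "square_integrable k" if "k \<in> {u, v, w, H12_dx u, H12_dx v, H12_dx w, H12_dyy u, H12_dyy v, H12_dyy w}" for k
    using that uvw by (auto simp: H12_square_integrable H12_dx_square_integrable H12_dyy_square_integrable)
  show "energy \<omega> (u + v) w = energy \<omega> u w + energy \<omega> v w"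
    unfolding energy_eq[OF H12_limit_add[OF lims(1,2)] lims(3)] energy_eq[OF lims(1,3)] energy_eq[OF lims(2,3)]
    using sq by (simp add: L2.bilinear algebra_simps)
next
  fix u v r assume uv: "u \<in> H12" "v \<in> H12"
  note lims = uv[THEN H12_limit_derivatives]
  have sq: "square_integrable k" if "k \<in> {u, v, H12_dx u, H12_dx v, H12_dyy u, H12_dyy v}" for k
    using that uv by (auto simp: H12_square_integrable H12_dx_square_integrable H12_dyy_square_integrable)
  show "energy \<omega> (r *\<^sub>R u) v = r * energy \<omega> u v"
    unfolding energy_eq[OF H12_limit_scale[OF lims(1)] lims(2)] energy_eq[OF lims(1,2)]
    using sq by (simp add: L2.bilinear algebra_simps)
next
  fix u assume "u \<in> H12"
  then show "0 \<le> energy \<omega> u u"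
    unfolding energy_def using assms
    by (simp add: L2.nonneg H12_square_integrable H12_dx_square_integrable H12_dyy_square_integrable)
qed

lemma continuous_le_if_AE_le:
  fixes f :: "real \<times> real \<Rightarrow> real"
  assumes cont: "continuous_on UNIV f" and le: "AE z in lborel. f z \<le> c"
  shows "f z \<le> c"
proof -
  have op: "open {z. c < f z}"
    using cont by (intro open_Collect_less continuous_intros) auto
  have "{z. c < f z} \<in> null_sets lborel"
    using le AE_iff_null_sets[of "{z. c < f z}" lborel] op by (simp add: not_less)
  then have "negligible {z. c < f z}"
    by (simp add: negligible_iff_null_sets null_sets_completionI)
  then have "{z. c < f z} = {}"
    using open_not_negligible[OF op] by blast
  then show ?thesis by (metis empty_Collect_eq not_less)
qed

lemma H12_norm_nonneg: "u \<in> H12 \<Longrightarrow> H12_norm u \<ge> 0"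
  by (simp add: H12_norm_def L2_norm_def)

lemma H12_norm_scale:
  assumes u: "u \<in> H12"
  shows "H12_norm (r *\<^sub>R u) = \<bar>r\<bar> * H12_norm u"
proof -
  note l = H12_limit_derivatives[OF u]
  note l1 = H12_limit_scale[OF l, of r] and l2 = H12_limit_derivatives[OF H12_scale[OF u, of r]]
  note eq = H12_limit_unique[OF l2 l1]
  have "L2_norm (H12_dx (r *\<^sub>R u)) = L2.nrm (r *\<^sub>R H12_dx u)"
    unfolding L2_nrm_eq[symmetric] L2.nrm_def
    by (intro arg_cong[of _ _ sqrt] L2_inner_cong_AE) (use l1 l2 eq in \<open>auto simp: H12_limit_def\<close>)
  moreover have "L2_norm (H12_dyy (r *\<^sub>R u)) = L2.nrm (r *\<^sub>R H12_dyy u)"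
    unfolding L2_nrm_eq[symmetric] L2.nrm_def
    by (intro arg_cong[of _ _ sqrt] L2_inner_cong_AE) (use l1 l2 eq in \<open>auto simp: H12_limit_def\<close>)
  moreover have "L2_norm (r *\<^sub>R u) = L2.nrm (r *\<^sub>R u)"
    by (simp add: L2_nrm_eq)
  moreover have "square_integrable u" "square_integrable (H12_dx u)" "square_integrable (H12_dyy u)"
    using l by (simp_all add: H12_limit_def)
  ultimately show ?thesis
    unfolding H12_norm_def L2_nrm_eq[symmetric] by (simp add: L2.nrm_scale algebra_simps)
qed

locale positive_frequency =
  fixes \<omega> :: real
  assumes \<omega>: "\<omega> > 0"
begin

sublocale H: semi_inner_product H12 "energy \<omega>"
  using energy_semi_inner_product \<omega> by simp

lemma energy_parts_le:
  assumes "H12_limit u g h"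
  shows "L2.nrm g \<le> H.nrm u" "L2.nrm h \<le> H.nrm u" "L2.nrm u \<le> H.nrm u / sqrt \<omega>"
proof -
  have sq: "square_integrable u" "square_integrable g" "square_integrable h"
    using assms unfolding H12_limit_def by auto
  have e: "energy \<omega> u u = L2_inner g g + L2_inner h h + \<omega> * L2_inner u u"
    using energy_eq[OF assms assms] .
  have n: "L2_inner g g \<ge> 0" "L2_inner h h \<ge> 0" "\<omega> * L2_inner u u \<ge> 0"
    using sq \<omega> by (auto intro!: mult_nonneg_nonneg L2.nonneg)
  show "L2.nrm g \<le> H.nrm u" "L2.nrm h \<le> H.nrm u"
    unfolding L2.nrm_def H.nrm_def using e n by simp_all
  have "sqrt (\<omega> * L2_inner u u) \<le> H.nrm u"
    unfolding H.nrm_def using e n by simp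
  then show "L2.nrm u \<le> H.nrm u / sqrt \<omega>"
    using \<omega> by (simp add: L2.nrm_def real_sqrt_mult field_simps)
qed

lemma L2_inner_le_energy: "u \<in> H12 \<Longrightarrow> \<omega> * L2_inner u u \<le> energy \<omega> u u"
  unfolding energy_def
  by (simp add: L2.nonneg H12_dx_square_integrable H12_dyy_square_integrable)

lemma energy_nrm_le_H12_norm:
  assumes u: "u \<in> H12"
  shows "H.nrm u \<le> (1 + sqrt \<omega>) * H12_norm u"
proof -
  note sq = H12_dx_square_integrable[OF u] H12_dyy_square_integrable[OF u] H12_square_integrable[OF u]
  let ?a = "L2.nrm (H12_dx u)" and ?b = "L2.nrm (H12_dyy u)" and ?c = "L2.nrm u"
  have n: "?a \<ge> 0" "?b \<ge> 0" "?c \<ge> 0" using sq L2.nrm_nonneg by auto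
  have "energy \<omega> u u = ?a\<^sup>2 + ?b\<^sup>2 + (sqrt \<omega> * ?c)\<^sup>2"
    using sq \<omega> by (simp add: energy_def L2.nrm_square power_mult_distrib)
  also have "\<dots> \<le> (?a + ?b + sqrt \<omega> * ?c)\<^sup>2"
    using n \<omega> by (simp add: power2_sum algebra_simps)
  finally have "H.nrm u \<le> sqrt ((?a + ?b + sqrt \<omega> * ?c)\<^sup>2)"
    unfolding H.nrm_def by (rule real_sqrt_le_mono)
  also have "\<dots> = ?a + ?b + sqrt \<omega> * ?c"
    using n \<omega> by simp
  also have "\<dots> \<le> (1 + sqrt \<omega>) * (?a + ?b + ?c)"
    using n \<omega> by (simp add: algebra_simps)
  finally show ?thesis
    by (simp add: H12_norm_def L2_nrm_eq)
qed

lemma H12_limitI_nrm: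
  assumes lim: "H12_limit u g h" and t: "\<And>n. test_function (\<phi> n)"
    and "(\<lambda>n. L2.nrm (\<phi> n - u)) \<longlonglongrightarrow> 0" "(\<lambda>n. L2.nrm (partial_x (\<phi> n) - g)) \<longlonglongrightarrow> 0"
      "(\<lambda>n. L2.nrm (partial_y (partial_y (\<phi> n)) - h)) \<longlonglongrightarrow> 0"
  shows "(\<lambda>n. H.nrm (\<phi> n - u)) \<longlonglongrightarrow> 0"
proof -
  have sq: "square_integrable u" "square_integrable g" "square_integrable h"
    using lim unfolding H12_limit_def by auto
  have eq: "H.nrm (\<phi> n - u) = sqrt ((L2.nrm (partial_x (\<phi> n) - g))\<^sup>2 + (L2.nrm (partial_y (partial_y (\<phi> n)) - h))\<^sup>2
      + \<omega> * (L2.nrm (\<phi> n - u))\<^sup>2)" for n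
    using energy_eq[OF H12_limit_diff[OF test_function_H12_limit[OF t[of n]] lim]
        H12_limit_diff[OF test_function_H12_limit[OF t[of n]] lim], of \<omega>] sq t
    by (simp add: H.nrm_def L2.nrm_square test_function_closed)
  have "(\<lambda>n. H.nrm (\<phi> n - u)) \<longlonglongrightarrow> sqrt (0\<^sup>2 + 0\<^sup>2 + \<omega> * 0\<^sup>2)"
    unfolding eq by (intro tendsto_intros assms)
  then show ?thesis by simp
qed

lemma H12_approximation:
  assumes "u \<in> H12"
  obtains \<phi> where "\<And>n. test_function (\<phi> n)" "(\<lambda>n. H.nrm (\<phi> n - u)) \<longlonglongrightarrow> 0"
    "AE z in lborel. (\<lambda>n. \<phi> n z) \<longlonglongrightarrow> u z"
proof -
  note lim = H12_limit_derivatives[OF assms]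
  obtain \<phi> where t: "\<And>n. test_function (\<phi> n)"
    and l: "(\<lambda>n. L2.nrm (\<phi> n - u)) \<longlonglongrightarrow> 0" "(\<lambda>n. L2.nrm (partial_x (\<phi> n) - H12_dx u)) \<longlonglongrightarrow> 0"
      "(\<lambda>n. L2.nrm (partial_y (partial_y (\<phi> n)) - H12_dyy u)) \<longlonglongrightarrow> 0"
    using lim unfolding H12_limit_iff by blast
  have *: "(\<lambda>n. H.nrm (\<phi> n - u)) \<longlonglongrightarrow> 0"
    by (rule H12_limitI_nrm[OF lim t l])
  obtain r where r: "strict_mono (r :: nat \<Rightarrow> nat)" "AE z in lborel. (\<lambda>n. \<phi> (r n) z) \<longlonglongrightarrow> u z"
    using L2_limit_AE_subsequence[of \<phi> u] l(1) t assms
    by (auto simp: L2_norm_eq_nrm_diff H12_square_integrable test_function_closed)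
  show ?thesis
    by (rule that[of "\<lambda>n. \<phi> (r n)"]) (use t r LIMSEQ_subseq_LIMSEQ[OF * r(1)] in \<open>auto simp: o_def\<close>)
qed

definition sup_const :: real where
  "sup_const = sqrt (2 + 1 / \<omega>)"

lemma sup_const_pos: "sup_const > 0"
  unfolding sup_const_def using \<omega> by (simp add: add_pos_pos)

text \<open>
  The constant only has to dominate the coefficients \<open>1\<close>, \<open>2\<close>, \<open>1\<close> in the Sobolev inequality by the
  coefficients \<open>\<omega>\<close>, \<open>1\<close>, \<open>1\<close> of the energy.
\<close>

lemma test_function_sup_bound:
  assumes f: "test_function f"
  shows "cmod (f z) \<le> sup_const * H.nrm f"
proof -
  let ?A = "L2_inner (partial_x f) (partial_x f)" and ?B = "L2_inner (partial_y (partial_y f)) (partial_y (partial_y f))"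
    and ?C = "L2_inner f f"
  have n: "?A \<ge> 0" "?B \<ge> 0" "?C \<ge> 0"
    using f by (auto intro!: L2.nonneg test_function_closed)
  have e: "energy \<omega> f f = ?A + ?B + \<omega> * ?C"
    using energy_eq[OF test_function_H12_limit[OF f] test_function_H12_limit[OF f]] .
  have "(cmod (f z))\<^sup>2 \<le> ?C + 2 * ?A + ?B"
    by (rule anisotropic_Sobolev[OF f])
  also have "\<dots> \<le> (2 + 1 / \<omega>) * (?A + ?B + \<omega> * ?C)"
  proof -
    have "(2 + 1 / \<omega>) * (?A + ?B + \<omega> * ?C) = ?C + 2 * ?A + ?B + (?B + 2 * \<omega> * ?C + (?A + ?B) / \<omega>)"
      using \<omega> by (simp add: field_simps)
    moreover have "0 \<le> ?B + 2 * \<omega> * ?C + (?A + ?B) / \<omega>"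
      using n \<omega> by (intro add_nonneg_nonneg mult_nonneg_nonneg divide_nonneg_nonneg) auto
    ultimately show ?thesis by linarith
  qed
  also have "\<dots> = (sup_const * H.nrm f)\<^sup>2"
    using \<omega> H.nonneg[OF test_function_H12[OF f]]
    by (simp add: sup_const_def H.nrm_def power_mult_distrib e)
  finally show ?thesis
    by (rule power2_le_imp_le)
      (use sup_const_pos H.nrm_nonneg[OF test_function_H12[OF f]] in \<open>auto intro!: mult_nonneg_nonneg\<close>)
qed

lemma test_function_normalize:
  assumes t: "test_function \<phi>" and s: "H.nrm \<phi> \<le> s" "s > 0"
  shows "test_function ((1 / s) *\<^sub>R \<phi>)" "energy \<omega> ((1 / s) *\<^sub>R \<phi>) ((1 / s) *\<^sub>R \<phi>) \<le> 1"
proof -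
  show t': "test_function ((1 / s) *\<^sub>R \<phi>)" using t by (rule test_function_scale')
  have "H.nrm ((1 / s) *\<^sub>R \<phi>) \<le> 1"
    using H.nrm_scale[OF test_function_H12[OF t], of "1 / s"] s by simp
  then have "(H.nrm ((1 / s) *\<^sub>R \<phi>))\<^sup>2 \<le> 1\<^sup>2"
    by (intro power_mono H.nrm_nonneg test_function_H12 t')
  then show "energy \<omega> ((1 / s) *\<^sub>R \<phi>) ((1 / s) *\<^sub>R \<phi>) \<le> 1"
    by (simp add: H.nrm_square[OF test_function_H12[OF t']])
qed

lemma H12_sup_bound_AE:
  assumes u: "u \<in> H12"
  shows "AE z in lborel. cmod (u z) \<le> sup_const * H.nrm u"
proof -
  obtain \<phi> where t: "\<And>n. test_function (\<phi> n)" and l: "(\<lambda>n. H.nrm (\<phi> n - u)) \<longlonglongrightarrow> 0"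
    and ae: "AE z in lborel. (\<lambda>n. \<phi> n z) \<longlonglongrightarrow> u z"
    using H12_approximation[OF u] by blast
  have "(\<lambda>n. energy \<omega> (\<phi> n) (\<phi> n)) \<longlonglongrightarrow> energy \<omega> u u"
    using t u l by (intro H.tendsto_B) (auto intro: test_function_H12)
  then have nl: "(\<lambda>n. sup_const * H.nrm (\<phi> n)) \<longlonglongrightarrow> sup_const * H.nrm u"
    unfolding H.nrm_def by (intro tendsto_intros)
  show ?thesis
    using ae
  proof eventually_elim
    case (elim z)
    show ?case
      by (rule tendsto_le[OF _ nl tendsto_norm[OF elim]]) (use test_function_sup_bound[OF t] in auto)
  qed
qed

text \<open>
  Every element of \<open>H12\<close> agrees almost everywhere with a unique continuous function, and only for
  continuous functions is the value at a point a bounded functional. Weak limits are therefore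
  taken among the continuous elements.
\<close>

definition HC :: "(real \<times> real \<Rightarrow> complex) set" where
  "HC = {u \<in> H12. continuous_on UNIV u}"

lemma HC_subset_H12: "u \<in> HC \<Longrightarrow> u \<in> H12"
  by (simp add: HC_def)

lemma test_function_HC: "test_function f \<Longrightarrow> f \<in> HC"
  by (simp add: HC_def test_function_H12 test_function_continuous)

lemma HC_sup_bound:
  assumes "u \<in> HC"
  shows "cmod (u z) \<le> sup_const * H.nrm u"
  using assms H12_sup_bound_AE[of u] unfolding HC_def
  by (intro continuous_le_if_AE_le[of "\<lambda>z. cmod (u z)"]) (auto intro: continuous_intros)

text \<open>
  Test functions that converge in the energy norm converge uniformly, by the sup bound.
\<close>

lemma continuous_representative:
  assumes u: "u \<in> H12"
  obtains v where "v \<in> HC" "AE z in lborel. u z = v z" "H.nrm (u - v) = 0"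
proof -
  obtain \<phi> where t: "\<And>n. test_function (\<phi> n)" and l: "(\<lambda>n. H.nrm (\<phi> n - u)) \<longlonglongrightarrow> 0"
    and ae: "AE z in lborel. (\<lambda>n. \<phi> n z) \<longlonglongrightarrow> u z"
    using H12_approximation[OF u] by blast
  have "uniformly_Cauchy_on UNIV \<phi>"
  proof (rule uniformly_Cauchy_onI)
    fix e :: real assume e: "e > 0"
    define d where "d = e / (2 * sup_const)"
    have d: "d > 0" using e sup_const_pos by (simp add: d_def)
    obtain M where M: "\<And>n. n \<ge> M \<Longrightarrow> H.nrm (\<phi> n - u) < d"
      using order_tendstoD(2)[OF l d] by (auto simp: eventually_sequentially)
    have "dist (\<phi> m z) (\<phi> n z) < e" if "m \<ge> M" "n \<ge> M" for m n z
    proof -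
      have "dist (\<phi> m z) (\<phi> n z) = cmod ((\<phi> m - \<phi> n) z)"
        by (simp add: dist_norm)
      also have "\<dots> \<le> sup_const * H.nrm (\<phi> m - \<phi> n)"
        by (rule test_function_sup_bound[OF test_function_diff[OF t t]])
      also have "\<dots> \<le> sup_const * (H.nrm (\<phi> m - u) + H.nrm (\<phi> n - u))"
        using H.nrm_triangle_diff[of "\<phi> m" u "\<phi> n"] H.nrm_diff_commute[of u "\<phi> n"] t u sup_const_pos
        by (intro mult_left_mono) (auto simp: test_function_H12)
      also have "\<dots> < sup_const * (d + d)"
        using M[OF that(1)] M[OF that(2)] sup_const_pos by (intro mult_strict_left_mono) auto
      also have "\<dots> = e"
        using sup_const_pos by (simp add: d_def)
      finally show ?thesis .
    qed
    then show "\<exists>M. \<forall>x\<in>UNIV. \<forall>m\<ge>M. \<forall>n\<ge>M. dist (\<phi> m x) (\<phi> n x) < e" by blast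
  qed
  then have "uniformly_convergent_on UNIV \<phi>"
    by (rule Cauchy_uniformly_convergent)
  then obtain v where v: "uniform_limit UNIV \<phi> v sequentially"
    unfolding uniformly_convergent_on_def by blast
  have cont: "continuous_on UNIV v"
    by (rule uniform_limit_theorem[OF _ v]) (use t test_function_continuous in auto)
  have uv: "AE z in lborel. u z = v z"
    using ae
  proof eventually_elim
    case (elim z)
    then show ?case
      using tendsto_uniform_limitI[OF v, of z] LIMSEQ_unique by blast
  qed
  note lim = H12_limit_derivatives[OF u]
  have sqv: "square_integrable v"
    using square_integrable_cong_AE[OF H12_square_integrable[OF u] uv] cont
    by (simp add: borel_measurable_continuous_onI)
  have vlim: "H12_limit v (H12_dx u) (H12_dyy u)"
    by (rule H12_limit_cong_AE[OF lim sqv uv]) (use lim in \<open>auto simp: H12_limit_def\<close>)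
  then have vHC: "v \<in> HC"
    unfolding HC_def using cont H12_limit_imp_H12 by blast
  have "L2_inner (u - v) (u - v) = L2_inner 0 0"
    by (rule L2_inner_cong_AE) (use uv sqv H12_square_integrable[OF u] in auto)
  then have "H.nrm (u - v) = 0"
    using energy_eq[OF H12_limit_diff[OF lim vlim] H12_limit_diff[OF lim vlim], of \<omega>]
    by (simp add: H.nrm_def L2_inner_def)
  then show ?thesis using that vHC uv by blast
qed

text \<open>
  Replacing each term by a nearby test function reduces the claim to the completeness of \<open>L\<^sup>2\<close> for the
  three components.
\<close>

lemma H12_complete:
  assumes X: "\<And>n. X n \<in> H12"
    and Cau: "\<And>e. e > 0 \<Longrightarrow> \<exists>k. \<forall>m\<ge>k. \<forall>n\<ge>k. H.nrm (X m - X n) < e"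
  shows "\<exists>u\<in>H12. (\<lambda>n. H.nrm (X n - u)) \<longlonglongrightarrow> 0"
proof -
  have "\<exists>\<phi>. test_function \<phi> \<and> H.nrm (X n - \<phi>) < inverse (real (Suc n))" for n
  proof -
    obtain \<phi> where t: "\<And>k. test_function (\<phi> k)" and l: "(\<lambda>k. H.nrm (\<phi> k - X n)) \<longlonglongrightarrow> 0"
      using H12_approximation[OF X[of n]] by blast
    have "\<forall>\<^sub>F k in sequentially. H.nrm (\<phi> k - X n) < inverse (real (Suc n))"
      using order_tendstoD(2)[OF l] by simp
    then obtain k where "H.nrm (\<phi> k - X n) < inverse (real (Suc n))"
      by (auto simp: eventually_sequentially)
    then show ?thesis
      using t H.nrm_diff_commute[of "\<phi> k" "X n"] X test_function_H12[OF t] by auto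
  qed
  then obtain \<phi> where t: "\<And>n. test_function (\<phi> n)" and \<phi>X: "\<And>n. H.nrm (X n - \<phi> n) < inverse (real (Suc n))"
    by metis
  note tH = test_function_H12[OF t]
  have l0: "(\<lambda>n. H.nrm (X n - \<phi> n)) \<longlonglongrightarrow> 0"
  proof (rule tendsto_sandwich[OF _ _ tendsto_const LIMSEQ_inverse_real_of_nat])
    show "\<forall>\<^sub>F n in sequentially. H.nrm (X n - \<phi> n) \<le> inverse (real (Suc n))"
      using \<phi>X less_imp_le by (intro always_eventually allI) blast
  qed (use X tH in \<open>auto intro!: always_eventually H.nrm_nonneg\<close>)
  have \<phi>Cau: "\<exists>k. \<forall>m\<ge>k. \<forall>n\<ge>k. H.nrm (\<phi> m - \<phi> n) < e" if e: "e > 0" for e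
  proof -
    obtain k1 where k1: "\<And>m n. m \<ge> k1 \<Longrightarrow> n \<ge> k1 \<Longrightarrow> H.nrm (X m - X n) < e / 3"
      using Cau[of "e / 3"] e by auto
    obtain k2 where k2: "\<And>n. n \<ge> k2 \<Longrightarrow> H.nrm (X n - \<phi> n) < e / 3"
      using order_tendstoD(2)[OF l0, of "e / 3"] e by (auto simp: eventually_sequentially)
    have "H.nrm (\<phi> m - \<phi> n) < e" if "m \<ge> max k1 k2" "n \<ge> max k1 k2" for m n
    proof -
      have "H.nrm (\<phi> m - \<phi> n) \<le> H.nrm (\<phi> m - X m) + (H.nrm (X m - X n) + H.nrm (X n - \<phi> n))"
        using H.nrm_triangle_diff[of "\<phi> m" "X m" "\<phi> n"] H.nrm_triangle_diff[of "X m" "X n" "\<phi> n"] tH X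
        by (smt (verit))
      then show ?thesis
        using k1[of m n] k2[of m] k2[of n] that H.nrm_diff_commute[OF tH X, of m m] by simp
    qed
    then show ?thesis by blast
  qed
  have lims: "H12_limit (\<phi> m - \<phi> n) (partial_x (\<phi> m) - partial_x (\<phi> n))
      (partial_y (partial_y (\<phi> m)) - partial_y (partial_y (\<phi> n)))" for m n
    by (intro H12_limit_diff test_function_H12_limit t)
  have C: "\<exists>k. \<forall>m\<ge>k. \<forall>n\<ge>k. L2.nrm (partial_x (\<phi> m) - partial_x (\<phi> n)) < e"
    "\<exists>k. \<forall>m\<ge>k. \<forall>n\<ge>k. L2.nrm (partial_y (partial_y (\<phi> m)) - partial_y (partial_y (\<phi> n))) < e"
    "\<exists>k. \<forall>m\<ge>k. \<forall>n\<ge>k. L2.nrm (\<phi> m - \<phi> n) < e" if e: "e > 0" for e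
  proof -
    show "\<exists>k. \<forall>m\<ge>k. \<forall>n\<ge>k. L2.nrm (partial_x (\<phi> m) - partial_x (\<phi> n)) < e"
      "\<exists>k. \<forall>m\<ge>k. \<forall>n\<ge>k. L2.nrm (partial_y (partial_y (\<phi> m)) - partial_y (partial_y (\<phi> n))) < e"
      using \<phi>Cau[OF e] energy_parts_le(1,2)[OF lims] by (meson order_le_less_trans)+
    have "e * sqrt \<omega> > 0" using e \<omega> by simp
    from \<phi>Cau[OF this] obtain k where k: "\<And>m n. m \<ge> k \<Longrightarrow> n \<ge> k \<Longrightarrow> H.nrm (\<phi> m - \<phi> n) < e * sqrt \<omega>"
      by blast
    have "L2.nrm (\<phi> m - \<phi> n) < e" if "m \<ge> k" "n \<ge> k" for m n
    proof -
      have "H.nrm (\<phi> m - \<phi> n) / sqrt \<omega> < e"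
        using k[OF that] \<omega> by (simp add: field_simps)
      then show ?thesis
        using energy_parts_le(3)[OF lims, of m n] by simp
    qed
    then show "\<exists>k. \<forall>m\<ge>k. \<forall>n\<ge>k. L2.nrm (\<phi> m - \<phi> n) < e" by blast
  qed
  have sq: "square_integrable (\<phi> n)" "square_integrable (partial_x (\<phi> n))"
    "square_integrable (partial_y (partial_y (\<phi> n)))" for n
    by (intro test_function_closed t)+
  obtain g where g: "square_integrable g" "(\<lambda>n. L2.nrm (partial_x (\<phi> n) - g)) \<longlonglongrightarrow> 0"
    by (rule L2_complete[OF sq(2) C(1)]) blast+
  obtain h where h: "square_integrable h" "(\<lambda>n. L2.nrm (partial_y (partial_y (\<phi> n)) - h)) \<longlonglongrightarrow> 0"
    by (rule L2_complete[OF sq(3) C(2)]) blast+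
  obtain u where u: "square_integrable u" "(\<lambda>n. L2.nrm (\<phi> n - u)) \<longlonglongrightarrow> 0"
    by (rule L2_complete[OF sq(1) C(3)]) blast+
  have lim: "H12_limit u g h"
    unfolding H12_limit_iff using u g h t by blast
  have l1: "(\<lambda>n. H.nrm (\<phi> n - u)) \<longlonglongrightarrow> 0"
    by (rule H12_limitI_nrm[OF lim t u(2) g(2) h(2)])
  have uH: "u \<in> H12"
    using lim H12_limit_imp_H12 by blast
  have "(\<lambda>n. H.nrm (X n - u)) \<longlonglongrightarrow> 0"
  proof (rule tendsto_sandwich[OF _ _ tendsto_const])
    show "(\<lambda>n. H.nrm (X n - \<phi> n) + H.nrm (\<phi> n - u)) \<longlonglongrightarrow> 0"
      using tendsto_add[OF l0 l1] by simp
  qed (use X tH uH in \<open>auto intro!: always_eventually H.nrm_nonneg H.nrm_triangle_diff\<close>)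
  then show ?thesis using uH by blast
qed

sublocale HC: semi_hilbert HC "energy \<omega>"
proof
  show "subspace HC"
    unfolding HC_def subspace_def
    by (auto simp: plus_fun_def scaleR_fun_def zero_fun_def intro!: continuous_intros)
      (use H.mem_simps in \<open>auto simp: plus_fun_def scaleR_fun_def zero_fun_def\<close>)
next
  fix X :: "nat \<Rightarrow> real \<times> real \<Rightarrow> complex"
  assume X: "\<And>n. X n \<in> HC"
    and Cau: "\<And>e. e > 0 \<Longrightarrow> \<exists>k. \<forall>m\<ge>k. \<forall>n\<ge>k. H.nrm (X m - X n) < e"
  have XH: "X n \<in> H12" for n using X unfolding HC_def by blast
  obtain u where u: "u \<in> H12" "(\<lambda>n. H.nrm (X n - u)) \<longlonglongrightarrow> 0"
    using H12_complete[OF XH Cau] by blast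
  obtain v where v: "v \<in> HC" "H.nrm (u - v) = 0"
    using continuous_representative[OF u(1)] by blast
  have vH: "v \<in> H12" using v unfolding HC_def by blast
  have "(\<lambda>n. H.nrm (X n - v)) \<longlonglongrightarrow> 0"
  proof (rule tendsto_sandwich[OF _ _ tendsto_const u(2)])
    show "\<forall>\<^sub>F n in sequentially. H.nrm (X n - v) \<le> H.nrm (X n - u)"
      using H.nrm_triangle_diff[OF XH u(1) vH] v(2) by simp
  qed (use XH vH in \<open>auto intro!: always_eventually H.nrm_nonneg\<close>)
  then show "\<exists>u\<in>HC. (\<lambda>n. H.nrm (X n - u)) \<longlonglongrightarrow> 0"
    using v(1) by blast
qed (auto simp: HC_def H.add_left H.scale_left H.nonneg intro: H.sym)

end

section \<open>A nonzero test function\<close>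

text \<open>
  The functions \<open>P(1/t) exp(-1/t)\<close>, extended by zero to \<open>t \<le> 0\<close>, form a class that contains the standard flat
  function and its derivatives of all orders.
\<close>

definition flat :: "real poly \<Rightarrow> real \<Rightarrow> real" where
  "flat P t = (if t > 0 then poly P (1 / t) * exp (- (1 / t)) else 0)"

lemma poly_mult_exp_minus_tendsto_0: "((\<lambda>s::real. poly P s * exp (- s)) \<longlongrightarrow> 0) at_top"
proof -
  have "((\<lambda>s. \<Sum>i\<le>degree P. coeff P i * (s ^ i / exp s)) \<longlongrightarrow> (\<Sum>i\<le>degree P. coeff P i * 0)) at_top"
    by (intro tendsto_intros tendsto_power_div_exp_0)
  then show ?thesis
    by (simp add: poly_altdef sum_distrib_right exp_minus divide_inverse mult.assoc)
qed

lemma flat_deriv: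
  "(flat P has_field_derivative flat ([:0, 0, 1:] * (P - pderiv P)) t) (at t)"
proof -
  consider "t < 0" | "t > 0" | "t = 0" by linarith
  then show ?thesis
  proof cases
    case 1
    have "((\<lambda>t. 0) has_field_derivative 0) (at t)" by simp
    then have "(flat P has_field_derivative 0) (at t)"
      by (rule DERIV_cong_ev[THEN iffD1, rotated -1, OF _ refl _ refl])
        (use 1 in \<open>auto simp: flat_def eventually_at_filter intro: eventually_mono[OF eventually_nhds_in_open[of "{..<0}"]]\<close>)
    then show ?thesis using 1 by (simp add: flat_def)
  next
    case 2
    then have "((\<lambda>t. poly P (1 / t) * exp (- (1 / t))) has_field_derivative
        flat ([:0, 0, 1:] * (P - pderiv P)) t) (at t)"
      by (auto intro!: derivative_eq_intros DERIV_chain2[OF poly_DERIV] simp: flat_def field_simps power2_eq_square)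
    then show ?thesis
      by (rule DERIV_cong_ev[THEN iffD1, rotated -1, OF _ refl _ refl])
        (use 2 in \<open>auto simp: flat_def intro: eventually_mono[OF eventually_nhds_in_open[of "{0<..}"]]\<close>)
  next
    case 3
    have right: "((\<lambda>h. flat P h / h) \<longlongrightarrow> 0) (at_right 0)"
    proof -
      have "((\<lambda>h. poly (pCons 0 P) (inverse h) * exp (- inverse h)) \<longlongrightarrow> 0) (at_right (0::real))"
        by (rule filterlim_compose[OF poly_mult_exp_minus_tendsto_0 filterlim_inverse_at_top_right])
      then show ?thesis
        by (rule Lim_transform_eventually)
          (auto simp: eventually_at_filter flat_def field_simps)
    qed
    have left: "((\<lambda>h. flat P h / h) \<longlongrightarrow> 0) (at_left 0)"
      by (rule Lim_transform_eventually[OF tendsto_const]) (auto simp: eventually_at_filter flat_def)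
    have "((\<lambda>h. flat P h / h) \<longlongrightarrow> 0) (at 0)"
      using left right by (simp add: filterlim_at_split)
    then show ?thesis
      using 3 by (simp add: DERIV_def flat_def)
  qed
qed

text \<open>
  Smoothness to all orders follows from a class of differentiable functions that contains its own
  partial derivatives. This one contains bump functions with bounded support.
\<close>

inductive_set flat_algebra :: "(real \<times> real \<Rightarrow> real) set" where
  flat: "(\<lambda>(x, y). flat P (a * x + b * y + c)) \<in> flat_algebra"
| const: "(\<lambda>z. c) \<in> flat_algebra"
| add: "f \<in> flat_algebra \<Longrightarrow> g \<in> flat_algebra \<Longrightarrow> (\<lambda>z. f z + g z) \<in> flat_algebra"
| mult: "f \<in> flat_algebra \<Longrightarrow> g \<in> flat_algebra \<Longrightarrow> (\<lambda>z. f z * g z) \<in> flat_algebra"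

lemma flat_algebra_derivative:
  assumes "f \<in> flat_algebra"
  shows "\<exists>f1\<in>flat_algebra. \<exists>f2\<in>flat_algebra.
    \<forall>z. (f has_derivative (\<lambda>(h, k). h * f1 z + k * f2 z)) (at z)"
  using assms
proof induction
  case (flat P a b c)
  let ?Q = "[:0, 0, 1:] * (P - pderiv P)"
  let ?d = "\<lambda>(x, y). flat ?Q (a * x + b * y + c)"
  have "((\<lambda>(x, y). flat P (a * x + b * y + c)) has_derivative (\<lambda>(h, k). h * (a * ?d z) + k * (b * ?d z))) (at z)" for z
  proof -
    have "((\<lambda>z. flat P (a * fst z + b * snd z + c)) has_derivative
        (\<lambda>w. (a * fst w + b * snd w) * flat ?Q (a * fst z + b * snd z + c))) (at z)"
      by (rule has_derivative_eq_rhs[OF DERIV_compose_FDERIV[OF flat_deriv]])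
        (auto intro!: derivative_eq_intros simp: fun_eq_iff)
    then show ?thesis
      by (simp add: case_prod_beta' algebra_simps)
  qed
  moreover have "(\<lambda>z. e * ?d z) \<in> flat_algebra" for e
    by (intro flat_algebra.intros)
  ultimately show ?case by (intro bexI[of _ "\<lambda>z. a * ?d z"] bexI[of _ "\<lambda>z. b * ?d z"]) auto
next
  case (const c)
  have "((\<lambda>z. c) has_derivative (\<lambda>(h, k). h * 0 + k * 0)) (at z)" for z :: "real \<times> real"
    by (simp add: case_prod_beta')
  then show ?case
    using flat_algebra.const[of 0] by (intro bexI[of _ "\<lambda>z. 0"]) auto
next
  case (add f g)
  then obtain f1 f2 g1 g2 where *: "f1 \<in> flat_algebra" "f2 \<in> flat_algebra" "g1 \<in> flat_algebra" "g2 \<in> flat_algebra"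
    and d: "\<And>z. (f has_derivative (\<lambda>(h, k). h * f1 z + k * f2 z)) (at z)"
      "\<And>z. (g has_derivative (\<lambda>(h, k). h * g1 z + k * g2 z)) (at z)"
    by blast
  have "((\<lambda>z. f z + g z) has_derivative (\<lambda>(h, k). h * (f1 z + g1 z) + k * (f2 z + g2 z))) (at z)" for z
    by (rule has_derivative_eq_rhs[OF has_derivative_add[OF d]]) (auto simp: fun_eq_iff algebra_simps)
  then show ?case
    using * by (intro bexI[of _ "\<lambda>z. f1 z + g1 z"] bexI[of _ "\<lambda>z. f2 z + g2 z"]) (auto intro: flat_algebra.intros)
next
  case (mult f g)
  then obtain f1 f2 g1 g2 where *: "f1 \<in> flat_algebra" "f2 \<in> flat_algebra" "g1 \<in> flat_algebra" "g2 \<in> flat_algebra"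
    and d: "\<And>z. (f has_derivative (\<lambda>(h, k). h * f1 z + k * f2 z)) (at z)"
      "\<And>z. (g has_derivative (\<lambda>(h, k). h * g1 z + k * g2 z)) (at z)"
    by blast
  have "((\<lambda>z. f z * g z) has_derivative (\<lambda>(h, k). h * (f z * g1 z + f1 z * g z) + k * (f z * g2 z + f2 z * g z))) (at z)" for z
    by (rule has_derivative_eq_rhs[OF has_derivative_mult[OF d]]) (auto simp: fun_eq_iff algebra_simps)
  then show ?case
    using * mult.hyps by (intro bexI[of _ "\<lambda>z. f z * g1 z + f1 z * g z"] bexI[of _ "\<lambda>z. f z * g2 z + f2 z * g z"])
      (auto intro: flat_algebra.intros)
qed

lemma flat_algebra_C_k:
  "f \<in> flat_algebra \<Longrightarrow> C_k k (\<lambda>z. complex_of_real (f z))"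
proof (induction k arbitrary: f)
  case 0
  then obtain f1 f2 where "\<And>z. (f has_derivative (\<lambda>(h, k). h * f1 z + k * f2 z)) (at z)"
    using flat_algebra_derivative by blast
  then have "continuous_on UNIV f"
    by (intro has_derivative_continuous_on) (auto intro: has_derivative_at_withinI)
  then show ?case by (auto intro: continuous_intros)
next
  case (Suc k)
  then obtain f1 f2 where *: "f1 \<in> flat_algebra" "f2 \<in> flat_algebra"
    and d: "\<And>z. (f has_derivative (\<lambda>(h, k). h * f1 z + k * f2 z)) (at z)"
    using flat_algebra_derivative by blast
  have d': "((\<lambda>z. complex_of_real (f z)) has_derivative (\<lambda>w. complex_of_real (fst w * f1 z + snd w * f2 z))) (at z)" for z
    using has_derivative_of_real[OF d[of z]] by (simp add: case_prod_beta')
  have diff: "(\<lambda>z. complex_of_real (f z)) differentiable_on UNIV"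
    using d' unfolding differentiable_on_def differentiable_def by blast
  have px: "partial_x (\<lambda>z. complex_of_real (f z)) = (\<lambda>z. complex_of_real (f1 z))"
  proof
    fix z :: "real \<times> real"
    obtain x y where z: "z = (x, y)" by (cases z)
    have "((\<lambda>t. complex_of_real (f (t, y))) has_derivative (\<lambda>h. complex_of_real (h * f1 (x, y)))) (at x)"
      by (rule has_derivative_eq_rhs[OF has_derivative_compose[OF _ d', of "\<lambda>t. (t, y)" "\<lambda>h. (h, 0)"]])
        (auto intro!: derivative_eq_intros simp: fun_eq_iff)
    then have "((\<lambda>t. complex_of_real (f (t, y))) has_vector_derivative complex_of_real (f1 (x, y))) (at x)"
      by (simp add: has_vector_derivative_def scaleR_conv_of_real)
    then show "partial_x (\<lambda>z. complex_of_real (f z)) z = complex_of_real (f1 z)"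
      unfolding z by (rule partial_x_eqI)
  qed
  have py: "partial_y (\<lambda>z. complex_of_real (f z)) = (\<lambda>z. complex_of_real (f2 z))"
  proof
    fix z :: "real \<times> real"
    obtain x y where z: "z = (x, y)" by (cases z)
    have "((\<lambda>t. complex_of_real (f (x, t))) has_derivative (\<lambda>h. complex_of_real (h * f2 (x, y)))) (at y)"
      by (rule has_derivative_eq_rhs[OF has_derivative_compose[OF _ d', of "\<lambda>t. (x, t)" "\<lambda>h. (0, h)"]])
        (auto intro!: derivative_eq_intros simp: fun_eq_iff)
    then have "((\<lambda>t. complex_of_real (f (x, t))) has_vector_derivative complex_of_real (f2 (x, y))) (at y)"
      by (simp add: has_vector_derivative_def scaleR_conv_of_real)
    then show "partial_y (\<lambda>z. complex_of_real (f z)) z = complex_of_real (f2 z)"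
      unfolding z by (rule partial_y_eqI)
  qed
  show ?case
    using Suc.IH * diff by (simp add: px py)
qed

lemma nonzero_test_function_exists: "\<exists>f. test_function f \<and> f 0 \<noteq> 0"
proof -
  \<comment> \<open>Each \<open>b a c\<close> is positive on a half plane; the four half planes meet in the square \<open>(-1, 1)\<^sup>2\<close>.\<close>
  define b where "b = (\<lambda>a c. \<lambda>(x::real, y::real). flat 1 (a * x + c * y + 1))"
  define f where "f = (\<lambda>z. b 1 0 z * b (-1) 0 z * (b 0 1 z * b 0 (-1) z))"
  have "f \<in> flat_algebra"
    unfolding f_def b_def by (intro flat_algebra.intros)
  then have "C_k k (\<lambda>z. complex_of_real (f z))" for k
    by (rule flat_algebra_C_k)
  moreover have "f z = 0" if z: "2 \<le> norm z" for z
  proof -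
    obtain x y where xy: "z = (x, y)" by (cases z)
    have "norm z \<le> \<bar>x\<bar> + \<bar>y\<bar>"
      using norm_Pair_le[of x y] by (simp add: xy)
    then have "1 \<le> \<bar>x\<bar> \<or> 1 \<le> \<bar>y\<bar>" using z by linarith
    then show ?thesis
      unfolding f_def b_def xy by (auto simp: flat_def abs_le_iff)
  qed
  moreover have "f 0 \<noteq> 0"
    by (simp add: f_def b_def flat_def zero_prod_def)
  ultimately have "test_function (\<lambda>z. complex_of_real (f z))" "complex_of_real (f 0) \<noteq> 0"
    unfolding test_function_iff by auto
  then show ?thesis by blast
qed

section \<open>The nonlinearity\<close>

lemma zero_if_linear_le_quadratic:
  fixes a b :: real
  assumes "\<And>t. t * a \<le> t\<^sup>2 * b"
  shows "a = 0"
proof (rule ccontr)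
  assume a: "a \<noteq> 0"
  define t where "t = a / (\<bar>b\<bar> + 1)"
  have "t * a = a\<^sup>2 / (\<bar>b\<bar> + 1)" by (simp add: t_def power2_eq_square)
  moreover have "t\<^sup>2 * b = (a\<^sup>2 / (\<bar>b\<bar> + 1)) * (b / (\<bar>b\<bar> + 1))"
    by (simp add: t_def power2_eq_square)
  moreover have "a\<^sup>2 / (\<bar>b\<bar> + 1) > 0" using a by (simp add: add_nonneg_pos)
  moreover have "b / (\<bar>b\<bar> + 1) < 1"
  proof -
    have "b < \<bar>b\<bar> + 1" by linarith
    then show ?thesis by (simp add: add_nonneg_pos)
  qed
  ultimately show False
    using assms[of t] mult_strict_left_mono[of "b / (\<bar>b\<bar> + 1)" 1 "a\<^sup>2 / (\<bar>b\<bar> + 1)"] by linarith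
qed

text \<open>
  Young's inequality: the power function lies above its tangent at \<open>A\<close>.
\<close>

lemma powr_tangent_le:
  fixes A B q :: real
  assumes q: "q > 1" and "A \<ge> 0" "B \<ge> 0"
  shows "q * (A powr (q - 1) * B) \<le> (q - 1) * A powr q + B powr q"
proof -
  define q' where "q' = q / (q - 1)"
  have q': "q' > 1" "1 / q' + 1 / q = 1"
    using q by (auto simp: q'_def field_simps)
  have "A powr (q - 1) * B \<le> (A powr (q - 1)) powr q' / q' + B powr q / q"
    using Youngs_inequality[of q' q "A powr (q - 1)" B] q q' assms by simp
  also have "(A powr (q - 1)) powr q' = A powr q"
    using q by (simp add: powr_powr q'_def)
  finally have "q * (A powr (q - 1) * B) \<le> q * (A powr q / q' + B powr q / q)"
    using q by (intro mult_left_mono) auto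
  also have "\<dots> = (q - 1) * A powr q + B powr q"
    using q by (simp add: q'_def field_simps)
  finally show ?thesis .
qed

locale nonlinear_equation = positive_frequency +
  fixes p :: real
  assumes p: "p > 2"
begin

definition nonlin :: "complex \<Rightarrow> complex" where
  "nonlin a = cmod a powr (p - 2) *\<^sub>R a"

lemma norm_nonlin: "cmod (nonlin a) = cmod a powr (p - 1)"
proof (cases "a = 0")
  case False
  then have "cmod a powr (p - 2) * cmod a = cmod a powr (p - 2 + 1)"
    by (subst powr_add) simp
  then show ?thesis by (simp add: nonlin_def algebra_simps)
qed (use p in \<open>simp add: nonlin_def\<close>)

lemma nonlin_inner_self: "nonlin a \<bullet> a = cmod a powr p"
proof (cases "a = 0")
  case False
  then have "cmod a powr (p - 2) * (cmod a)\<^sup>2 = cmod a powr (p - 2) * cmod a powr 2"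
    by simp
  also have "\<dots> = cmod a powr p"
    by (subst powr_add[symmetric]) simp
  finally show ?thesis
    by (simp add: nonlin_def power2_norm_eq_inner)
qed (use p in \<open>simp add: nonlin_def\<close>)

lemma nonlin_inner_le: "p * (nonlin a \<bullet> b) \<le> (p - 1) * cmod a powr p + cmod b powr p"
proof -
  have "nonlin a \<bullet> b \<le> cmod (nonlin a) * cmod b"
    by (rule norm_cauchy_schwarz)
  also have "\<dots> = cmod a powr (p - 1) * cmod b"
    by (simp add: norm_nonlin)
  finally have "p * (nonlin a \<bullet> b) \<le> p * (cmod a powr (p - 1) * cmod b)"
    using p by (intro mult_left_mono) auto
  also have "\<dots> \<le> (p - 1) * cmod a powr p + cmod b powr p"
    using powr_tangent_le[of p "cmod a" "cmod b"] p by simp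
  finally show ?thesis .
qed

text \<open>
  For \<open>|b| \<le> |a|\<close> the increment splits into \<open>|a|\<^sup>p\<^sup>-\<^sup>2 (a - b)\<close> and \<open>(|a|\<^sup>p\<^sup>-\<^sup>2 - |b|\<^sup>p\<^sup>-\<^sup>2) b\<close>. The second part is at
  most \<open>|a|\<^sup>p\<^sup>-\<^sup>1 - |b|\<^sup>p\<^sup>-\<^sup>1\<close>, which the tangent inequality with exponent \<open>p - 1\<close> bounds.
\<close>

lemma nonlin_Lipschitz:
  assumes "cmod a \<le> M" "cmod b \<le> M"
  shows "cmod (nonlin a - nonlin b) \<le> p * M powr (p - 2) * cmod (a - b)"
proof -
  have *: "cmod (nonlin a - nonlin b) \<le> p * M powr (p - 2) * cmod (a - b)"
    if le: "cmod a \<le> M" "cmod b \<le> cmod a" for a b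
  proof -
  let ?A = "cmod a" and ?B = "cmod b"
  define s where "s = ?A powr (p - 2)"
  have s: "s \<ge> 0" by (simp add: s_def)
  have AB: "?B \<le> ?A" using le by simp
  have monoB: "?B powr (p - 2) \<le> s"
    unfolding s_def using AB p by (intro powr_mono2) auto
  have key: "?B * (s - ?B powr (p - 2)) \<le> (p - 1) * s * (?A - ?B)"
  proof -
    have sA: "?A powr (p - 1) = s * ?A" and sB: "?B powr (p - 1) = ?B powr (p - 2) * ?B"
      using norm_nonlin[of a] norm_nonlin[of b] by (simp_all add: nonlin_def s_def)
    have "(p - 1) * (s * ?B) \<le> (p - 2) * (s * ?A) + ?B powr (p - 2) * ?B"
      using powr_tangent_le[of "p - 1" ?A ?B] p by (simp add: s_def sA[unfolded s_def] sB)
    moreover have "s * ?B \<le> s * ?A"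
      using s AB by (intro mult_left_mono) auto
    ultimately show ?thesis by (simp add: algebra_simps)
  qed
  have "nonlin a - nonlin b = s *\<^sub>R (a - b) + (s - ?B powr (p - 2)) *\<^sub>R b"
    by (simp add: nonlin_def s_def algebra_simps)
  also have "cmod \<dots> \<le> s * cmod (a - b) + (s - ?B powr (p - 2)) * ?B"
    using s monoB by (intro norm_triangle_le) simp
  also have "\<dots> \<le> s * cmod (a - b) + (p - 1) * s * (?A - ?B)"
    using key by (simp add: mult.commute)
  also have "\<dots> \<le> s * cmod (a - b) + (p - 1) * s * cmod (a - b)"
    using norm_triangle_ineq2[of a b] p s by (intro add_left_mono mult_left_mono) auto
  also have "\<dots> = p * s * cmod (a - b)"
    by (simp add: algebra_simps)
  also have "\<dots> \<le> p * M powr (p - 2) * cmod (a - b)"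
    unfolding s_def using p le by (intro mult_right_mono mult_left_mono powr_mono2) auto
  finally show ?thesis .
  qed
  show ?thesis
  proof (cases "cmod b \<le> cmod a")
    case True
    then show ?thesis using * assms by blast
  next
    case False
    then show ?thesis using *[of b a] assms by (simp add: norm_minus_commute)
  qed
qed

lemma continuous_nonlin: "continuous_on UNIV nonlin"
  unfolding continuous_on_iff
proof (intro ballI allI impI)
  fix a :: complex and e :: real assume e: "e > 0"
  define C where "C = p * (cmod a + 1) powr (p - 2)"
  have C: "C > 0"
  proof -
    have "cmod a + 1 > 0" using norm_ge_zero[of a] by linarith
    then show ?thesis using p by (simp add: C_def)
  qed
  have "dist (nonlin b) (nonlin a) < e" if "dist b a < min 1 (e / C)" for b
  proof -
    have "cmod b \<le> cmod a + 1"
      using norm_triangle_sub[of b a] that by (simp add: dist_norm)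
    then have "cmod (nonlin b - nonlin a) \<le> C * cmod (b - a)"
      unfolding C_def by (intro nonlin_Lipschitz) auto
    also have "\<dots> < e"
      using that C by (simp add: dist_norm field_simps)
    finally show ?thesis by (simp add: dist_norm)
  qed
  then show "\<exists>d>0. \<forall>b\<in>UNIV. dist b a < d \<longrightarrow> dist (nonlin b) (nonlin a) < e"
    using e C by (intro exI[of _ "min 1 (e / C)"]) auto
qed

lemma nonlin_measurable [measurable]: "nonlin \<in> borel_measurable borel"
  by (rule borel_measurable_continuous_onI[OF continuous_nonlin])

definition Lp_power :: "(real \<times> real \<Rightarrow> complex) \<Rightarrow> real" where
  "Lp_power u = (LINT z|lborel. cmod (u z) powr p)"

definition pairing :: "(real \<times> real \<Rightarrow> complex) \<Rightarrow> (real \<times> real \<Rightarrow> complex) \<Rightarrow> real" where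
  "pairing u v = (LINT z|lborel. nonlin (u z) \<bullet> v z)"

lemma J_eq: "J \<omega> p u = energy \<omega> u u / 2 - Lp_power u / p"
  by (simp add: J_def energy_def L2_inner_self Lp_power_def field_simps)

lemma norm_nonlin_le:
  assumes "cmod a \<le> M"
  shows "cmod (nonlin a) \<le> M powr (p - 2) * cmod a"
  using assms p unfolding nonlin_def by (auto intro!: mult_right_mono powr_mono2)

lemma bounded_nonlin_square_integrable:
  assumes u: "square_integrable u" and M: "AE z in lborel. cmod (u z) \<le> M"
  shows "square_integrable (\<lambda>z. nonlin (u z))"
proof -
  have um [measurable]: "u \<in> borel_measurable borel"
    using u by (simp add: square_integrable_def)
  have int: "integrable lborel (\<lambda>z. (M powr (p - 2) * cmod (u z))\<^sup>2)"
    using u by (simp add: square_integrable_def power_mult_distrib)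
  have le: "AE z in lborel. (cmod (nonlin (u z)))\<^sup>2 \<le> (M powr (p - 2) * cmod (u z))\<^sup>2"
    using M by eventually_elim (intro power_mono norm_nonlin_le, auto)
  have "integrable lborel (\<lambda>z. (cmod (nonlin (u z)))\<^sup>2)"
    by (rule Bochner_Integration.integrable_bound[OF int]) (use le in auto)
  then show "square_integrable (\<lambda>z. nonlin (u z))"
    by (simp add: square_integrable_def)
qed

lemma bounded_Lp_power:
  assumes u: "square_integrable u" and M: "AE z in lborel. cmod (u z) \<le> M"
  shows "integrable lborel (\<lambda>z. cmod (u z) powr p)" "Lp_power u \<le> M powr (p - 2) * L2_inner u u"
proof -
  have um [measurable]: "u \<in> borel_measurable borel"
    using u by (simp add: square_integrable_def)
  have int: "integrable lborel (\<lambda>z. M powr (p - 2) * (cmod (u z))\<^sup>2)"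
    using u by (simp add: square_integrable_def)
  have le: "AE z in lborel. cmod (u z) powr p \<le> M powr (p - 2) * (cmod (u z))\<^sup>2"
    using M
  proof eventually_elim
    case (elim z)
    have "cmod (u z) powr p = nonlin (u z) \<bullet> u z"
      by (simp add: nonlin_inner_self)
    also have "\<dots> = cmod (u z) powr (p - 2) * (cmod (u z))\<^sup>2"
      by (simp add: nonlin_def power2_norm_eq_inner)
    also have "\<dots> \<le> M powr (p - 2) * (cmod (u z))\<^sup>2"
      using elim p by (intro mult_right_mono powr_mono2) auto
    finally show ?case .
  qed
  show int': "integrable lborel (\<lambda>z. cmod (u z) powr p)"
    by (rule Bochner_Integration.integrable_bound[OF int]) (use le in auto)
  show "Lp_power u \<le> M powr (p - 2) * L2_inner u u"
    using integral_mono_AE[OF int' int le] by (simp add: Lp_power_def L2_inner_self)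
qed

lemma H12_Lp_integrable: "u \<in> H12 \<Longrightarrow> integrable lborel (\<lambda>z. cmod (u z) powr p)"
  using bounded_Lp_power(1)[OF H12_square_integrable H12_sup_bound_AE] .

lemma H12_nonlin_square_integrable: "u \<in> H12 \<Longrightarrow> square_integrable (\<lambda>z. nonlin (u z))"
  using bounded_nonlin_square_integrable[OF H12_square_integrable H12_sup_bound_AE] .

lemma pairing_eq_L2_inner: "pairing u v = L2_inner (\<lambda>z. nonlin (u z)) v"
  by (simp add: pairing_def L2_inner_def)

lemma pairing_linear:
  assumes "u \<in> H12" "v \<in> H12" "w \<in> H12"
  shows "pairing u (v + w) = pairing u v + pairing u w" "pairing u (v - w) = pairing u v - pairing u w"
    "pairing u (r *\<^sub>R v) = r * pairing u v"
  using assms unfolding pairing_eq_L2_inner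
  by (simp_all add: L2.bilinear H12_nonlin_square_integrable H12_square_integrable)

lemma pairing_self: "pairing u u = Lp_power u"
  by (simp add: pairing_def Lp_power_def nonlin_inner_self)

lemma pairing_le:
  assumes u: "u \<in> H12" and v: "v \<in> H12"
  shows "p * pairing u v \<le> (p - 1) * Lp_power u + Lp_power v"
proof -
  have "p * pairing u v = (LINT z|lborel. p * (nonlin (u z) \<bullet> v z))"
    by (simp add: pairing_def)
  also have "\<dots> \<le> (LINT z|lborel. (p - 1) * cmod (u z) powr p + cmod (v z) powr p)"
    using integrable_inner[OF H12_nonlin_square_integrable[OF u] H12_square_integrable[OF v]]
      H12_Lp_integrable[OF u] H12_Lp_integrable[OF v]
    by (intro integral_mono) (auto intro!: nonlin_inner_le)
  also have "\<dots> = (p - 1) * Lp_power u + Lp_power v"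
    using H12_Lp_integrable[OF u] H12_Lp_integrable[OF v] by (simp add: Lp_power_def)
  finally show ?thesis .
qed

lemma Lp_power_convex:
  assumes u: "u \<in> H12" and v: "v \<in> H12"
  shows "Lp_power u + p * pairing u v \<le> Lp_power (u + v)"
  using pairing_le[OF u H.mem_simps(2)[OF u v]] pairing_linear(1)[OF u u v]
  by (simp add: pairing_self algebra_simps)

lemma Lp_power_scale: "Lp_power (r *\<^sub>R u) = \<bar>r\<bar> powr p * Lp_power u"
  by (simp add: Lp_power_def scaleR_fun_def powr_mult)

lemma pairing_scale_left:
  assumes "r \<ge> 0"
  shows "pairing (r *\<^sub>R u) v = r powr (p - 1) * pairing u v"
proof -
  have "nonlin (r *\<^sub>R a) = r powr (p - 1) *\<^sub>R nonlin a" for a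
  proof (cases "r = 0")
    case False
    have "r powr (p - 2) * r = r powr (p - 2 + 1)"
      using False assms by (subst powr_add) simp
    then show ?thesis
      using assms by (simp add: nonlin_def powr_mult algebra_simps)
  qed (use p in \<open>simp add: nonlin_def\<close>)
  then show ?thesis
    by (simp add: pairing_def scaleR_fun_def)
qed

lemma pairing_tendsto:
  assumes u: "u \<in> H12" and X: "\<And>n. X n \<in> H12" and v: "v \<in> H12" and l: "(\<lambda>n. H.nrm (X n - v)) \<longlonglongrightarrow> 0"
  shows "(\<lambda>n. pairing u (X n)) \<longlonglongrightarrow> pairing u v"
proof -
  have "(\<lambda>n. L2.nrm (X n - v)) \<longlonglongrightarrow> 0"
  proof (rule tendsto_sandwich[OF _ _ tendsto_const])
    show "(\<lambda>n. H.nrm (X n - v) / sqrt \<omega>) \<longlonglongrightarrow> 0"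
      using tendsto_divide[OF l tendsto_const, of "sqrt \<omega>"] \<omega> by simp
    show "\<forall>\<^sub>F n in sequentially. L2.nrm (X n - v) \<le> H.nrm (X n - v) / sqrt \<omega>"
      using energy_parts_le(3)[OF H12_limit_derivatives[OF H.mem_simps(3)[OF X v]]] by simp
  qed (use X v in \<open>auto intro!: always_eventually L2.nrm_nonneg simp: H12_square_integrable\<close>)
  then show ?thesis
    unfolding pairing_eq_L2_inner
    by (intro L2.tendsto_B) (use u X v in \<open>auto simp: H12_square_integrable H12_nonlin_square_integrable\<close>)
qed

text \<open>
  Convexity at \<open>u\<close> makes the difference nonnegative. Convexity at \<open>u + v\<close> bounds it by the increment of
  the derivative, \<open>p\<close> times the pairing of \<open>f(u + v) - f(u)\<close> with \<open>v\<close>, which is quadratic by the Lipschitz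
  bound.
\<close>

lemma Lp_power_second_order:
  assumes u: "u \<in> H12" and v: "v \<in> H12" and M: "sup_const * (H.nrm u + H.nrm v) \<le> M"
  shows "\<bar>Lp_power (u + v) - Lp_power u - p * pairing u v\<bar> \<le> p\<^sup>2 * M powr (p - 2) * L2_inner v v"
proof -
  have uv: "u + v \<in> H12" using u v by auto
  have "Lp_power (u + v) + p * pairing (u + v) (- v) \<le> Lp_power u"
    using Lp_power_convex[OF uv, of "- v"] v by simp
  moreover have "pairing (u + v) (- v) = - pairing (u + v) v"
    using pairing_linear(3)[OF uv v v, of "-1"] by simp
  ultimately have up: "Lp_power (u + v) - Lp_power u - p * pairing u v \<le> p * (pairing (u + v) v - pairing u v)"
    by (simp add: algebra_simps)
  have low: "0 \<le> Lp_power (u + v) - Lp_power u - p * pairing u v"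
    using Lp_power_convex[OF u v] by simp
  have i: "integrable lborel (\<lambda>z. nonlin ((u + v) z) \<bullet> v z)" "integrable lborel (\<lambda>z. nonlin (u z) \<bullet> v z)"
    using integrable_inner[OF H12_nonlin_square_integrable[OF uv] H12_square_integrable[OF v]]
      integrable_inner[OF H12_nonlin_square_integrable[OF u] H12_square_integrable[OF v]] by auto
  have iv: "integrable lborel (\<lambda>z. p * M powr (p - 2) * (cmod (v z))\<^sup>2)"
    using H12_square_integrable[OF v] by (simp add: square_integrable_def)
  have "pairing (u + v) v - pairing u v = (LINT z|lborel. nonlin ((u + v) z) \<bullet> v z - nonlin (u z) \<bullet> v z)"
    using i by (simp add: pairing_def)
  also have "\<dots> \<le> (LINT z|lborel. p * M powr (p - 2) * (cmod (v z))\<^sup>2)"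
  proof (rule integral_mono_AE)
    show "AE z in lborel. nonlin ((u + v) z) \<bullet> v z - nonlin (u z) \<bullet> v z \<le> p * M powr (p - 2) * (cmod (v z))\<^sup>2"
      using H12_sup_bound_AE[OF u] H12_sup_bound_AE[OF v]
    proof eventually_elim
      case (elim z)
      have bu: "cmod (u z) \<le> M" "cmod (u z + v z) \<le> M"
      proof -
        have "sup_const * H.nrm v \<ge> 0"
          using sup_const_pos H.nrm_nonneg[OF v] by simp
        then show "cmod (u z) \<le> M" "cmod (u z + v z) \<le> M"
          using elim M norm_triangle_ineq[of "u z" "v z"] by (auto simp: algebra_simps)
      qed
      have "nonlin ((u + v) z) \<bullet> v z - nonlin (u z) \<bullet> v z = (nonlin (u z + v z) - nonlin (u z)) \<bullet> v z"
        by (simp add: inner_diff_left)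
      also have "\<dots> \<le> cmod (nonlin (u z + v z) - nonlin (u z)) * cmod (v z)"
        by (rule norm_cauchy_schwarz)
      also have "\<dots> \<le> p * M powr (p - 2) * cmod (u z + v z - u z) * cmod (v z)"
        by (intro mult_right_mono nonlin_Lipschitz bu) auto
      also have "\<dots> = p * M powr (p - 2) * (cmod (v z))\<^sup>2"
        by (simp add: power2_eq_square)
      finally show ?case .
    qed
  qed (use i iv in auto)
  also have "\<dots> = p * M powr (p - 2) * L2_inner v v"
    by (simp add: L2_inner_self)
  finally have "p * (pairing (u + v) v - pairing u v) \<le> p * (p * M powr (p - 2) * L2_inner v v)"
    using p by (intro mult_left_mono) auto
  then show ?thesis
    using up low by (simp add: power2_eq_square mult.assoc)
qed

end

section \<open>The best constant and its extremals\<close>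

context positive_frequency
begin

lemma Re_Im_eval_bounded_functional:
  "HC.bounded_functional (\<lambda>u. Re (u z))" "HC.bounded_functional (\<lambda>u. Im (u z))"
proof -
  have "\<bar>Re (u z)\<bar> \<le> sup_const * H.nrm u" "\<bar>Im (u z)\<bar> \<le> sup_const * H.nrm u" if "u \<in> HC" for u
    using HC_sup_bound[OF that, of z] abs_Re_le_cmod[of "u z"] abs_Im_le_cmod[of "u z"] by linarith+
  then show "HC.bounded_functional (\<lambda>u. Re (u z))" "HC.bounded_functional (\<lambda>u. Im (u z))"
    unfolding HC.bounded_functional_def by (auto simp: scaleR_fun_def)
qed

text \<open>
  The real and imaginary parts of point evaluations are bounded functionals, so that weak
  convergence is pointwise.
\<close>

lemma HC_weak_compactness:
  assumes X: "\<And>n. X n \<in> HC" and bdd: "\<And>n. energy \<omega> (X n) (X n) \<le> C"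
  obtains r :: "nat \<Rightarrow> nat" and u where "strict_mono r" "u \<in> HC"
    "\<And>z. (\<lambda>n. X (r n) z) \<longlonglongrightarrow> u z"
    "\<And>v. v \<in> HC \<Longrightarrow> (\<lambda>n. energy \<omega> (X (r n)) v) \<longlonglongrightarrow> energy \<omega> u v"
proof -
  obtain r :: "nat \<Rightarrow> nat" and u where r: "strict_mono r" and u: "u \<in> HC"
    and L: "\<And>L. HC.bounded_functional L \<Longrightarrow> (\<lambda>n. L (X (r n))) \<longlonglongrightarrow> L u"
    using HC.weak_compactness[of X C, OF X bdd] by blast
  have "(\<lambda>n. X (r n) z) \<longlonglongrightarrow> u z" for z
    using tendsto_Complex[OF L[OF Re_Im_eval_bounded_functional(1)[of z]] L[OF Re_Im_eval_bounded_functional(2)[of z]]]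
    by simp
  moreover have "(\<lambda>n. energy \<omega> (X (r n)) v) \<longlonglongrightarrow> energy \<omega> u v" if v: "v \<in> HC" for v
    using L[OF HC.bounded_functional_B[OF v]] HC.sym[OF v X] HC.sym[OF v u] by simp
  ultimately show ?thesis using that r u by blast
qed

lemma energy_translate:
  assumes f: "test_function f"
  shows "energy \<omega> (\<lambda>z. f (z + a)) (\<lambda>z. f (z + a)) = energy \<omega> f f"
proof -
  have tr: "L2_inner (\<lambda>z. g (z + a)) (\<lambda>z. g (z + a)) = L2_inner g g" if "square_integrable g" for g
  proof -
    have "(LINT z|lborel. g z \<bullet> g z) = (LINT z|distr lborel borel ((+) a). g z \<bullet> g z)"
      by (simp add: lborel_distr_plus)
    also have "\<dots> = (LINT z|lborel. g (a + z) \<bullet> g (a + z))"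
      using that by (intro integral_distr) (auto simp: square_integrable_def)
    finally show ?thesis by (simp add: L2_inner_def add.commute)
  qed
  note t = test_function_H12_limit[OF test_function_translate[OF f, of a]]
  note fs = test_function_partial_y[OF f] test_function_partial_x[OF f] f test_function_partial_y[OF test_function_partial_y[OF f]]
  show ?thesis
    unfolding energy_eq[OF t t] energy_eq[OF test_function_H12_limit[OF f] test_function_H12_limit[OF f]]
    using fs by (simp add: partial_translate tr test_function_square_integrable)
qed

end

context nonlinear_equation
begin

lemma Lp_power_translate:
  assumes "u \<in> borel_measurable borel"
  shows "Lp_power (\<lambda>z. u (z + a)) = Lp_power u"
proof -
  have "(LINT z|lborel. cmod (u z) powr p) = (LINT z|distr lborel borel ((+) a). cmod (u z) powr p)"
    by (simp add: lborel_distr_plus)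
  also have "\<dots> = (LINT z|lborel. cmod (u (a + z)) powr p)"
    using assms by (intro integral_distr) auto
  finally show ?thesis by (simp add: Lp_power_def add.commute)
qed

definition best_const :: real where
  "best_const = (SUP \<phi>\<in>{\<phi>. test_function \<phi> \<and> energy \<omega> \<phi> \<phi> \<le> 1}. Lp_power \<phi>)"

lemma Lp_power_le:
  assumes u: "u \<in> H12" and e: "energy \<omega> u u \<le> 1" and M: "AE z in lborel. cmod (u z) \<le> M"
  shows "Lp_power u \<le> M powr (p - 2) / \<omega>"
proof -
  have "Lp_power u \<le> M powr (p - 2) * L2_inner u u"
    using bounded_Lp_power(2)[OF H12_square_integrable[OF u] M] .
  also have "\<dots> \<le> M powr (p - 2) * (1 / \<omega>)"
    using L2_inner_le_energy[OF u] e \<omega> by (intro mult_left_mono) (auto simp: field_simps)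
  finally show ?thesis by simp
qed

lemma Lp_power_test_bdd_above: "bdd_above (Lp_power ` {\<phi>. test_function \<phi> \<and> energy \<omega> \<phi> \<phi> \<le> 1})"
proof (rule bdd_aboveI2)
  fix \<phi> assume "\<phi> \<in> {\<phi>. test_function \<phi> \<and> energy \<omega> \<phi> \<phi> \<le> 1}"
  then have t: "test_function \<phi>" and e: "energy \<omega> \<phi> \<phi> \<le> 1" by auto
  have "H.nrm \<phi> \<le> 1" using e by (simp add: H.nrm_def)
  then have "sup_const * H.nrm \<phi> \<le> sup_const * 1"
    using sup_const_pos by (intro mult_left_mono) auto
  then have "cmod (\<phi> z) \<le> sup_const" for z
    using test_function_sup_bound[OF t, of z] by simp
  then show "Lp_power \<phi> \<le> sup_const powr (p - 2) / \<omega>"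
    by (intro Lp_power_le[OF test_function_H12[OF t] e]) simp
qed

lemma Lp_power_le_best_const:
  "test_function \<phi> \<Longrightarrow> energy \<omega> \<phi> \<phi> \<le> 1 \<Longrightarrow> Lp_power \<phi> \<le> best_const"
  unfolding best_const_def by (rule cSUP_upper[OF _ Lp_power_test_bdd_above]) simp

lemma continuous_Lp_power_pos:
  assumes u: "u \<in> HC" and z: "u z \<noteq> 0"
  shows "Lp_power u > 0"
proof (rule ccontr)
  assume "\<not> Lp_power u > 0"
  moreover have "Lp_power u \<ge> 0"
    unfolding Lp_power_def by (rule integral_nonneg_AE) simp
  ultimately have "Lp_power u = 0" by linarith
  then have "(LINT z|lborel. cmod (u z) powr p) = 0"
    unfolding Lp_power_def .
  then have "AE z in lborel. cmod (u z) powr p = 0"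
    using integral_nonneg_eq_0_iff_AE[OF H12_Lp_integrable[OF HC_subset_H12[OF u]]] by simp
  then have "AE z in lborel. cmod (u z) \<le> 0" by simp
  then have "cmod (u z) \<le> 0"
    using u by (intro continuous_le_if_AE_le[of "\<lambda>z. cmod (u z)"]) (auto simp: HC_def intro: continuous_intros)
  then show False using z by simp
qed

lemma best_const_pos: "best_const > 0"
proof -
  obtain f where f: "test_function f" "f 0 \<noteq> 0"
    using nonzero_test_function_exists by blast
  have n: "H.nrm f > 0"
  proof (rule ccontr)
    assume "\<not> H.nrm f > 0"
    then have "sup_const * H.nrm f \<le> 0"
      using sup_const_pos by (simp add: mult_nonneg_nonpos)
    then have "cmod (f 0) \<le> 0"
      using test_function_sup_bound[OF f(1), of 0] by linarith
    then show False using f(2) by simp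
  qed
  note t = test_function_normalize[OF f(1) order_refl n]
  have "Lp_power ((1 / H.nrm f) *\<^sub>R f) > 0"
    using f n by (intro continuous_Lp_power_pos[of _ 0] test_function_HC t) (simp add: scaleR_fun_def)
  then show ?thesis
    using Lp_power_le_best_const[OF t] by linarith
qed

lemma Lp_power_le_test:
  assumes t: "test_function \<phi>" and s: "H.nrm \<phi> \<le> s" "s > 0"
  shows "Lp_power \<phi> \<le> best_const * s powr p"
proof -
  have "Lp_power ((1 / s) *\<^sub>R \<phi>) \<le> best_const"
    using Lp_power_le_best_const[OF test_function_normalize[OF assms]] .
  then have "(1 / s) powr p * Lp_power \<phi> \<le> best_const"
    using s by (simp add: Lp_power_scale)
  then show ?thesis
    using s by (simp add: powr_divide field_simps)
qed

text \<open>
  Homogeneity gives the inequality for test functions. In the limit only a lower bound for \<open>N(\<phi>\<^sub>n)\<close> is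
  required, and convexity provides it. The slack \<open>d\<close> gives a common positive bound for the norms of the
  approximations, also if \<open>H.nrm u = 0\<close>.
\<close>

lemma Lp_power_Sobolev:
  assumes u: "u \<in> H12"
  shows "Lp_power u \<le> best_const * H.nrm u powr p"
proof -
  obtain \<phi> where t: "\<And>n. test_function (\<phi> n)" and l: "(\<lambda>n. H.nrm (\<phi> n - u)) \<longlonglongrightarrow> 0"
    using H12_approximation[OF u] by blast
  have bound: "Lp_power u \<le> best_const * (H.nrm u + d) powr p" if d: "d > 0" for d
  proof -
    have "(\<lambda>n. pairing u (\<phi> n)) \<longlonglongrightarrow> pairing u u"
      by (rule pairing_tendsto[OF u test_function_H12[OF t] u l])
    then have "(\<lambda>n. best_const * (H.nrm u + d) powr p + p * (pairing u u - pairing u (\<phi> n)))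
        \<longlonglongrightarrow> best_const * (H.nrm u + d) powr p + p * (pairing u u - pairing u u)"
      by (intro tendsto_intros)
    moreover have "\<forall>\<^sub>F n in sequentially. Lp_power u
        \<le> best_const * (H.nrm u + d) powr p + p * (pairing u u - pairing u (\<phi> n))"
      using order_tendstoD(2)[OF l d]
    proof eventually_elim
      case (elim n)
      have "H.nrm (\<phi> n) \<le> H.nrm u + d"
        using H.nrm_triangle[of "\<phi> n - u" u] t u elim by (simp add: test_function_H12)
      then have "Lp_power (\<phi> n) \<le> best_const * (H.nrm u + d) powr p"
        using d H.nrm_nonneg[OF u] by (intro Lp_power_le_test[OF t]) auto
      then show ?case
        using pairing_le[OF u test_function_H12[OF t], of n] by (simp add: pairing_self algebra_simps)
    qed
    ultimately show ?thesis
      using tendsto_lowerbound[of _ _ sequentially "Lp_power u"] by fastforce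
  qed
  have "((\<lambda>d. best_const * (H.nrm u + d) powr p) \<longlongrightarrow> best_const * (H.nrm u + 0) powr p) (at_right 0)"
  proof (intro tendsto_mult_left tendsto_powr')
    have "\<forall>\<^sub>F d in at_right 0. 0 \<le> H.nrm u + d"
      using H.nrm_nonneg[OF u] by (auto simp: eventually_at_filter)
    then show "H.nrm u + 0 \<noteq> 0 \<or> 0 < p \<and> (\<forall>\<^sub>F d in at_right 0. 0 \<le> H.nrm u + d)"
      using p by simp
  qed (intro tendsto_intros)+
  then show ?thesis
    using tendsto_lowerbound[of "\<lambda>d. best_const * (H.nrm u + d) powr p" _ "at_right 0" "Lp_power u"] bound
    by (auto simp: eventually_at_filter)
qed

text \<open>
  The sharp bound is \<open>S\<close> times the norm of \<open>w\<close>. The larger number \<open>s = (1 + E(w, w))/2\<close> is smooth in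
  \<open>w\<close>, never zero, and has the same first order expansion at elements of norm one.
\<close>

lemma pairing_test_le:
  assumes \<phi>: "test_function \<phi>" "energy \<omega> \<phi> \<phi> \<le> 1" and w: "test_function w"
  shows "pairing \<phi> w \<le> best_const * ((1 + energy \<omega> w w) / 2)"
proof -
  define s where "s = (1 + energy \<omega> w w) / 2"
  have wH: "w \<in> H12" and \<phi>H: "\<phi> \<in> H12"
    using w \<phi> test_function_H12 by auto
  have s: "s > 0" "H.nrm w \<le> s"
  proof -
    show "s > 0" using H.nonneg[OF wH] by (simp add: s_def add_pos_nonneg)
    have "0 \<le> (H.nrm w - 1)\<^sup>2" by simp
    then show "H.nrm w \<le> s"
      unfolding s_def H.nrm_square[OF wH, symmetric] by (simp add: power2_diff)
  qed
  note n = test_function_normalize[OF w s(2,1)]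
  have "p * pairing \<phi> ((1 / s) *\<^sub>R w) \<le> (p - 1) * Lp_power \<phi> + Lp_power ((1 / s) *\<^sub>R w)"
    by (rule pairing_le[OF \<phi>H test_function_H12[OF n(1)]])
  also have "\<dots> \<le> (p - 1) * best_const + best_const"
    using p by (intro add_mono mult_left_mono Lp_power_le_best_const n \<phi>) auto
  finally have "p * (pairing \<phi> w / s) \<le> p * best_const"
    using pairing_linear(3)[OF \<phi>H wH wH, of "1 / s"] by (simp add: algebra_simps)
  then have "pairing \<phi> w / s \<le> best_const"
    by (rule mult_left_le_imp_le) (use p in simp)
  then show ?thesis
    using s by (simp add: s_def[symmetric] field_simps)
qed

text \<open>
  If \<open>|\<psi>| \<le> c\<close> everywhere, then \<open>N(\<psi>) \<le> c\<^sup>p\<^sup>-\<^sup>2 / \<omega>\<close>. The choice of \<open>c\<close> makes this \<open>S/2\<close>, so functions with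
  larger values of \<open>N\<close> exceed \<open>c\<close> somewhere, and a translation moves such a point to the origin.
\<close>

lemma maximizing_sequence:
  obtains \<phi> c where "\<And>n. test_function (\<phi> n)" "\<And>n. energy \<omega> (\<phi> n) (\<phi> n) \<le> 1"
    "(\<lambda>n. Lp_power (\<phi> n)) \<longlonglongrightarrow> best_const" "c > 0" "\<And>n :: nat. c \<le> cmod (\<phi> n 0)"
proof -
  define c where "c = (best_const * \<omega> / 2) powr (1 / (p - 2))"
  have c: "c > 0" "c powr (p - 2) = best_const * \<omega> / 2"
    using best_const_pos \<omega> p by (auto simp: c_def powr_powr)
  have ex: "\<exists>\<phi>. test_function \<phi> \<and> energy \<omega> \<phi> \<phi> \<le> 1 \<and> best_const - best_const / 2 * inverse (real (Suc n)) < Lp_power \<phi> \<and> c \<le> cmod (\<phi> 0)" for n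
  proof -
    let ?D = "{\<phi>. test_function \<phi> \<and> energy \<omega> \<phi> \<phi> \<le> 1}"
    have ne: "?D \<noteq> {}"
    proof -
      have "test_function 0"
        using nonzero_test_function_exists test_function_scale'[of _ 0] by fastforce
      moreover have "energy \<omega> 0 0 = 0"
        using H.scale_left[of 0 0 0] by simp
      ultimately show ?thesis by auto
    qed
    have "best_const - best_const / 2 * inverse (real (Suc n)) < best_const"
      using best_const_pos by simp
    then obtain \<psi> where \<psi>: "test_function \<psi>" "energy \<omega> \<psi> \<psi> \<le> 1"
      and big: "best_const - best_const / 2 * inverse (real (Suc n)) < Lp_power \<psi>"
      using less_cSUP_iff[OF ne Lp_power_test_bdd_above] unfolding best_const_def by auto
    have "inverse (real (Suc n)) \<le> 1" by (simp add: field_simps)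
    then have "best_const / 2 * inverse (real (Suc n)) \<le> best_const / 2 * 1"
      using best_const_pos by (intro mult_left_mono) auto
    then have half: "best_const / 2 < Lp_power \<psi>"
      using big by linarith
    have "\<exists>z. c \<le> cmod (\<psi> z)"
    proof (rule ccontr)
      assume "\<not> ?thesis"
      then have "AE z in lborel. cmod (\<psi> z) \<le> c" by (auto simp: not_le intro!: AE_I2 less_imp_le)
      from Lp_power_le[OF test_function_H12[OF \<psi>(1)] \<psi>(2) this] show False
        using half \<omega> by (simp add: c(2))
    qed
    then obtain a where "c \<le> cmod (\<psi> a)" by blast
    then show ?thesis
      using \<psi> big test_function_translate[OF \<psi>(1), of a] energy_translate[OF \<psi>(1), of a]
        Lp_power_translate[OF borel_measurable_continuous_onI[OF test_function_continuous[OF \<psi>(1)]], of a]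
      by (intro exI[of _ "\<lambda>z. \<psi> (z + a)"]) simp
  qed
  then obtain \<phi> where \<phi>: "\<And>n. test_function (\<phi> n)" "\<And>n. energy \<omega> (\<phi> n) (\<phi> n) \<le> 1"
    "\<And>n. best_const - best_const / 2 * inverse (real (Suc n)) < Lp_power (\<phi> n)" "\<And>n. c \<le> cmod (\<phi> n 0)"
    by metis
  have "(\<lambda>n. Lp_power (\<phi> n)) \<longlonglongrightarrow> best_const"
  proof (rule tendsto_sandwich[OF _ _ _ tendsto_const])
    have "(\<lambda>n. best_const - best_const / 2 * inverse (real (Suc n))) \<longlonglongrightarrow> best_const - best_const / 2 * 0"
      by (intro tendsto_intros LIMSEQ_inverse_real_of_nat)
    then show "(\<lambda>n. best_const - best_const / 2 * inverse (real (Suc n))) \<longlonglongrightarrow> best_const" by simp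
    show "\<forall>\<^sub>F n in sequentially. best_const - best_const / 2 * inverse (real (Suc n)) \<le> Lp_power (\<phi> n)"
      using \<phi>(3) less_imp_le by (intro always_eventually allI) blast
    show "\<forall>\<^sub>F n in sequentially. Lp_power (\<phi> n) \<le> best_const"
      using Lp_power_le_best_const \<phi> by (intro always_eventually allI) blast
  qed
  then show ?thesis using that \<phi> c by blast
qed

lemma pairing_pointwise_limit:
  assumes X: "\<And>n. X n \<in> HC" "\<And>n. energy \<omega> (X n) (X n) \<le> 1" and u: "u \<in> HC"
    and l: "\<And>z. (\<lambda>n. X n z) \<longlonglongrightarrow> u z" and v: "test_function v"
  shows "(\<lambda>n. pairing (X n) v) \<longlonglongrightarrow> pairing u v"
  unfolding pairing_def
proof (rule integral_dominated_convergence)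
  have Xm [measurable]: "X n \<in> borel_measurable borel" for n
    using X by (simp add: HC_def borel_measurable_continuous_onI)
  have um [measurable]: "u \<in> borel_measurable borel" and vm [measurable]: "v \<in> borel_measurable borel"
    using u test_function_continuous[OF v] by (simp_all add: HC_def borel_measurable_continuous_onI)
  show "(\<lambda>z. nonlin (u z) \<bullet> v z) \<in> borel_measurable lborel" "(\<lambda>z. nonlin (X n z) \<bullet> v z) \<in> borel_measurable lborel" for n
    by simp_all
  have "Cc (\<lambda>z. cmod (v z))"
    by (rule Cc_compose0[OF test_function_Cc[OF v]]) (auto intro: continuous_intros)
  then show "integrable lborel (\<lambda>z. sup_const powr (p - 1) * cmod (v z))"
    by (intro integrable_mult_right Cc_integrable)
  have "(\<lambda>n. nonlin (X n z) \<bullet> v z) \<longlonglongrightarrow> nonlin (u z) \<bullet> v z" for z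
    using continuous_nonlin l[of z]
    by (intro tendsto_intros continuous_on_tendsto_compose[OF continuous_nonlin]) auto
  then show "AE z in lborel. (\<lambda>n. nonlin (X n z) \<bullet> v z) \<longlonglongrightarrow> nonlin (u z) \<bullet> v z" by simp
  have "norm (nonlin (X n z) \<bullet> v z) \<le> sup_const powr (p - 1) * cmod (v z)" for n z
  proof -
    have "H.nrm (X n) \<le> 1" using X(2)[of n] by (simp add: H.nrm_def)
    then have "sup_const * H.nrm (X n) \<le> sup_const * 1"
      using sup_const_pos by (intro mult_left_mono) auto
    then have "cmod (X n z) \<le> sup_const"
      using HC_sup_bound[OF X(1), of n z] by simp
    then have "cmod (nonlin (X n z)) \<le> sup_const powr (p - 1)"
      unfolding norm_nonlin using p by (intro powr_mono2) auto
    then have "cmod (nonlin (X n z)) * cmod (v z) \<le> sup_const powr (p - 1) * cmod (v z)"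
      by (rule mult_right_mono) simp
    then show ?thesis
      using Cauchy_Schwarz_ineq2[of "nonlin (X n z)" "v z"] by simp
  qed
  then show "AE z in lborel. norm (nonlin (X n z) \<bullet> v z) \<le> sup_const powr (p - 1) * cmod (v z)" for n by simp
qed

text \<open>
  Apply \<open>pairing_test_le\<close> to \<open>u\<^sub>n\<close> and \<open>w = u\<^sub>n + t v\<close> and let \<open>n\<close> tend to infinity: the terms without \<open>t\<close>
  cancel, because \<open>N(u\<^sub>n)\<close> tends to \<open>S\<close> and \<open>E(u\<^sub>n, u\<^sub>n) \<le> 1\<close>. What remains is linear in \<open>t\<close> on the left and
  quadratic on the right, for both signs of \<open>t\<close>, so the linear part vanishes.
\<close>

theorem extremal_exists:
  obtains u where "u \<in> HC" "energy \<omega> u u = 1" "\<And>v. v \<in> H12 \<Longrightarrow> pairing u v = best_const * energy \<omega> u v"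
proof -
  obtain \<psi> c where \<psi>: "\<And>n. test_function (\<psi> n)" "\<And>n. energy \<omega> (\<psi> n) (\<psi> n) \<le> 1"
    "(\<lambda>n. Lp_power (\<psi> n)) \<longlonglongrightarrow> best_const" and c: "c > 0" "\<And>n :: nat. c \<le> cmod (\<psi> n 0)"
    using maximizing_sequence by blast
  obtain r u where r: "strict_mono r" and u: "u \<in> HC"
    and pw: "\<And>z. (\<lambda>n. \<psi> (r n) z) \<longlonglongrightarrow> u z"
    and weak: "\<And>v. v \<in> HC \<Longrightarrow> (\<lambda>n. energy \<omega> (\<psi> (r n)) v) \<longlonglongrightarrow> energy \<omega> u v"
    using HC_weak_compactness[of \<psi> 1, OF test_function_HC[OF \<psi>(1)] \<psi>(2)] by blast
  define X where "X n = \<psi> (r n)" for n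
  have X: "test_function (X n)" "energy \<omega> (X n) (X n) \<le> 1" for n
    using \<psi> by (auto simp: X_def)
  have XLp: "(\<lambda>n. Lp_power (X n)) \<longlonglongrightarrow> best_const"
    using LIMSEQ_subseq_LIMSEQ[OF \<psi>(3) r] by (simp add: X_def o_def)
  note XHC = test_function_HC[OF X(1)] and XH = test_function_H12[OF X(1)]
  have uH: "u \<in> H12" using u HC_subset_H12 by blast
  have Xn: "H.nrm (X n) \<le> 1" for n
    using X(2) by (simp add: H.nrm_def)
  have "H.nrm u \<le> 1"
  proof (rule ccontr)
    assume gt: "\<not> H.nrm u \<le> 1"
    have "energy \<omega> (X n) u \<le> H.nrm u" for n
    proof -
      have "energy \<omega> (X n) u \<le> H.nrm (X n) * H.nrm u"
        using H.Cauchy_Schwarz[OF XH uH, of n] by linarith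
      also have "\<dots> \<le> 1 * H.nrm u"
        by (intro mult_right_mono Xn H.nrm_nonneg uH)
      finally show ?thesis by simp
    qed
    then have "energy \<omega> u u \<le> H.nrm u"
      by (intro tendsto_upperbound[OF weak[OF u]]) (auto simp: X_def)
    then have "H.nrm u * H.nrm u \<le> H.nrm u * 1"
      using H.nrm_square[OF uH] by (simp add: power2_eq_square)
    then show False using gt by (subst (asm) mult_le_cancel_left_pos) auto
  qed
  have EL_test: "pairing u v = best_const * energy \<omega> u v" if v: "test_function v" for v
  proof -
    note vH = test_function_H12[OF v]
    have pw': "(\<lambda>n. pairing (X n) v) \<longlonglongrightarrow> pairing u v"
      by (rule pairing_pointwise_limit[OF XHC X(2) u _ v]) (use pw in \<open>simp add: X_def\<close>)
    have en: "(\<lambda>n. energy \<omega> (X n) v) \<longlonglongrightarrow> energy \<omega> u v"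
      using weak[OF test_function_HC[OF v]] by (simp add: X_def)
    have "t * (pairing u v - best_const * energy \<omega> u v) \<le> t\<^sup>2 * (best_const * energy \<omega> v v / 2)" for t
    proof -
      have "best_const + t * pairing u v \<le> best_const * ((2 + 2 * t * energy \<omega> u v + t\<^sup>2 * energy \<omega> v v) / 2)"
      proof (rule tendsto_le[OF _ _ tendsto_add[OF XLp tendsto_mult_left[OF pw']]])
        show "(\<lambda>n. best_const * ((2 + 2 * t * energy \<omega> (X n) v + t\<^sup>2 * energy \<omega> v v) / 2))
            \<longlonglongrightarrow> best_const * ((2 + 2 * t * energy \<omega> u v + t\<^sup>2 * energy \<omega> v v) / 2)"
          by (intro tendsto_intros en) simp
        show "\<forall>\<^sub>F n in sequentially. Lp_power (X n) + t * pairing (X n) v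
            \<le> best_const * ((2 + 2 * t * energy \<omega> (X n) v + t\<^sup>2 * energy \<omega> v v) / 2)"
        proof (rule always_eventually, rule allI)
          fix n
          let ?w = "X n + t *\<^sub>R v"
          have w: "test_function ?w"
            by (intro test_function_add' test_function_scale' X v)
          have "Lp_power (X n) + t * pairing (X n) v = pairing (X n) ?w"
            using pairing_linear[OF XH XH H.mem_simps(4)[OF vH]] pairing_linear(3)[OF XH vH vH]
            by (simp add: pairing_self)
          also have "\<dots> \<le> best_const * ((1 + energy \<omega> ?w ?w) / 2)"
            by (rule pairing_test_le[OF X w])
          also have "energy \<omega> ?w ?w = energy \<omega> (X n) (X n) + 2 * t * energy \<omega> (X n) v + t\<^sup>2 * energy \<omega> v v"
            using XH vH H.sym[OF vH XH] by (simp add: H.bilinear algebra_simps power2_eq_square)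
          also have "best_const * ((1 + \<dots>) / 2)
              \<le> best_const * ((2 + 2 * t * energy \<omega> (X n) v + t\<^sup>2 * energy \<omega> v v) / 2)"
            using X(2)[of n] best_const_pos by (intro mult_left_mono divide_right_mono) auto
          finally show "Lp_power (X n) + t * pairing (X n) v
            \<le> best_const * ((2 + 2 * t * energy \<omega> (X n) v + t\<^sup>2 * energy \<omega> v v) / 2)" .
        qed
      qed simp
      then show ?thesis by (simp add: field_simps)
    qed
    then show ?thesis
      using zero_if_linear_le_quadratic by fastforce
  qed
  have EL: "pairing u v = best_const * energy \<omega> u v" if v: "v \<in> H12" for v
  proof -
    obtain \<phi> where t: "\<And>n. test_function (\<phi> n)" and l: "(\<lambda>n. H.nrm (\<phi> n - v)) \<longlonglongrightarrow> 0"
      using H12_approximation[OF v] by blast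
    have "(\<lambda>n. pairing u (\<phi> n)) \<longlonglongrightarrow> pairing u v"
      by (rule pairing_tendsto[OF uH test_function_H12[OF t] v l])
    moreover have "(\<lambda>n. best_const * energy \<omega> u (\<phi> n)) \<longlonglongrightarrow> best_const * energy \<omega> u v"
      by (intro tendsto_mult_left H.tendsto_B) (use uH v l t test_function_H12 in auto)
    ultimately show ?thesis
      using LIMSEQ_unique by (simp add: EL_test[OF t])
  qed
  have u0: "u 0 \<noteq> 0"
  proof -
    have "c \<le> cmod (u 0)"
      by (rule tendsto_lowerbound[OF tendsto_norm[OF pw[of 0]]]) (use c in auto)
    then show ?thesis using c by auto
  qed
  have pos: "H.nrm u > 0"
    using HC_sup_bound[OF u, of 0] u0 H.nrm_nonneg[OF uH] by (cases "H.nrm u = 0") auto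
  have "best_const * (H.nrm u)\<^sup>2 = Lp_power u"
    using EL[OF uH] by (simp add: pairing_self H.nrm_square[OF uH])
  also have "\<dots> \<le> best_const * H.nrm u powr p"
    by (rule Lp_power_Sobolev[OF uH])
  finally have "H.nrm u powr 2 \<le> H.nrm u powr p"
    using best_const_pos pos by simp
  then have "H.nrm u \<ge> 1"
  proof -
    have "H.nrm u powr p < H.nrm u powr 2" if "H.nrm u < 1"
      using powr_less_mono'[of "H.nrm u" 2 p] that pos p by simp
    then show ?thesis using \<open>H.nrm u powr 2 \<le> H.nrm u powr p\<close> by linarith
  qed
  then have "energy \<omega> u u = 1"
    using \<open>H.nrm u \<le> 1\<close> H.nrm_square[OF uH] by simp
  then show ?thesis using that u EL by blast
qed

section \<open>Ground states\<close>

lemma J_expansion: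
  assumes u: "u \<in> H12" and v: "v \<in> H12" and EL: "pairing u v = energy \<omega> u v"
    and M: "sup_const * (H.nrm u + H.nrm v) \<le> M"
  shows "\<bar>J \<omega> p (u + v) - J \<omega> p u\<bar> \<le> (1 / 2 + p * M powr (p - 2) / \<omega>) * (H.nrm v)\<^sup>2"
proof -
  have e: "energy \<omega> (u + v) (u + v) = energy \<omega> u u + 2 * energy \<omega> u v + energy \<omega> v v"
    using u v H.sym[OF v u] by (simp add: H.bilinear)
  have "J \<omega> p (u + v) - J \<omega> p u = energy \<omega> v v / 2 - (Lp_power (u + v) - Lp_power u - p * pairing u v) / p"
    unfolding J_eq e EL using p by (simp add: field_simps)
  also have "\<bar>\<dots>\<bar> \<le> energy \<omega> v v / 2 + \<bar>Lp_power (u + v) - Lp_power u - p * pairing u v\<bar> / p"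
    using abs_triangle_ineq4[of "energy \<omega> v v / 2" "(Lp_power (u + v) - Lp_power u - p * pairing u v) / p"]
      H.nonneg[OF v] p by (simp add: abs_divide)
  also have "\<dots> \<le> energy \<omega> v v / 2 + p\<^sup>2 * M powr (p - 2) * L2_inner v v / p"
    using Lp_power_second_order[OF u v M] p by (intro add_left_mono divide_right_mono) auto
  also have "\<dots> = energy \<omega> v v / 2 + p * M powr (p - 2) * L2_inner v v"
    using p by (simp add: power2_eq_square)
  also have "\<dots> \<le> energy \<omega> v v / 2 + p * M powr (p - 2) * (energy \<omega> v v / \<omega>)"
    using L2_inner_le_energy[OF v] \<omega> p by (intro add_left_mono mult_left_mono) (auto simp: field_simps)
  also have "\<dots> = (1 / 2 + p * M powr (p - 2) / \<omega>) * (H.nrm v)\<^sup>2"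
    by (simp add: H.nrm_square[OF v] algebra_simps)
  finally show ?thesis .
qed

text \<open>
  The factor \<open>1 + sqrt \<omega>\<close> passes from the energy norm to \<open>H12_norm\<close>; the bound \<open>1/A\<close> on \<open>\<delta>\<close> keeps the
  energy norm of \<open>v\<close> below one, which makes the constant in \<open>J_expansion\<close> uniform.
\<close>

lemma solutionI:
  assumes u: "u \<in> H12" and EL: "\<And>v. v \<in> H12 \<Longrightarrow> pairing u v = energy \<omega> u v"
  shows "solution \<omega> p u"
  unfolding solution_def
proof (intro conjI allI impI u)
  fix \<epsilon> :: real assume \<epsilon>: "\<epsilon> > 0"
  define A where "A = 1 + sqrt \<omega>"
  define C where "C = 1 / 2 + p * (sup_const * (H.nrm u + 1)) powr (p - 2) / \<omega>"
  have A: "A > 0" using \<omega> by (simp add: A_def add_pos_pos)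
  have C: "C > 0" using p \<omega> by (simp add: C_def add_pos_nonneg)
  define \<delta> where "\<delta> = min (1 / A) (\<epsilon> / (C * A\<^sup>2))"
  have "\<delta> > 0" using A C \<epsilon> by (simp add: \<delta>_def)
  moreover have "\<bar>J \<omega> p (\<lambda>z. u z + v z) - J \<omega> p u\<bar> \<le> \<epsilon> * H12_norm v" if v: "v \<in> H12" and small: "H12_norm v < \<delta>" for v
  proof -
    have le: "H.nrm v \<le> A * H12_norm v"
      using energy_nrm_le_H12_norm[OF v] by (simp add: A_def)
    have "A * H12_norm v \<le> 1"
      using small A by (simp add: \<delta>_def field_simps)
    then have "H.nrm v \<le> 1" using le by linarith
    then have M: "sup_const * (H.nrm u + H.nrm v) \<le> sup_const * (H.nrm u + 1)"
      using sup_const_pos by (intro mult_left_mono) auto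
    have "\<bar>J \<omega> p (u + v) - J \<omega> p u\<bar> \<le> C * (H.nrm v)\<^sup>2"
      unfolding C_def by (rule J_expansion[OF u v EL[OF v] M])
    also have "\<dots> \<le> C * (A * H12_norm v)\<^sup>2"
      using C le H.nrm_nonneg[OF v] by (intro mult_left_mono power_mono) auto
    also have "\<dots> = (C * A\<^sup>2 * H12_norm v) * H12_norm v"
      by (simp add: power2_eq_square)
    also have "\<dots> \<le> \<epsilon> * H12_norm v"
    proof (rule mult_right_mono)
      have "H12_norm v \<le> \<epsilon> / (C * A\<^sup>2)" using small by (simp add: \<delta>_def)
      then show "C * A\<^sup>2 * H12_norm v \<le> \<epsilon>"
        using A C by (simp add: field_simps)
    qed (rule H12_norm_nonneg[OF v])
    finally show ?thesis by (simp add: plus_fun_def)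
  qed
  ultimately show "\<exists>\<delta>>0. \<forall>v\<in>H12. H12_norm v < \<delta> \<longrightarrow> \<bar>J \<omega> p (\<lambda>z. u z + v z) - J \<omega> p u\<bar> \<le> \<epsilon> * H12_norm v"
    by blast
qed

text \<open>
  Along the ray \<open>(1 + t) v\<close> the functional is an explicit function of \<open>t\<close> with derivative
  \<open>E(v, v) - N(v)\<close> at zero, and the derivative vanishes at a critical point.
\<close>

lemma solution_Nehari:
  assumes sol: "solution \<omega> p v"
  shows "energy \<omega> v v = Lp_power v"
proof -
  have v: "v \<in> H12" using sol by (simp add: solution_def)
  define g where "g t = J \<omega> p (v + t *\<^sub>R v)" for t
  have g: "g t = (1 + t)\<^sup>2 / 2 * energy \<omega> v v - \<bar>1 + t\<bar> powr p / p * Lp_power v" for t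
  proof -
    have "v + t *\<^sub>R v = (1 + t) *\<^sub>R v" by (simp add: scaleR_add_left)
    then show ?thesis
      using v by (simp add: g_def J_eq Lp_power_scale H.bilinear power2_eq_square)
  qed
  have "(g has_field_derivative (energy \<omega> v v - Lp_power v)) (at 0)"
  proof -
    have "((\<lambda>t. (1 + t)\<^sup>2 / 2 * energy \<omega> v v - (1 + t) powr p / p * Lp_power v) has_field_derivative
        (energy \<omega> v v - Lp_power v)) (at 0)"
      using p by (auto intro!: derivative_eq_intros)
    then show ?thesis
    proof (rule has_field_derivative_transform_within_open[of _ _ _ "{-1<..}"])
      fix t :: real assume "t \<in> {-1<..}"
      then show "(1 + t)\<^sup>2 / 2 * energy \<omega> v v - (1 + t) powr p / p * Lp_power v = g t"
        by (simp add: g)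
    qed auto
  qed
  moreover have "(g has_field_derivative 0) (at 0)"
    unfolding DERIV_def
  proof (rule LIM_I)
    fix e :: real assume e: "e > 0"
    define H where "H = H12_norm v"
    have H: "H \<ge> 0" using H12_norm_nonneg[OF v] by (simp add: H_def)
    have "e / (H + 1) > 0" using e H by simp
    then obtain \<delta> where \<delta>: "\<delta> > 0" "\<And>w. w \<in> H12 \<Longrightarrow> H12_norm w < \<delta> \<Longrightarrow>
        \<bar>J \<omega> p (\<lambda>z. v z + w z) - J \<omega> p v\<bar> \<le> e / (H + 1) * H12_norm w"
      using sol unfolding solution_def by blast
    have "norm ((g (0 + t) - g 0) / t - 0) < e" if t: "t \<noteq> 0" "norm (t - 0) < \<delta> / (H + 1)" for t
    proof -
      have n: "H12_norm (t *\<^sub>R v) = \<bar>t\<bar> * H"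
        using H12_norm_scale[OF v] by (simp add: H_def)
      have "\<bar>t\<bar> * H \<le> \<bar>t\<bar> * (H + 1)" by (intro mult_left_mono) auto
      also have "\<dots> < \<delta>" using t H by (simp add: field_simps)
      finally have "\<bar>J \<omega> p (\<lambda>z. v z + (t *\<^sub>R v) z) - J \<omega> p v\<bar> \<le> e / (H + 1) * (\<bar>t\<bar> * H)"
        using \<delta>(2)[OF H12_scale[OF v, of t]] n by simp
      then have "\<bar>g t - g 0\<bar> \<le> \<bar>t\<bar> * (e / (H + 1) * H)"
        by (simp add: g_def plus_fun_def zero_fun_def scaleR_fun_def algebra_simps)
      also have "\<dots> < \<bar>t\<bar> * e"
        using t e H by (intro mult_strict_left_mono) (auto simp: field_simps)
      finally show ?thesis
        using t by (simp add: field_simps abs_divide)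
    qed
    then show "\<exists>s>0. \<forall>t. t \<noteq> 0 \<and> norm (t - 0) < s \<longrightarrow> norm ((g (0 + t) - g 0) / t - 0) < e"
      using \<delta>(1) H by (intro exI[of _ "\<delta> / (H + 1)"]) auto
  qed
  ultimately show ?thesis
    using DERIV_unique by fastforce
qed

lemma nontrivial_solution_energy:
  assumes "nontrivial_solution \<omega> p v"
  shows "J \<omega> p v = (1 / 2 - 1 / p) * energy \<omega> v v" "best_const powr (- 1 / (p - 2)) \<le> H.nrm v"
proof -
  have sol: "solution \<omega> p v" and nz: "\<not> (AE z in lborel. v z = 0)"
    using assms by (auto simp: nontrivial_solution_def)
  have v: "v \<in> H12" using sol by (simp add: solution_def)
  note N = solution_Nehari[OF sol]
  show "J \<omega> p v = (1 / 2 - 1 / p) * energy \<omega> v v"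
    by (simp add: J_eq N[symmetric] algebra_simps)
  have pos: "H.nrm v > 0"
  proof (rule ccontr)
    assume "\<not> H.nrm v > 0"
    then have "H.nrm v = 0" using H.nrm_nonneg[OF v] by simp
    then show False using H12_sup_bound_AE[OF v] nz by simp
  qed
  have "H.nrm v powr 2 \<le> best_const * H.nrm v powr p"
    using Lp_power_Sobolev[OF v] pos by (simp add: N[symmetric] H.nrm_square[OF v])
  also have "H.nrm v powr p = H.nrm v powr 2 * H.nrm v powr (p - 2)"
    by (simp flip: powr_add)
  finally have "H.nrm v powr 2 * 1 \<le> H.nrm v powr 2 * (best_const * H.nrm v powr (p - 2))"
    by (simp add: algebra_simps)
  then have "1 \<le> best_const * H.nrm v powr (p - 2)"
    using pos by (subst (asm) mult_le_cancel_left_pos) auto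
  then have "best_const powr (-1) \<le> H.nrm v powr (p - 2)"
    using best_const_pos by (simp add: powr_minus field_simps)
  then have "(best_const powr (-1)) powr (1 / (p - 2)) \<le> (H.nrm v powr (p - 2)) powr (1 / (p - 2))"
    using p by (intro powr_mono2) auto
  moreover have "(best_const powr (-1)) powr (1 / (p - 2)) = best_const powr (- 1 / (p - 2))"
    by (simp only: powr_powr) simp
  moreover have "(H.nrm v powr (p - 2)) powr (1 / (p - 2)) = H.nrm v"
    using p pos by (simp add: powr_powr)
  ultimately show "best_const powr (- 1 / (p - 2)) \<le> H.nrm v"
    by simp
qed

text \<open>
  The scaling constant \<open>c\<close> satisfies \<open>c\<^sup>p\<^sup>-\<^sup>2 S = 1\<close>, which turns the multiplier \<open>S\<close> in the equation of the
  extremal into one. It is at the same time the lower bound in \<open>nontrivial_solution_energy\<close>.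
\<close>

theorem ground_state_exists: "\<exists>u. ground_state \<omega> p u"
proof -
  obtain u where u: "u \<in> HC" "energy \<omega> u u = 1"
    and EL: "\<And>v. v \<in> H12 \<Longrightarrow> pairing u v = best_const * energy \<omega> u v"
    using extremal_exists by blast
  have uH: "u \<in> H12" using u HC_subset_H12 by blast
  define c where "c = best_const powr (- 1 / (p - 2))"
  have c: "c > 0" using best_const_pos by (simp add: c_def)
  have cp: "c powr (p - 1) * best_const = c"
  proof -
    have "c powr (p - 2) = best_const powr (-1)"
      using p by (simp add: c_def powr_powr)
    then have "c powr (p - 2) * best_const = 1"
      using best_const_pos by (simp add: powr_minus)
    moreover have "c powr (p - 1) = c powr (p - 2) * c"
      using c powr_add[of c "p - 2" 1] by simp
    ultimately show ?thesis by (simp add: algebra_simps)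
  qed
  define w where "w = c *\<^sub>R u"
  have w: "w \<in> H12" using uH by (simp add: w_def)
  have "pairing w v = energy \<omega> w v" if v: "v \<in> H12" for v
  proof -
    have "pairing w v = c powr (p - 1) * best_const * energy \<omega> u v"
      using pairing_scale_left[of c u v] c EL[OF v] by (simp add: w_def)
    also have "\<dots> = energy \<omega> w v"
      unfolding cp w_def using uH v by (simp add: H.bilinear)
    finally show ?thesis .
  qed
  then have sol: "solution \<omega> p w"
    using w by (intro solutionI) auto
  have ew: "energy \<omega> w w = c\<^sup>2"
    using uH u by (simp add: w_def H.bilinear power2_eq_square)
  have "\<not> (AE z in lborel. w z = 0)"
  proof
    assume ae: "AE z in lborel. w z = 0"
    then have "AE z in lborel. cmod (w z) powr p = 0"
      by eventually_elim simp
    then have "Lp_power w = 0"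
      unfolding Lp_power_def by (rule integral_eq_zero_AE)
    then show False
      using solution_Nehari[OF sol] ew c by simp
  qed
  then have ns: "nontrivial_solution \<omega> p w"
    using sol by (simp add: nontrivial_solution_def)
  have "J \<omega> p w \<le> J \<omega> p v" if v: "nontrivial_solution \<omega> p v" for v
  proof -
    have vH: "v \<in> H12" using v by (simp add: nontrivial_solution_def solution_def)
    have "c\<^sup>2 \<le> (H.nrm v)\<^sup>2"
      using nontrivial_solution_energy(2)[OF v] c by (intro power_mono) (auto simp: c_def)
    then have "energy \<omega> w w \<le> energy \<omega> v v"
      by (simp add: ew H.nrm_square[OF vH])
    then have "(1 / 2 - 1 / p) * energy \<omega> w w \<le> (1 / 2 - 1 / p) * energy \<omega> v v"
      using p by (intro mult_left_mono) (auto simp: field_simps)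
    then show ?thesis
      using nontrivial_solution_energy(1)[OF v] nontrivial_solution_energy(1)[OF ns] by simp
  qed
  then show ?thesis
    using ns unfolding ground_state_def by blast
qed

end

theorem theorem1p2:
  fixes p \<omega> :: real
  assumes "p > 2" and "\<omega> > 0"
  shows "\<exists>u. ground_state \<omega> p u"
proof -
  interpret nonlinear_equation \<omega> p
    using assms by unfold_locales
  show ?thesis by (rule ground_state_exists)
qed

end
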